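(* Let $\mathcal{C}$ be a category. For any set-valued functors $F,G,H:\mathcal{C}\to\mathcal{S}$ there are morphisms of locales $$lFunc(F,G)\xrightarrow{m^*}lFunc(F,H)\otimes lFunc(H,G),\qquad lFunc(F,F)\xrightarrow{e^*}2$$ defined on the generators by $$m^*[(X,\langle x|y\rangle)]=(\lambda_X^*\otimes\lambda_X^* )\,m_X^*[\langle x|y\rangle],\qquad e^*[(X,\langle x|y\rangle)]=e_X^*[\langle x|y\rangle].$$ These data satisfy the equations of an enrichment of the functor category $\mathcal{S}^{\mathcal{C}}$ over the category of localic spaces, denoted $lFunc(\mathcal{S}^{\mathcal{C}})$. For each $X\in\mathcal{C}$ the evaluation functor $ev_X:\mathcal{S}^{\mathcal{C}}\to\mathcal{S}$, $ev_X(F)=FX$, becomes a functor for the enriched structures (given on hom-spaces by $\lambda_X^*$), and $X\mapsto ev_X$ defines an ordinary functor $\mu^*:\mathcal{C}\to l\mathcal{S}^{lFunc(\mathcal{S}^{\mathcal{C}})}$ into the ordinary category of enriched functors $lFunc(\mathcal{S}^{\mathcal{C}})\to l\mathcal{S}$. The same formulae, together with $\iota^*[(X,\langle x|y\rangle)]=\lambda_X^*\iota_X^*[\langle x|y\rangle]$, also define morphisms of locales $$lBij(F,G)\xrightarrow{m^*}lBij(F,H)\otimes lBij(H,G),\quad lBij(F,F)\xrightarrow{e^*}2,\quad lBij(F,G)\xrightarrow{\iota^*}lBij(G,F),$$ which determine a structure of localic groupoid on the (discrete) set of objects of $\mathcal{S}^{\mathcal{C}}$, denoted $lBij(\mathcal{S}^{\mathcal{C}})$.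 As before, evaluation becomes enriched and $X\mapsto ev_X$ defines an ordinary functor $\mu^*:\mathcal{C}\to l\mathcal{S}^{lBij(\mathcal{S}^{\mathcal{C}})}$ into the ordinary category of enriched functors.
   Context: $\mathcal{S}$ is the category of sets. A locale is a complete lattice in which finite infima distribute over arbitrary suprema; morphisms of locales preserve finite infima and arbitrary suprema. The category of localic spaces is the opposite of the category of locales; $\otimes$ is the coproduct of locales (product of spaces), and $2=\{0,1\}$ is the terminal localic space. For sets $X,Y$: $lFunc(X,Y)$ is the locale with generators $[\langle x|y\rangle]$ ($x\in X$, $y\in Y$) subject to (u) $[\langle z|x\rangle]\wedge[\langle z|y\rangle]=0$ for $z\in X$, $x\neq y\in Y$, and (e) $\bigvee_{x\in Y}[\langle z|x\rangle]=1$ for $z\in X$. $lBij(X,Y)$ is obtained by adding (i) $[\langle x|z\rangle]\wedge[\langle y|z\rangle]=0$ for $x\neq y\in X$, $z\in Y$, and (s) $\bigvee_{x\in X}[\langle x|z\rangle]=1$ for $z\in Y$. Sets form a category $l\mathcal{S}$ enriched over localic spaces, with hom-spaces $lFunc(X,Y)$ and structure $m^*[\langle x|y\rangle]=\bigvee_z[\langle x|z\rangle]\otimes[\langle z|y\rangle]$, $e^*[\langle x|y\rangle]=1\Leftrightarrow x=y$; similarly the $lBij(X,Y)$ form a localic groupoid with in addition $\iota^*[\langle x|y\rangle]=[\langle y|x\rangle]$. For functors $F,G:\mathcal{C}\to\mathcal{S}$: $lFunc(F,G)$ is the locale with generators $[(X,\langle x|y\rangle)]$ ($X\in\mathcal{C}$,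 $x\in FX$, $y\in GX$) subject to $[(X,\langle x|y\rangle)]\leq[(Y,\langle F(f)x|G(f)y\rangle)]$ for each $f:X\to Y$ in $\mathcal{C}$, and, for each $X$, relations (u) and (e) for the $[(X,\langle x|y\rangle)]$; $lBij(F,G)$ is obtained by adding, for each $X$, relations (i) and (s). (In the paper these generators are written $\#[(X,\langle x|y\rangle)]$, $\#$ being the associated sheaf.) For $X\in\mathcal{C}$, $\lambda_X^*:lFunc(FX,GX)\to lFunc(F,G)$ and $\lambda_X^*:lBij(FX,GX)\to lBij(F,G)$ are the morphisms of locales with $\lambda_X^*[\langle x|y\rangle]=[(X,\langle x|y\rangle)]$. $m_X^*$, $e_X^*$, $\iota_X^*$ are the structure morphisms above for the sets $FX,GX,HX$. A localic groupoid with discrete set of objects is a groupoid enriched in localic spaces. Natural transformations between enriched functors $P,Q$ into $l\mathcal{S}$ are families of functions $t_F:PF\to QF$ with $\mu^*[\langle x|y\rangle]\leq\mu^*[\langle t_Fx|t_Gy\rangle]$, where $\mu^*$ denotes the respective structure maps. Usual size conventions apply (e.g. $\mathcal{C}$ small). *)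

theory Defs
  imports "HOL-Algebra.Complete_Lattice" "HOL-Library.FuncSet"
begin

section \<open>Locales and their morphisms\<close>

text \<open>All arrows between localic spaces are written as the corresponding morphisms of locales
  (inverse images), hence in the opposite direction. Morphisms are extensional functions on
  carriers, so that two morphisms are equal iff they agree on the carrier.\<close>

locale frame_lattice = complete_lattice L for L (structure) +
  assumes meet_Sup_distrib:
    "\<lbrakk>x \<in> carrier L; A \<subseteq> carrier L\<rbrakk> \<Longrightarrow> x \<sqinter> \<Squnion>A = \<Squnion>((\<lambda>a. x \<sqinter> a) ` A)"

definition frame_homs :: "'a gorder \<Rightarrow> 'b gorder \<Rightarrow> ('a \<Rightarrow> 'b) set" where
  "frame_homs L M =
    {h \<in> carrier L \<rightarrow>\<^sub>E carrier M.
      (\<forall>A. A \<subseteq> carrier L \<longrightarrow> finite A \<longrightarrow> h (\<Sqinter>\<^bsub>L\<^esub>A) = \<Sqinter>\<^bsub>M\<^esub>(h ` A)) \<and>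
      (\<forall>A. A \<subseteq> carrier L \<longrightarrow> h (\<Squnion>\<^bsub>L\<^esub>A) = \<Squnion>\<^bsub>M\<^esub>(h ` A))}"

definition two :: "bool gorder" where
  "two = \<lparr>carrier = UNIV, eq = (=), le = (\<le>)\<rparr>"

definition from_two :: "'a gorder \<Rightarrow> bool \<Rightarrow> 'a" where
  "from_two L p = (if p then \<top>\<^bsub>L\<^esub> else \<bottom>\<^bsub>L\<^esub>)"


section \<open>Coproducts of locales\<close>

text \<open>The coproduct is the tensor product of complete join semilattices, realised by the
  down-closed subsets of the product which are closed under suprema in each variable separately
  (for the empty supremum: they contain all pairs with a bottom component).
  See \<open>tensor_universal\<close> below.\<close>

definition biideal :: "'a gorder \<Rightarrow> 'b gorder \<Rightarrow> ('a \<times> 'b) set \<Rightarrow> bool" where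
  "biideal L M I \<longleftrightarrow> I \<subseteq> carrier L \<times> carrier M \<and>
    (\<forall>a b a' b'. (a, b) \<in> I \<longrightarrow> a' \<in> carrier L \<longrightarrow> b' \<in> carrier M \<longrightarrow>
       a' \<sqsubseteq>\<^bsub>L\<^esub> a \<longrightarrow> b' \<sqsubseteq>\<^bsub>M\<^esub> b \<longrightarrow> (a', b') \<in> I) \<and>
    (\<forall>A b. A \<subseteq> carrier L \<longrightarrow> b \<in> carrier M \<longrightarrow> A \<times> {b} \<subseteq> I \<longrightarrow> (\<Squnion>\<^bsub>L\<^esub>A, b) \<in> I) \<and>
    (\<forall>a B. a \<in> carrier L \<longrightarrow> B \<subseteq> carrier M \<longrightarrow> {a} \<times> B \<subseteq> I \<longrightarrow> (a, \<Squnion>\<^bsub>M\<^esub>B) \<in> I)"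

definition tensor :: "'a gorder \<Rightarrow> 'b gorder \<Rightarrow> ('a \<times> 'b) set gorder"  (infixr \<open>\<otimes>\<close> 75) where
  "L \<otimes> M = \<lparr>carrier = {I. biideal L M I}, eq = (=), le = (\<subseteq>)\<rparr>"

definition tens :: "'a gorder \<Rightarrow> 'b gorder \<Rightarrow> 'a \<Rightarrow> 'b \<Rightarrow> ('a \<times> 'b) set" where
  "tens L M a b = \<Inter>{I. biideal L M I \<and> (a, b) \<in> I}"

text \<open>Every \<open>I\<close> in \<open>L \<otimes> M\<close> is the supremum of the \<open>a \<otimes> b\<close> with \<open>(a, b) \<in> I\<close>, so the
  following maps are determined by their values on elementary tensors:
  \<open>a \<otimes> b \<mapsto> f a \<otimes> g b\<close>, \<open>(a \<otimes> b) \<otimes> c \<mapsto> a \<otimes> (b \<otimes> c)\<close>, \<open>1 \<otimes> a \<mapsto> a\<close>, \<open>a \<otimes> 1 \<mapsto> a\<close>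
  and \<open>a \<otimes> b \<mapsto> a \<sqinter> b\<close> (the inverse image of the diagonal).\<close>

definition tensor_map ::
  "'a gorder \<Rightarrow> 'b gorder \<Rightarrow> 'c gorder \<Rightarrow> 'd gorder \<Rightarrow> ('a \<Rightarrow> 'c) \<Rightarrow> ('b \<Rightarrow> 'd)
     \<Rightarrow> ('a \<times> 'b) set \<Rightarrow> ('c \<times> 'd) set" where
  "tensor_map L M L' M' f g =
    (\<lambda>I\<in>carrier (L \<otimes> M). \<Squnion>\<^bsub>L' \<otimes> M'\<^esub> {tens L' M' (f a) (g b) | a b. (a, b) \<in> I})"

definition tensor_assoc ::
  "'a gorder \<Rightarrow> 'b gorder \<Rightarrow> 'c gorder \<Rightarrow> (('a \<times> 'b) set \<times> 'c) set \<Rightarrow> ('a \<times> ('b \<times> 'c) set) set" where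
  "tensor_assoc L M N =
    (\<lambda>I\<in>carrier ((L \<otimes> M) \<otimes> N).
       \<Squnion>\<^bsub>L \<otimes> (M \<otimes> N)\<^esub> {tens L (M \<otimes> N) a (tens M N b c) | a b c. \<exists>J. (J, c) \<in> I \<and> (a, b) \<in> J})"

definition left_unitor :: "'a gorder \<Rightarrow> (bool \<times> 'a) set \<Rightarrow> 'a" where
  "left_unitor L = (\<lambda>I\<in>carrier (two \<otimes> L). \<Squnion>\<^bsub>L\<^esub> {a. (True, a) \<in> I})"

definition right_unitor :: "'a gorder \<Rightarrow> ('a \<times> bool) set \<Rightarrow> 'a" where
  "right_unitor L = (\<lambda>I\<in>carrier (L \<otimes> two). \<Squnion>\<^bsub>L\<^esub> {a. (a, True) \<in> I})"

definition codiag :: "'a gorder \<Rightarrow> ('a \<times> 'a) set \<Rightarrow> 'a" where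
  "codiag L = (\<lambda>I\<in>carrier (L \<otimes> L). \<Squnion>\<^bsub>L\<^esub> {a \<sqinter>\<^bsub>L\<^esub> b | a b. (a, b) \<in> I})"


section \<open>Locales presented by generators and relations\<close>

text \<open>A relation \<open>(a, B)\<close> consists of a finite set \<open>a\<close> of generators and a set \<open>B\<close> of such finite
  sets, and stands for \<open>\<And>a \<le> \<Or>{\<And>b | b \<in> B}\<close>; the top element is the infimum over the empty set
  and the bottom element is the supremum over \<open>B = {}\<close>. The presented locale is the usual one: a
  finite set of generators represents its formal infimum, and the elements are the down-closed
  sets of such infima (upward closed as sets of finite sets) which are closed under all
  relations, stably under infima. See \<open>gen_satisfies\<close> and \<open>presented_universal\<close> below.\<close>

record 'g presentation =
  gens :: "'g set"
  rels :: "('g set \<times> 'g set set) set"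

definition pideal :: "'g presentation \<Rightarrow> 'g set set \<Rightarrow> bool" where
  "pideal P I \<longleftrightarrow> I \<subseteq> Fpow (gens P) \<and>
    (\<forall>b c. b \<in> I \<longrightarrow> c \<in> Fpow (gens P) \<longrightarrow> b \<subseteq> c \<longrightarrow> c \<in> I) \<and>
    (\<forall>a B c. (a, B) \<in> rels P \<longrightarrow> c \<in> Fpow (gens P) \<longrightarrow> (\<forall>b\<in>B. b \<union> c \<in> I) \<longrightarrow> a \<union> c \<in> I)"

definition presented :: "'g presentation \<Rightarrow> 'g set set gorder" where
  "presented P = \<lparr>carrier = {I. pideal P I}, eq = (=), le = (\<subseteq>)\<rparr>"

definition gen :: "'g presentation \<Rightarrow> 'g \<Rightarrow> 'g set set" where
  "gen P g = \<Inter>{I. pideal P I \<and> {g} \<in> I}"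

text \<open>The morphism of locales with prescribed values on the generators.\<close>

definition gen_hom :: "'g presentation \<Rightarrow> 'b gorder \<Rightarrow> ('g \<Rightarrow> 'b) \<Rightarrow> 'g set set \<Rightarrow> 'b" where
  "gen_hom P L \<phi> = (THE h. h \<in> frame_homs (presented P) L \<and> (\<forall>g\<in>gens P. h (gen P g) = \<phi> g))"


section \<open>Ordinary categories and functors\<close>

text \<open>Hom-sets need not be disjoint, so composition and the action of a functor on morphisms
  carry the objects as arguments: \<open>Cmp C X Y Z g f\<close> is the composite of \<open>f : X \<rightarrow> Y\<close> and
  \<open>g : Y \<rightarrow> Z\<close>. Functors and transformations are extensional, so that equality of these records
  and functions is equality of functors and of transformations.\<close>

record ('o, 'a) cat =
  Ob :: "'o set"
  Mor :: "'o \<Rightarrow> 'o \<Rightarrow> 'a set"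
  Idn :: "'o \<Rightarrow> 'a"
  Cmp :: "'o \<Rightarrow> 'o \<Rightarrow> 'o \<Rightarrow> 'a \<Rightarrow> 'a \<Rightarrow> 'a"

locale category =
  fixes C :: "('o, 'a) cat"
  assumes Idn_closed: "X \<in> Ob C \<Longrightarrow> Idn C X \<in> Mor C X X"
    and Cmp_closed: "\<lbrakk>X \<in> Ob C; Y \<in> Ob C; Z \<in> Ob C; f \<in> Mor C X Y; g \<in> Mor C Y Z\<rbrakk>
      \<Longrightarrow> Cmp C X Y Z g f \<in> Mor C X Z"
    and Cmp_Idn_right: "\<lbrakk>X \<in> Ob C; Y \<in> Ob C; f \<in> Mor C X Y\<rbrakk> \<Longrightarrow> Cmp C X X Y f (Idn C X) = f"
    and Cmp_Idn_left: "\<lbrakk>X \<in> Ob C; Y \<in> Ob C; f \<in> Mor C X Y\<rbrakk> \<Longrightarrow> Cmp C X Y Y (Idn C Y) f = f"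
    and Cmp_assoc: "\<lbrakk>W \<in> Ob C; X \<in> Ob C; Y \<in> Ob C; Z \<in> Ob C;
        f \<in> Mor C W X; g \<in> Mor C X Y; h \<in> Mor C Y Z\<rbrakk>
      \<Longrightarrow> Cmp C W Y Z h (Cmp C W X Y g f) = Cmp C W X Z (Cmp C X Y Z h g) f"

record ('o, 'a, 'p, 'b) funct =
  fOb :: "'o \<Rightarrow> 'p"
  fMor :: "'o \<Rightarrow> 'o \<Rightarrow> 'a \<Rightarrow> 'b"

locale cat_functor = C: category C + D: category D
  for C :: "('o, 'a) cat" and D :: "('p, 'b) cat" +
  fixes F :: "('o, 'a, 'p, 'b) funct"
  assumes fOb_closed: "fOb F \<in> Ob C \<rightarrow>\<^sub>E Ob D"
    and fMor_closed:
      "fMor F \<in> (\<Pi>\<^sub>E X\<in>Ob C. \<Pi>\<^sub>E Y\<in>Ob C. Mor C X Y \<rightarrow>\<^sub>E Mor D (fOb F X) (fOb F Y))"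
    and fMor_Idn: "X \<in> Ob C \<Longrightarrow> fMor F X X (Idn C X) = Idn D (fOb F X)"
    and fMor_Cmp: "\<lbrakk>X \<in> Ob C; Y \<in> Ob C; Z \<in> Ob C; f \<in> Mor C X Y; g \<in> Mor C Y Z\<rbrakk>
      \<Longrightarrow> fMor F X Z (Cmp C X Y Z g f) =
          Cmp D (fOb F X) (fOb F Y) (fOb F Z) (fMor F Y Z g) (fMor F X Y f)"

definition functor_cat ::
  "('o, 'a) cat \<Rightarrow> ('p, 'b) cat \<Rightarrow> (('o, 'a, 'p, 'b) funct, 'o \<Rightarrow> 'b) cat" where
  "functor_cat C D =
    \<lparr>Ob = {F. cat_functor C D F},
     Mor = (\<lambda>F G. {t \<in> (\<Pi>\<^sub>E X\<in>Ob C. Mor D (fOb F X) (fOb G X)).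
       \<forall>X\<in>Ob C. \<forall>Y\<in>Ob C. \<forall>f\<in>Mor C X Y.
         Cmp D (fOb F X) (fOb G X) (fOb G Y) (fMor G X Y f) (t X) =
         Cmp D (fOb F X) (fOb F Y) (fOb G Y) (t Y) (fMor F X Y f)}),
     Idn = (\<lambda>F. \<lambda>X\<in>Ob C. Idn D (fOb F X)),
     Cmp = (\<lambda>F G H s t. \<lambda>X\<in>Ob C. Cmp D (fOb F X) (fOb G X) (fOb H X) (s X) (t X))\<rparr>"

text \<open>The category of sets, the sets being the subsets of an arbitrary type \<open>'v\<close>.\<close>

definition set_cat :: "('v set, 'v \<Rightarrow> 'v) cat" where
  "set_cat =
    \<lparr>Ob = UNIV,
     Mor = (\<lambda>X Y. X \<rightarrow>\<^sub>E Y),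
     Idn = (\<lambda>X. \<lambda>x\<in>X. x),
     Cmp = (\<lambda>X Y Z g f. compose X g f)\<rparr>"

type_synonym ('o, 'a, 'v) set_funct = "('o, 'a, 'v set, 'v \<Rightarrow> 'v) funct"


section \<open>Categories enriched over localic spaces\<close>

text \<open>\<open>lMul A F H G\<close> goes from \<open>lHom A F G\<close> to \<open>lHom A F H \<otimes> lHom A H G\<close>.\<close>

record ('o, 'h) lcat =
  lObj :: "'o set"
  lHom :: "'o \<Rightarrow> 'o \<Rightarrow> 'h gorder"
  lMul :: "'o \<Rightarrow> 'o \<Rightarrow> 'o \<Rightarrow> 'h \<Rightarrow> ('h \<times> 'h) set"
  lUnit :: "'o \<Rightarrow> 'h \<Rightarrow> bool"

locale localic_category =
  fixes A :: "('o, 'h) lcat"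
  assumes lHom_frame: "\<lbrakk>F \<in> lObj A; G \<in> lObj A\<rbrakk> \<Longrightarrow> frame_lattice (lHom A F G)"
    and lMul_hom: "\<lbrakk>F \<in> lObj A; H \<in> lObj A; G \<in> lObj A\<rbrakk>
      \<Longrightarrow> lMul A F H G \<in> frame_homs (lHom A F G) (lHom A F H \<otimes> lHom A H G)"
    and lUnit_hom: "F \<in> lObj A \<Longrightarrow> lUnit A F \<in> frame_homs (lHom A F F) two"
    and lMul_assoc: "\<lbrakk>F \<in> lObj A; H \<in> lObj A; K \<in> lObj A; G \<in> lObj A; u \<in> carrier (lHom A F G)\<rbrakk>
      \<Longrightarrow> tensor_assoc (lHom A F H) (lHom A H K) (lHom A K G)
            (tensor_map (lHom A F K) (lHom A K G) (lHom A F H \<otimes> lHom A H K) (lHom A K G)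
               (lMul A F H K) id (lMul A F K G u)) =
          tensor_map (lHom A F H) (lHom A H G) (lHom A F H) (lHom A H K \<otimes> lHom A K G)
            id (lMul A H K G) (lMul A F H G u)"
    and lUnit_left: "\<lbrakk>F \<in> lObj A; G \<in> lObj A; u \<in> carrier (lHom A F G)\<rbrakk>
      \<Longrightarrow> left_unitor (lHom A F G)
            (tensor_map (lHom A F F) (lHom A F G) two (lHom A F G)
               (lUnit A F) id (lMul A F F G u)) = u"
    and lUnit_right: "\<lbrakk>F \<in> lObj A; G \<in> lObj A; u \<in> carrier (lHom A F G)\<rbrakk>
      \<Longrightarrow> right_unitor (lHom A F G)
            (tensor_map (lHom A F G) (lHom A G G) (lHom A F G) two
               id (lUnit A G) (lMul A F G G u)) = u"

locale localic_groupoid = localic_category A for A :: "('o, 'h) lcat" +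
  fixes \<iota> :: "'o \<Rightarrow> 'o \<Rightarrow> 'h \<Rightarrow> 'h"
  assumes inv_hom: "\<lbrakk>F \<in> lObj A; G \<in> lObj A\<rbrakk> \<Longrightarrow> \<iota> F G \<in> frame_homs (lHom A F G) (lHom A G F)"
    and inv_right: "\<lbrakk>F \<in> lObj A; G \<in> lObj A; u \<in> carrier (lHom A F F)\<rbrakk>
      \<Longrightarrow> codiag (lHom A F G)
            (tensor_map (lHom A F G) (lHom A G F) (lHom A F G) (lHom A F G)
               id (\<iota> G F) (lMul A F G F u)) =
          from_two (lHom A F G) (lUnit A F u)"
    and inv_left: "\<lbrakk>F \<in> lObj A; G \<in> lObj A; u \<in> carrier (lHom A F F)\<rbrakk>
      \<Longrightarrow> codiag (lHom A G F)
            (tensor_map (lHom A F G) (lHom A G F) (lHom A G F) (lHom A G F)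
               (\<iota> F G) id (lMul A F G F u)) =
          from_two (lHom A G F) (lUnit A F u)"

record ('o, 'h, 'p, 'k) efunct =
  eOb :: "'o \<Rightarrow> 'p"
  eHom :: "'o \<Rightarrow> 'o \<Rightarrow> 'k \<Rightarrow> 'h"

locale enriched_functor = A: localic_category A + B: localic_category B
  for A :: "('o, 'h) lcat" and B :: "('p, 'k) lcat" +
  fixes P :: "('o, 'h, 'p, 'k) efunct"
  assumes eOb_closed: "eOb P \<in> lObj A \<rightarrow>\<^sub>E lObj B"
    and eHom_closed: "eHom P \<in>
      (\<Pi>\<^sub>E F\<in>lObj A. \<Pi>\<^sub>E G\<in>lObj A. frame_homs (lHom B (eOb P F) (eOb P G)) (lHom A F G))"
    and eHom_mul: "\<lbrakk>F \<in> lObj A; H \<in> lObj A; G \<in> lObj A; u \<in> carrier (lHom B (eOb P F) (eOb P G))\<rbrakk>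
      \<Longrightarrow> tensor_map (lHom B (eOb P F) (eOb P H)) (lHom B (eOb P H) (eOb P G))
              (lHom A F H) (lHom A H G)
            (eHom P F H) (eHom P H G) (lMul B (eOb P F) (eOb P H) (eOb P G) u) =
          lMul A F H G (eHom P F G u)"
    and eHom_unit: "\<lbrakk>F \<in> lObj A; u \<in> carrier (lHom B (eOb P F) (eOb P F))\<rbrakk>
      \<Longrightarrow> lUnit A F (eHom P F F u) = lUnit B (eOb P F) u"

definition efunct_comp ::
  "('o, 'h) lcat \<Rightarrow> ('p, 'k) lcat \<Rightarrow> ('q, 'l) lcat \<Rightarrow>
   ('p, 'k, 'q, 'l) efunct \<Rightarrow> ('o, 'h, 'p, 'k) efunct \<Rightarrow> ('o, 'h, 'q, 'l) efunct" where
  "efunct_comp A B D Q P =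
    \<lparr>eOb = compose (lObj A) (eOb Q) (eOb P),
     eHom = (\<lambda>F\<in>lObj A. \<lambda>G\<in>lObj A.
       compose (carrier (lHom D (eOb Q (eOb P F)) (eOb Q (eOb P G))))
         (eHom P F G) (eHom Q (eOb P F) (eOb P G)))\<rparr>"

text \<open>The underlying ordinary category: morphisms are the points of the hom-spaces.\<close>

definition underlying_cat :: "('o, 'h) lcat \<Rightarrow> ('o, 'h \<Rightarrow> bool) cat" where
  "underlying_cat A =
    \<lparr>Ob = lObj A,
     Mor = (\<lambda>F G. frame_homs (lHom A F G) two),
     Idn = lUnit A,
     Cmp = (\<lambda>F H G q p. \<lambda>u\<in>carrier (lHom A F G).
       codiag two (tensor_map (lHom A F H) (lHom A H G) two two p q (lMul A F H G u)))\<rparr>"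

text \<open>An enrichment of \<open>D\<close>: a category enriched over localic spaces whose underlying category
  is identified with \<open>D\<close> by an isomorphism \<open>pt\<close> which is the identity on objects.\<close>

definition enrichment ::
  "('o, 'a) cat \<Rightarrow> ('o, 'h) lcat \<Rightarrow> ('o \<Rightarrow> 'o \<Rightarrow> 'a \<Rightarrow> 'h \<Rightarrow> bool) \<Rightarrow> bool" where
  "enrichment D A pt \<longleftrightarrow>
    localic_category A \<and> lObj A = Ob D \<and>
    cat_functor D (underlying_cat A)
      \<lparr>fOb = (\<lambda>F\<in>Ob D. F), fMor = (\<lambda>F\<in>Ob D. \<lambda>G\<in>Ob D. \<lambda>t\<in>Mor D F G. pt F G t)\<rparr> \<and>
    (\<forall>F\<in>Ob D. \<forall>G\<in>Ob D. bij_betw (pt F G) (Mor D F G) (Mor (underlying_cat A) F G))"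


section \<open>The enriched categories of sets\<close>

text \<open>The pair \<open>(x, y)\<close> is the generator \<open>[\<langle>x|y\<rangle>]\<close>.\<close>

definition rel_u :: "'x set \<Rightarrow> 'y set \<Rightarrow> (('x \<times> 'y) set \<times> ('x \<times> 'y) set set) set" where
  "rel_u X Y = {({(z, x), (z, y)}, {}) | z x y. z \<in> X \<and> x \<in> Y \<and> y \<in> Y \<and> x \<noteq> y}"

definition rel_e :: "'x set \<Rightarrow> 'y set \<Rightarrow> (('x \<times> 'y) set \<times> ('x \<times> 'y) set set) set" where
  "rel_e X Y = {({}, {{(z, x)} | x. x \<in> Y}) | z. z \<in> X}"

definition rel_i :: "'x set \<Rightarrow> 'y set \<Rightarrow> (('x \<times> 'y) set \<times> ('x \<times> 'y) set set) set" where
  "rel_i X Y = {({(x, z), (y, z)}, {}) | x y z. x \<in> X \<and> y \<in> X \<and> x \<noteq> y \<and> z \<in> Y}"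

definition rel_s :: "'x set \<Rightarrow> 'y set \<Rightarrow> (('x \<times> 'y) set \<times> ('x \<times> 'y) set set) set" where
  "rel_s X Y = {({}, {{(x, z)} | x. x \<in> X}) | z. z \<in> Y}"

text \<open>The constructions below are carried out for both kinds of presentations at once:
  the parameter \<open>R\<close> is \<open>lFunc\<close> or \<open>lBij\<close>.\<close>

definition lFunc :: "'x set \<Rightarrow> 'y set \<Rightarrow> ('x \<times> 'y) presentation" where
  "lFunc X Y = \<lparr>gens = X \<times> Y, rels = rel_u X Y \<union> rel_e X Y\<rparr>"

definition lBij :: "'x set \<Rightarrow> 'y set \<Rightarrow> ('x \<times> 'y) presentation" where
  "lBij X Y = \<lparr>gens = X \<times> Y, rels = rel_u X Y \<union> rel_e X Y \<union> rel_i X Y \<union> rel_s X Y\<rparr>"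

type_synonym 'v set_pres = "'v set \<Rightarrow> 'v set \<Rightarrow> ('v \<times> 'v) presentation"

definition set_mult ::
  "'v set_pres \<Rightarrow> 'v set \<Rightarrow> 'v set \<Rightarrow> 'v set
     \<Rightarrow> ('v \<times> 'v) set set \<Rightarrow> (('v \<times> 'v) set set \<times> ('v \<times> 'v) set set) set" where
  "set_mult R X Z Y =
    gen_hom (R X Y) (presented (R X Z) \<otimes> presented (R Z Y))
      (\<lambda>(x, y). \<Squnion>\<^bsub>presented (R X Z) \<otimes> presented (R Z Y)\<^esub>
        {tens (presented (R X Z)) (presented (R Z Y)) (gen (R X Z) (x, z)) (gen (R Z Y) (z, y))
          | z. z \<in> Z})"

definition set_unit :: "'v set_pres \<Rightarrow> 'v set \<Rightarrow> ('v \<times> 'v) set set \<Rightarrow> bool" where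
  "set_unit R X = gen_hom (R X X) two (\<lambda>(x, y). x = y)"

definition set_inv :: "'v set_pres \<Rightarrow> 'v set \<Rightarrow> 'v set \<Rightarrow> ('v \<times> 'v) set set \<Rightarrow> ('v \<times> 'v) set set" where
  "set_inv R X Y = gen_hom (R X Y) (presented (R Y X)) (\<lambda>(x, y). gen (R Y X) (y, x))"

text \<open>\<open>enriched_sets lFunc\<close> is the enriched category of sets and functions.\<close>

definition enriched_sets :: "'v set_pres \<Rightarrow> ('v set, ('v \<times> 'v) set set) lcat" where
  "enriched_sets R =
    \<lparr>lObj = UNIV, lHom = (\<lambda>X Y. presented (R X Y)), lMul = set_mult R, lUnit = set_unit R\<rparr>"

text \<open>The point of \<open>lFunc X Y\<close> corresponding to a function.\<close>

definition function_point :: "'v set \<Rightarrow> 'v set \<Rightarrow> ('v \<Rightarrow> 'v) \<Rightarrow> ('v \<times> 'v) set set \<Rightarrow> bool" where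
  "function_point X Y f = gen_hom (lFunc X Y) two (\<lambda>(x, y). f x = y)"

text \<open>The inclusion of bijections into functions, given on hom-spaces by the quotient morphisms.\<close>

definition bij_incl ::
  "('v set, ('v \<times> 'v) set set, 'v set, ('v \<times> 'v) set set) efunct" where
  "bij_incl =
    \<lparr>eOb = (\<lambda>X. X), eHom = (\<lambda>X Y. gen_hom (lFunc X Y) (presented (lBij X Y)) (gen (lBij X Y)))\<rparr>"

text \<open>The ordinary category of enriched functors from \<open>A\<close> into the enriched category of sets.\<close>

definition enriched_functor_cat ::
  "('o, 'h) lcat \<Rightarrow> (('o, 'h, 'v set, ('v \<times> 'v) set set) efunct, 'o \<Rightarrow> 'v \<Rightarrow> 'v) cat" where
  "enriched_functor_cat A =
    \<lparr>Ob = {P. enriched_functor A (enriched_sets lFunc) P},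
     Mor = (\<lambda>P Q. {t \<in> (\<Pi>\<^sub>E F\<in>lObj A. eOb P F \<rightarrow>\<^sub>E eOb Q F).
       \<forall>F\<in>lObj A. \<forall>G\<in>lObj A. \<forall>x\<in>eOb P F. \<forall>y\<in>eOb P G.
         eHom P F G (gen (lFunc (eOb P F) (eOb P G)) (x, y))
           \<sqsubseteq>\<^bsub>lHom A F G\<^esub> eHom Q F G (gen (lFunc (eOb Q F) (eOb Q G)) (t F x, t G y))}),
     Idn = (\<lambda>P. \<lambda>F\<in>lObj A. \<lambda>x\<in>eOb P F. x),
     Cmp = (\<lambda>P Q S s t. \<lambda>F\<in>lObj A. compose (eOb P F) (s F) (t F))\<rparr>"


section \<open>The enriched functor categories\<close>

abbreviation set_functors :: "('o, 'a) cat \<Rightarrow> ('o, 'a, 'v) set_funct set" where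
  "set_functors C \<equiv> Ob (functor_cat C set_cat)"

text \<open>The triple \<open>(X, x, y)\<close> is the generator \<open>[(X, \<langle>x|y\<rangle>)]\<close>. The relations are naturality,
  and a copy of the relations of \<open>R (F X) (G X)\<close> for each \<open>X\<close>.\<close>

definition nat_pres ::
  "'v set_pres \<Rightarrow> ('o, 'a) cat \<Rightarrow> ('o, 'a, 'v) set_funct \<Rightarrow> ('o, 'a, 'v) set_funct
     \<Rightarrow> ('o \<times> 'v \<times> 'v) presentation" where
  "nat_pres R C F G =
    \<lparr>gens = {(X, x, y). X \<in> Ob C \<and> x \<in> fOb F X \<and> y \<in> fOb G X},
     rels =
      {({(X, x, y)}, {{(Y, fMor F X Y f x, fMor G X Y f y)}}) | X Y f x y.
         X \<in> Ob C \<and> Y \<in> Ob C \<and> f \<in> Mor C X Y \<and> x \<in> fOb F X \<and> y \<in> fOb G X} \<union>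
      {(Pair X ` a, (\<lambda>b. Pair X ` b) ` B) | X a B.
         X \<in> Ob C \<and> (a, B) \<in> rels (R (fOb F X) (fOb G X))}\<rparr>"

abbreviation nat_loc ::
  "'v set_pres \<Rightarrow> ('o, 'a) cat \<Rightarrow> ('o, 'a, 'v) set_funct \<Rightarrow> ('o, 'a, 'v) set_funct
     \<Rightarrow> ('o \<times> 'v \<times> 'v) set set gorder" where
  "nat_loc R C F G \<equiv> presented (nat_pres R C F G)"

text \<open>The morphisms \<open>\<lambda>\<^sub>X\<^sup>*\<close>.\<close>

definition lam ::
  "'v set_pres \<Rightarrow> ('o, 'a) cat \<Rightarrow> 'o \<Rightarrow> ('o, 'a, 'v) set_funct \<Rightarrow> ('o, 'a, 'v) set_funct
     \<Rightarrow> ('v \<times> 'v) set set \<Rightarrow> ('o \<times> 'v \<times> 'v) set set" where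
  "lam R C X F G =
    gen_hom (R (fOb F X) (fOb G X)) (nat_loc R C F G) (\<lambda>(x, y). gen (nat_pres R C F G) (X, x, y))"

definition lam_tensor ::
  "'v set_pres \<Rightarrow> ('o, 'a) cat \<Rightarrow> 'o \<Rightarrow>
   ('o, 'a, 'v) set_funct \<Rightarrow> ('o, 'a, 'v) set_funct \<Rightarrow> ('o, 'a, 'v) set_funct
     \<Rightarrow> (('v \<times> 'v) set set \<times> ('v \<times> 'v) set set) set
     \<Rightarrow> (('o \<times> 'v \<times> 'v) set set \<times> ('o \<times> 'v \<times> 'v) set set) set" where
  "lam_tensor R C X F H G =
    tensor_map (presented (R (fOb F X) (fOb H X))) (presented (R (fOb H X) (fOb G X)))
      (nat_loc R C F H) (nat_loc R C H G) (lam R C X F H) (lam R C X H G)"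

definition nat_mult ::
  "'v set_pres \<Rightarrow> ('o, 'a) cat \<Rightarrow>
   ('o, 'a, 'v) set_funct \<Rightarrow> ('o, 'a, 'v) set_funct \<Rightarrow> ('o, 'a, 'v) set_funct
     \<Rightarrow> ('o \<times> 'v \<times> 'v) set set
     \<Rightarrow> (('o \<times> 'v \<times> 'v) set set \<times> ('o \<times> 'v \<times> 'v) set set) set" where
  "nat_mult R C F H G =
    gen_hom (nat_pres R C F G) (nat_loc R C F H \<otimes> nat_loc R C H G)
      (\<lambda>(X, x, y). lam_tensor R C X F H G
        (set_mult R (fOb F X) (fOb H X) (fOb G X) (gen (R (fOb F X) (fOb G X)) (x, y))))"

definition nat_unit ::
  "'v set_pres \<Rightarrow> ('o, 'a) cat \<Rightarrow> ('o, 'a, 'v) set_funct \<Rightarrow> ('o \<times> 'v \<times> 'v) set set \<Rightarrow> bool" where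
  "nat_unit R C F =
    gen_hom (nat_pres R C F F) two
      (\<lambda>(X, x, y). set_unit R (fOb F X) (gen (R (fOb F X) (fOb F X)) (x, y)))"

definition nat_inv ::
  "'v set_pres \<Rightarrow> ('o, 'a) cat \<Rightarrow> ('o, 'a, 'v) set_funct \<Rightarrow> ('o, 'a, 'v) set_funct
     \<Rightarrow> ('o \<times> 'v \<times> 'v) set set \<Rightarrow> ('o \<times> 'v \<times> 'v) set set" where
  "nat_inv R C F G =
    gen_hom (nat_pres R C F G) (nat_loc R C G F)
      (\<lambda>(X, x, y). lam R C X G F
        (set_inv R (fOb F X) (fOb G X) (gen (R (fOb F X) (fOb G X)) (x, y))))"

definition enriched_functors ::
  "'v set_pres \<Rightarrow> ('o, 'a) cat \<Rightarrow> (('o, 'a, 'v) set_funct, ('o \<times> 'v \<times> 'v) set set) lcat" where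
  "enriched_functors R C =
    \<lparr>lObj = set_functors C, lHom = nat_loc R C, lMul = nat_mult R C, lUnit = nat_unit R C\<rparr>"

text \<open>The point of the hom-space corresponding to a natural transformation.\<close>

definition nat_point ::
  "('o, 'a) cat \<Rightarrow> ('o, 'a, 'v) set_funct \<Rightarrow> ('o, 'a, 'v) set_funct \<Rightarrow> ('o \<Rightarrow> 'v \<Rightarrow> 'v)
     \<Rightarrow> ('o \<times> 'v \<times> 'v) set set \<Rightarrow> bool" where
  "nat_point C F G t = gen_hom (nat_pres lFunc C F G) two (\<lambda>(X, x, y). t X x = y)"

definition ev ::
  "'v set_pres \<Rightarrow> ('o, 'a) cat \<Rightarrow> 'o \<Rightarrow>
   (('o, 'a, 'v) set_funct, ('o \<times> 'v \<times> 'v) set set, 'v set, ('v \<times> 'v) set set) efunct" where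
  "ev R C X =
    \<lparr>eOb = (\<lambda>F\<in>set_functors C. fOb F X),
     eHom = (\<lambda>F\<in>set_functors C. \<lambda>G\<in>set_functors C. lam R C X F G)\<rparr>"

text \<open>Evaluation on the groupoid of natural bijections, with values in sets and functions.\<close>

definition ev_bij ::
  "('o, 'a) cat \<Rightarrow> 'o \<Rightarrow>
   (('o, 'a, 'v) set_funct, ('o \<times> 'v \<times> 'v) set set, 'v set, ('v \<times> 'v) set set) efunct" where
  "ev_bij C X =
    efunct_comp (enriched_functors lBij C) (enriched_sets lBij) (enriched_sets lFunc)
      bij_incl (ev lBij C X)"

text \<open>\<open>X \<mapsto> E X\<close>, a morphism \<open>f\<close> being sent to the family of functions \<open>F f\<close>.\<close>

definition ev_functor ::
  "('o, 'a) cat \<Rightarrow>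
   ('o \<Rightarrow> (('o, 'a, 'v) set_funct, 'h, 'v set, ('v \<times> 'v) set set) efunct) \<Rightarrow>
   ('o, 'a, (('o, 'a, 'v) set_funct, 'h, 'v set, ('v \<times> 'v) set set) efunct,
     ('o, 'a, 'v) set_funct \<Rightarrow> 'v \<Rightarrow> 'v) funct" where
  "ev_functor C E =
    \<lparr>fOb = (\<lambda>X\<in>Ob C. E X),
     fMor = (\<lambda>X\<in>Ob C. \<lambda>Y\<in>Ob C. \<lambda>f\<in>Mor C X Y. \<lambda>F\<in>set_functors C. fMor F X Y f)\<rparr>"

section \<open>Lattice-theoretic preliminaries\<close>

lemma inter_system_lattice:
  fixes K :: "'x set set"
  defines "L \<equiv> \<lparr>carrier = K, eq = (=), le = (\<subseteq>)\<rparr>"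
  assumes U: "U \<in> K" "\<And>I. I \<in> K \<Longrightarrow> I \<subseteq> U"
    and Int: "\<And>A. A \<subseteq> K \<Longrightarrow> A \<noteq> {} \<Longrightarrow> \<Inter>A \<in> K"
  shows "complete_lattice L"
    and "\<And>A. A \<subseteq> K \<Longrightarrow> \<Sqinter>\<^bsub>L\<^esub>A = U \<inter> \<Inter>A"
    and "\<And>A. A \<subseteq> K \<Longrightarrow> \<Squnion>\<^bsub>L\<^esub>A = \<Inter>{I \<in> K. \<Union>A \<subseteq> I}"
proof -
  interpret partial_order L
    by unfold_locales (auto simp: L_def)
  have inf: "U \<inter> \<Inter>A \<in> K" if "A \<subseteq> K" for A
    using that Int[of "insert U A"] U by auto
  have sup: "\<Inter>{I \<in> K. \<Union>A \<subseteq> I} \<in> K" if "A \<subseteq> K" for A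
    by (rule Int) (use that U in blast)+
  have i: "greatest L (U \<inter> \<Inter>A) (Lower L A)" if "A \<subseteq> K" for A
    using inf[OF that] that U by (auto simp: greatest_def Lower_def L_def)
  have s: "least L (\<Inter>{I \<in> K. \<Union>A \<subseteq> I}) (Upper L A)" if "A \<subseteq> K" for A
  proof -
    have "\<Inter>{I \<in> K. \<Union>A \<subseteq> I} \<subseteq> y" if "y \<in> K" "\<forall>x. x \<in> A \<and> x \<in> K \<longrightarrow> x \<subseteq> y" for y
      using that \<open>A \<subseteq> K\<close> by blast
    then show ?thesis
      using sup[OF that] that U by (auto simp: least_def Upper_def L_def)
  qed
  show "complete_lattice L"
  proof unfold_locales
    fix A assume "A \<subseteq> carrier L"
    then have "A \<subseteq> K" by (simp add: L_def)
    then show "\<exists>s. least L s (Upper L A)" "\<exists>i. greatest L i (Lower L A)" using i s by iprover+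
  qed
  then interpret complete_lattice L .
  show "\<Sqinter>\<^bsub>L\<^esub>A = U \<inter> \<Inter>A" if "A \<subseteq> K" for A
    unfolding inf_def by (rule some_equality, rule i[OF that], erule greatest_unique[OF _ i[OF that]])
  show "\<Squnion>\<^bsub>L\<^esub>A = \<Inter>{I \<in> K. \<Union>A \<subseteq> I}" if "A \<subseteq> K" for A
    unfolding sup_def by (rule some_equality, rule s[OF that], erule least_unique[OF _ s[OF that]])
qed

context frame_lattice begin

lemma bin_meet:
  assumes "x \<in> carrier L" "y \<in> carrier L"
  shows "x \<sqinter> y \<in> carrier L" "x \<sqinter> y \<sqsubseteq> x" "x \<sqinter> y \<sqsubseteq> y"
    "\<And>z. z \<in> carrier L \<Longrightarrow> z \<sqsubseteq> x \<Longrightarrow> z \<sqsubseteq> y \<Longrightarrow> z \<sqsubseteq> x \<sqinter> y"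
  using assms by (auto intro: meet_closed meet_left meet_right meet_le)

lemma sup_le_iff:
  assumes "A \<subseteq> carrier L" "z \<in> carrier L"
  shows "\<Squnion>A \<sqsubseteq> z \<longleftrightarrow> (\<forall>a\<in>A. a \<sqsubseteq> z)"
proof
  assume "\<Squnion>A \<sqsubseteq> z"
  then show "\<forall>a\<in>A. a \<sqsubseteq> z"
    using assms by (intro ballI) (rule le_trans[OF sup_upper], auto)
next
  assume "\<forall>a\<in>A. a \<sqsubseteq> z"
  then show "\<Squnion>A \<sqsubseteq> z" using assms by (intro sup_least) (auto simp: Upper_def)
qed

lemma le_inf_iff:
  assumes "A \<subseteq> carrier L" "z \<in> carrier L"
  shows "z \<sqsubseteq> \<Sqinter>A \<longleftrightarrow> (\<forall>a\<in>A. z \<sqsubseteq> a)"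
proof
  assume "z \<sqsubseteq> \<Sqinter>A"
  then show "\<forall>a\<in>A. z \<sqsubseteq> a"
    using assms by (intro ballI) (rule le_trans[OF _ inf_lower], auto)
next
  assume "\<forall>a\<in>A. z \<sqsubseteq> a"
  then show "z \<sqsubseteq> \<Sqinter>A" using assms by (intro inf_greatest) (auto simp: Lower_def)
qed

lemma inf_Un:
  assumes "A \<subseteq> carrier L" "B \<subseteq> carrier L"
  shows "\<Sqinter>(A \<union> B) = \<Sqinter>A \<sqinter> \<Sqinter>B"
proof -
  have c: "\<Sqinter>A \<in> carrier L" "\<Sqinter>B \<in> carrier L" "\<Sqinter>(A \<union> B) \<in> carrier L" using assms by auto
  note m = bin_meet[OF c(1,2)]
  have 1: "\<Sqinter>(A \<union> B) \<sqsubseteq> \<Sqinter>A \<sqinter> \<Sqinter>B"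
  proof (rule m(4)[OF c(3)])
    show "\<Sqinter>(A \<union> B) \<sqsubseteq> \<Sqinter>A" "\<Sqinter>(A \<union> B) \<sqsubseteq> \<Sqinter>B"
      using assms c(3) inf_lower[of "A \<union> B"] by (subst le_inf_iff; auto)+
  qed
  have "\<Sqinter>A \<sqinter> \<Sqinter>B \<sqsubseteq> x" if "x \<in> A \<union> B" for x
  proof (cases "x \<in> A")
    case True
    show ?thesis using le_trans[OF m(2) inf_lower[OF assms(1) True]] True assms m(1) c by auto
  next
    case False
    then have x: "x \<in> B" using that by auto
    show ?thesis using le_trans[OF m(3) inf_lower[OF assms(2) x]] x assms m(1) c by auto
  qed
  then have 2: "\<Sqinter>A \<sqinter> \<Sqinter>B \<sqsubseteq> \<Sqinter>(A \<union> B)"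
    using assms m(1) by (subst le_inf_iff) auto
  show ?thesis by (rule le_antisym[OF 1 2 c(3) m(1)])
qed

lemma inf_empty': "\<Sqinter>{} = \<top>" and sup_empty': "\<Squnion>{} = \<bottom>"
  using weak_inf_empty weak_sup_empty by (simp_all only: eq_is_equal)

lemma Sup_meet_Sup:
  assumes "A \<subseteq> carrier L" "B \<subseteq> carrier L" "z \<in> carrier L"
    "\<And>a b. a \<in> A \<Longrightarrow> b \<in> B \<Longrightarrow> a \<sqinter> b \<sqsubseteq> z"
  shows "\<Squnion>A \<sqinter> \<Squnion>B \<sqsubseteq> z"
proof -
  have "\<Squnion>A \<sqinter> b \<sqsubseteq> z" if "b \<in> B" for b
  proof -
    have b: "b \<in> carrier L" using that assms by auto
    have "\<Squnion>A \<sqinter> b = b \<sqinter> \<Squnion>A" by (simp add: meet_comm)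
    also have "\<dots> = \<Squnion>((\<lambda>a. b \<sqinter> a) ` A)" using assms b by (simp add: meet_Sup_distrib)
    also have "\<dots> \<sqsubseteq> z"
    proof (subst sup_le_iff)
      show "(\<lambda>a. b \<sqinter> a) ` A \<subseteq> carrier L" using assms b by (auto intro!: bin_meet(1))
      show "\<forall>a\<in>(\<lambda>a. b \<sqinter> a) ` A. a \<sqsubseteq> z" using assms(4) that by (auto simp: meet_comm[of _ b])
    qed fact
    finally show ?thesis .
  qed
  moreover have c: "\<Squnion>A \<in> carrier L" using assms by simp
  then have "(\<lambda>b. \<Squnion>A \<sqinter> b) ` B \<subseteq> carrier L" using assms by (auto intro: bin_meet(1))
  ultimately show ?thesis
    using assms c by (simp add: meet_Sup_distrib sup_le_iff)
qed

end

lemma frame_homsI: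
  assumes L: "frame_lattice L" and M: "frame_lattice M"
    and h: "h \<in> carrier L \<rightarrow>\<^sub>E carrier M"
    and t: "h \<top>\<^bsub>L\<^esub> = \<top>\<^bsub>M\<^esub>"
    and m: "\<And>a b. a \<in> carrier L \<Longrightarrow> b \<in> carrier L \<Longrightarrow> h (a \<sqinter>\<^bsub>L\<^esub> b) = h a \<sqinter>\<^bsub>M\<^esub> h b"
    and s: "\<And>A. A \<subseteq> carrier L \<Longrightarrow> h (\<Squnion>\<^bsub>L\<^esub>A) = \<Squnion>\<^bsub>M\<^esub>(h ` A)"
  shows "h \<in> frame_homs L M"
proof -
  interpret L: frame_lattice L by fact
  interpret M: frame_lattice M by fact
  have "h (\<Sqinter>\<^bsub>L\<^esub>A) = \<Sqinter>\<^bsub>M\<^esub>(h ` A)" if "finite A" "A \<subseteq> carrier L" for A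
    using that
  proof induction
    case empty
    then show ?case by (simp add: L.inf_empty' M.inf_empty' t)
  next
    case (insert x A)
    have hA: "h x \<in> carrier M" "h ` A \<subseteq> carrier M" using insert h by auto
    have 1: "\<Sqinter>\<^bsub>L\<^esub>(insert x A) = x \<sqinter>\<^bsub>L\<^esub> \<Sqinter>\<^bsub>L\<^esub>A" using L.inf_Un[of "{x}" A] insert by simp
    have 2: "\<Sqinter>\<^bsub>M\<^esub>(insert (h x) (h`A)) = h x \<sqinter>\<^bsub>M\<^esub> \<Sqinter>\<^bsub>M\<^esub>(h`A)"
      using M.inf_Un[of "{h x}" "h ` A"] hA by simp
    show ?case using insert 1 2 by (simp add: m)
  qed
  then show ?thesis using h s by (auto simp: frame_homs_def)
qed

lemma frame_homsD:
  assumes L: "frame_lattice L" and M: "frame_lattice M" and h: "h \<in> frame_homs L M"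
  shows "h \<in> carrier L \<rightarrow>\<^sub>E carrier M"
    "h \<top>\<^bsub>L\<^esub> = \<top>\<^bsub>M\<^esub>"
    "\<And>a b. a \<in> carrier L \<Longrightarrow> b \<in> carrier L \<Longrightarrow> h (a \<sqinter>\<^bsub>L\<^esub> b) = h a \<sqinter>\<^bsub>M\<^esub> h b"
    "\<And>A. A \<subseteq> carrier L \<Longrightarrow> h (\<Squnion>\<^bsub>L\<^esub>A) = \<Squnion>\<^bsub>M\<^esub>(h ` A)"
    "\<And>A. A \<subseteq> carrier L \<Longrightarrow> finite A \<Longrightarrow> h (\<Sqinter>\<^bsub>L\<^esub>A) = \<Sqinter>\<^bsub>M\<^esub>(h ` A)"
proof -
  interpret L: frame_lattice L by fact
  interpret M: frame_lattice M by fact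
  show i: "\<And>A. A \<subseteq> carrier L \<Longrightarrow> finite A \<Longrightarrow> h (\<Sqinter>\<^bsub>L\<^esub>A) = \<Sqinter>\<^bsub>M\<^esub>(h ` A)"
    and "h \<in> carrier L \<rightarrow>\<^sub>E carrier M"
    "\<And>A. A \<subseteq> carrier L \<Longrightarrow> h (\<Squnion>\<^bsub>L\<^esub>A) = \<Squnion>\<^bsub>M\<^esub>(h ` A)"
    using h by (auto simp: frame_homs_def)
  show "h \<top>\<^bsub>L\<^esub> = \<top>\<^bsub>M\<^esub>" using i[of "{}"] by (simp add: L.inf_empty' M.inf_empty')
  show "h (a \<sqinter>\<^bsub>L\<^esub> b) = h a \<sqinter>\<^bsub>M\<^esub> h b" if "a \<in> carrier L" "b \<in> carrier L" for a b
    using i[of "{a,b}"] that by (simp add: meet_def)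
qed


section \<open>Universal property of presented locales\<close>

definition wf_presentation :: "'g presentation \<Rightarrow> bool" where
  "wf_presentation P \<longleftrightarrow> (\<forall>(a, B)\<in>rels P. a \<in> Fpow (gens P) \<and> B \<subseteq> Fpow (gens P))"

definition satisfies :: "'g presentation \<Rightarrow> 'b gorder \<Rightarrow> ('g \<Rightarrow> 'b) \<Rightarrow> bool" where
  "satisfies P L \<phi> \<longleftrightarrow> \<phi> \<in> gens P \<rightarrow> carrier L \<and>
    (\<forall>(a, B)\<in>rels P. \<Sqinter>\<^bsub>L\<^esub>(\<phi> ` a) \<sqsubseteq>\<^bsub>L\<^esub> \<Squnion>\<^bsub>L\<^esub>((\<lambda>b. \<Sqinter>\<^bsub>L\<^esub>(\<phi> ` b)) ` B))"

lemma Fpow_Un: "a \<in> Fpow S \<Longrightarrow> b \<in> Fpow S \<Longrightarrow> a \<union> b \<in> Fpow S"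
  by (auto simp: Fpow_def)

lemma pidealD:
  assumes "pideal P I"
  shows "b \<in> I \<Longrightarrow> b \<in> Fpow (gens P)"
    "b \<in> I \<Longrightarrow> c \<in> Fpow (gens P) \<Longrightarrow> b \<union> c \<in> I"
    "b \<in> I \<Longrightarrow> c \<in> Fpow (gens P) \<Longrightarrow> c \<union> b \<in> I"
    "b \<in> I \<Longrightarrow> c \<in> Fpow (gens P) \<Longrightarrow> b \<subseteq> c \<Longrightarrow> c \<in> I"
    "(a, B) \<in> rels P \<Longrightarrow> c \<in> Fpow (gens P) \<Longrightarrow> \<forall>b\<in>B. b \<union> c \<in> I \<Longrightarrow> a \<union> c \<in> I"
proof -
  note p = assms[unfolded pideal_def]
  show 1: "b \<in> Fpow (gens P)" if "b \<in> I" for b using p that by blast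
  show 4: "c \<in> I" if "b \<in> I" "c \<in> Fpow (gens P)" "b \<subseteq> c" for b c
    using p[THEN conjunct2, THEN conjunct1] that by blast
  show "b \<union> c \<in> I" if "b \<in> I" "c \<in> Fpow (gens P)"
    by (rule 4[OF that(1) Fpow_Un[OF 1[OF that(1)] that(2)]]) auto
  show "c \<union> b \<in> I" if "b \<in> I" "c \<in> Fpow (gens P)"
    by (rule 4[OF that(1) Fpow_Un[OF that(2) 1[OF that(1)]]]) auto
  show "a \<union> c \<in> I" if "(a, B) \<in> rels P" "c \<in> Fpow (gens P)" "\<forall>b\<in>B. b \<union> c \<in> I"
    using p[THEN conjunct2, THEN conjunct2] that by blast
qed

lemma pideal_Fpow: "wf_presentation P \<Longrightarrow> pideal P (Fpow (gens P))"
  unfolding pideal_def wf_presentation_def by (auto intro: Fpow_Un)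

lemma pideal_Inter: "A \<noteq> {} \<Longrightarrow> (\<And>I. I \<in> A \<Longrightarrow> pideal P I) \<Longrightarrow> pideal P (\<Inter>A)"
proof -
  assume ne: "A \<noteq> {}" and A: "\<And>I. I \<in> A \<Longrightarrow> pideal P I"
  show ?thesis
    unfolding pideal_def
  proof (intro conjI allI impI InterI)
    show "\<Inter>A \<subseteq> Fpow (gens P)" using ne A pidealD(1) by blast
  next
    fix b c I assume "b \<in> \<Inter>A" "c \<in> Fpow (gens P)" "b \<subseteq> c" "I \<in> A"
    then show "c \<in> I" using pidealD(4)[OF A] by blast
  next
    fix a B c I assume "(a, B) \<in> rels P" "c \<in> Fpow (gens P)" "\<forall>b\<in>B. b \<union> c \<in> \<Inter>A" "I \<in> A"
    then show "a \<union> c \<in> I" using pidealD(5)[OF A] by blast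
  qed
qed

text \<open>The Heyting implication.\<close>

lemma pideal_residual:
  assumes T: "pideal P T" and wf: "wf_presentation P" and x: "x \<subseteq> Fpow (gens P)"
  shows "pideal P {c \<in> Fpow (gens P). \<forall>d\<in>x. c \<union> d \<in> T}"
  unfolding pideal_def
proof (intro conjI allI impI)
  fix b c assume "b \<in> {c \<in> Fpow (gens P). \<forall>d\<in>x. c \<union> d \<in> T}" "c \<in> Fpow (gens P)" "b \<subseteq> c"
  then show "c \<in> {c \<in> Fpow (gens P). \<forall>d\<in>x. c \<union> d \<in> T}"
    using T x by (auto intro: pidealD(4)[OF T, of "b \<union> _"] Fpow_Un)
next
  fix a B c assume r: "(a, B) \<in> rels P" and c: "c \<in> Fpow (gens P)"
    and b: "\<forall>b\<in>B. b \<union> c \<in> {c \<in> Fpow (gens P). \<forall>d\<in>x. c \<union> d \<in> T}"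
  have "a \<in> Fpow (gens P)" using r wf by (auto simp: wf_presentation_def)
  moreover have "a \<union> (c \<union> d) \<in> T" if "d \<in> x" for d
    using b c x that by (intro pidealD(5)[OF T r]) (auto intro: Fpow_Un simp: Un_assoc)
  ultimately show "a \<union> c \<in> {c \<in> Fpow (gens P). \<forall>d\<in>x. c \<union> d \<in> T}"
    using c by (auto intro: Fpow_Un simp: Un_assoc)
qed auto

lemma presented_lattice:
  assumes wf: "wf_presentation P"
  shows "complete_lattice (presented P)"
    and "\<And>A. A \<subseteq> {I. pideal P I} \<Longrightarrow> \<Sqinter>\<^bsub>presented P\<^esub>A = Fpow (gens P) \<inter> \<Inter>A"
    and "\<And>A. A \<subseteq> {I. pideal P I} \<Longrightarrow> \<Squnion>\<^bsub>presented P\<^esub>A = \<Inter>{I \<in> {I. pideal P I}. \<Union>A \<subseteq> I}"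
proof -
  have *: "Fpow (gens P) \<in> {I. pideal P I}" "\<And>I. I \<in> {I. pideal P I} \<Longrightarrow> I \<subseteq> Fpow (gens P)"
    "\<And>A. A \<subseteq> {I. pideal P I} \<Longrightarrow> A \<noteq> {} \<Longrightarrow> \<Inter>A \<in> {I. pideal P I}"
    using pideal_Fpow[OF wf] pidealD(1) pideal_Inter[of _ P] by blast+
  note i = inter_system_lattice[where K = "{I. pideal P I}" and U = "Fpow (gens P)", folded presented_def]
  show "complete_lattice (presented P)" by (rule i(1)) (use * in auto)
  show "\<Sqinter>\<^bsub>presented P\<^esub>A = Fpow (gens P) \<inter> \<Inter>A" if "A \<subseteq> {I. pideal P I}" for A
    by (rule i(2)[OF _ _ _ that]) (use * in auto)
  show "\<Squnion>\<^bsub>presented P\<^esub>A = \<Inter>{I \<in> {I. pideal P I}. \<Union>A \<subseteq> I}" if "A \<subseteq> {I. pideal P I}" for A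
    by (rule i(3)[OF _ _ _ that]) (use * in auto)
qed

lemma presented_sup_subset:
  assumes "wf_presentation P" "A \<subseteq> {I. pideal P I}" "pideal P I" "\<And>J. J \<in> A \<Longrightarrow> J \<subseteq> I"
  shows "\<Squnion>\<^bsub>presented P\<^esub>A \<subseteq> I"
  unfolding presented_lattice(3)[OF assms(1,2)] using assms(3,4) by blast

lemma presented_frame:
  assumes wf: "wf_presentation P"
  shows "frame_lattice (presented P)"
proof -
  interpret complete_lattice "presented P" by (rule presented_lattice[OF wf])
  note inf = presented_lattice(2)[OF wf] and sup = presented_lattice(3)[OF wf]
  have carr: "carrier (presented P) = {I. pideal P I}" and le: "le (presented P) = (\<subseteq>)"
    by (simp_all add: presented_def)
  show ?thesis
  proof unfold_locales
    fix x A assume x: "x \<in> carrier (presented P)" and A: "A \<subseteq> carrier (presented P)"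
    have px: "pideal P x" using x by (simp add: carr)
    have meet: "x \<sqinter>\<^bsub>presented P\<^esub> y = x \<inter> y" if "y \<in> carrier (presented P)" for y
      using that x pidealD(1)[OF px] inf[of "{x, y}"] by (auto simp: meet_def carr)
    let ?T = "\<Squnion>\<^bsub>presented P\<^esub>((\<lambda>a. x \<sqinter>\<^bsub>presented P\<^esub> a) ` A)"
    have sub: "(\<lambda>a. x \<sqinter>\<^bsub>presented P\<^esub> a) ` A \<subseteq> carrier (presented P)"
      using x A by auto
    have T: "pideal P ?T" using sup_closed[OF sub] by (simp add: carr)
    let ?R = "{c \<in> Fpow (gens P). \<forall>d\<in>x. c \<union> d \<in> ?T}"
    have R: "pideal P ?R" using pideal_residual[OF T wf] pidealD(1)[OF px] by blast
    have up: "x \<inter> a \<subseteq> ?T" if "a \<in> A" for a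
      using sup_upper[OF sub, of "x \<sqinter>\<^bsub>presented P\<^esub> a"] that A by (auto simp: le meet subset_iff)
    have "a \<subseteq> ?R" if "a \<in> A" for a
    proof
      fix c assume c: "c \<in> a"
      have pa: "pideal P a" using that A by (auto simp: carr)
      show "c \<in> ?R"
        using c pidealD(1)[OF pa] pidealD(1)[OF px] pidealD(2)[OF pa c] pidealD(3)[OF px] up[OF that]
        by auto
    qed
    then have "\<Squnion>\<^bsub>presented P\<^esub>A \<subseteq> ?R" using R A by (intro presented_sup_subset[OF wf]) (auto simp: carr)
    then have "x \<inter> \<Squnion>\<^bsub>presented P\<^esub>A \<subseteq> ?T" by (auto dest!: subsetD)
    moreover have "?T \<subseteq> x \<inter> \<Squnion>\<^bsub>presented P\<^esub>A"
    proof -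
      have "x \<sqinter>\<^bsub>presented P\<^esub> a \<subseteq> x \<inter> \<Squnion>\<^bsub>presented P\<^esub>A" if "a \<in> A" for a
        using that A sup_upper[of A a] meet[of a] by (auto simp: le)
      moreover have "pideal P (x \<inter> \<Squnion>\<^bsub>presented P\<^esub>A)"
        using meet_closed[OF x sup_closed[OF A]] meet[OF sup_closed[OF A]] by (simp add: carr)
      ultimately show ?thesis using sub by (intro presented_sup_subset[OF wf]) (auto simp: carr)
    qed
    ultimately show "x \<sqinter>\<^bsub>presented P\<^esub> \<Squnion>\<^bsub>presented P\<^esub>A = ?T"
      using meet[OF sup_closed[OF A]] by auto
  qed
qed

lemma pideal_gen:
  assumes "wf_presentation P" "g \<in> gens P"
  shows "pideal P (gen P g)" "{g} \<in> gen P g"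
  using assms pideal_Fpow[of P] unfolding gen_def by (auto intro!: pideal_Inter simp: Fpow_def)

lemma gen_subset: "pideal P I \<Longrightarrow> {g} \<in> I \<Longrightarrow> gen P g \<subseteq> I"
  unfolding gen_def by auto

lemma gen_mem:
  assumes "wf_presentation P" "b \<in> Fpow (gens P)" "g \<in> b"
  shows "b \<in> gen P g"
proof -
  have "g \<in> gens P" using assms by (auto simp: Fpow_def)
  from pidealD(4)[OF pideal_gen[OF assms(1) this] assms(2)] show ?thesis using assms by simp
qed

lemma gen_image_pideal:
  assumes "wf_presentation P" "b \<in> Fpow (gens P)"
  shows "gen P ` b \<subseteq> {I. pideal P I}" "gen P ` b \<subseteq> carrier (presented P)" "finite (gen P ` b)"
proof -
  have "b \<subseteq> gens P" "finite b" using assms(2) by (auto simp: Fpow_def)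
  then show 1: "gen P ` b \<subseteq> {I. pideal P I}" and "finite (gen P ` b)"
    using pideal_gen(1)[OF assms(1)] by blast+
  from 1 show "gen P ` b \<subseteq> carrier (presented P)" by (simp add: presented_def)
qed

text \<open>The formal infimum of \<open>a\<close>.\<close>

lemma Inter_gen:
  assumes wf: "wf_presentation P" and a: "a \<in> Fpow (gens P)" and I: "pideal P I" "a \<in> I"
  shows "Fpow (gens P) \<inter> \<Inter>(gen P ` a) \<subseteq> I"
proof -
  have "finite a" "a \<subseteq> gens P" using a by (auto simp: Fpow_def)
  then have "\<forall>I. pideal P I \<longrightarrow> a \<in> I \<longrightarrow> Fpow (gens P) \<inter> \<Inter>(gen P ` a) \<subseteq> I"
  proof (induction a)
    case empty
    then show ?case by (auto dest: pidealD(4))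
  next
    case (insert g a)
    show ?case
    proof (intro allI impI subsetI)
      fix I x assume I: "pideal P I" "insert g a \<in> I" and x: "x \<in> Fpow (gens P) \<inter> \<Inter>(gen P ` insert g a)"
      have ga: "{g} \<in> Fpow (gens P)" "a \<in> Fpow (gens P)" using insert by (auto simp: Fpow_def)
      let ?J = "Fpow (gens P) \<inter> \<Inter>(gen P ` a)"
      have "pideal P {d \<in> Fpow (gens P). \<forall>e\<in>{{g}}. d \<union> e \<in> I}"
        by (rule pideal_residual[OF I(1) wf]) (use ga in auto)
      then have "?J \<subseteq> {d \<in> Fpow (gens P). \<forall>e\<in>{{g}}. d \<union> e \<in> I}"
        using insert I ga by auto
      then have "{g} \<in> {c \<in> Fpow (gens P). \<forall>d\<in>?J. c \<union> d \<in> I}"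
        using ga by (auto simp: Un_commute)
      then have "gen P g \<subseteq> {c \<in> Fpow (gens P). \<forall>d\<in>?J. c \<union> d \<in> I}"
        by (intro gen_subset pideal_residual[OF I(1) wf]) auto
      then have "x \<union> x \<in> I" using x by blast
      then show "x \<in> I" by simp
    qed
  qed
  then show ?thesis using I by blast
qed

lemma gen_satisfies:
  assumes wf: "wf_presentation P"
  shows "satisfies P (presented P) (gen P)"
  unfolding satisfies_def
proof (intro conjI ballI funcsetI; clarify?)
  fix g assume "g \<in> gens P"
  then show "gen P g \<in> carrier (presented P)" using pideal_gen[OF wf] by (simp add: presented_def)
next
  fix a B assume r: "(a, B) \<in> rels P"
  then have aB: "a \<in> Fpow (gens P)" "B \<subseteq> Fpow (gens P)" using wf by (auto simp: wf_presentation_def)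
  have inf: "\<Sqinter>\<^bsub>presented P\<^esub>(gen P ` b) = Fpow (gens P) \<inter> \<Inter>(gen P ` b)" if "b \<in> Fpow (gens P)" for b
    by (rule presented_lattice(2)[OF wf gen_image_pideal(1)[OF wf that]])
  have inf_closed: "pideal P (\<Sqinter>\<^bsub>presented P\<^esub>(gen P ` b))" if "b \<in> Fpow (gens P)" for b
  proof -
    interpret complete_lattice "presented P" by (rule presented_lattice[OF wf])
    from inf_closed[OF gen_image_pideal(2)[OF wf that]] show ?thesis by (simp add: presented_def)
  qed
  have "\<Sqinter>\<^bsub>presented P\<^esub>(gen P ` a) \<subseteq> I"
    if I: "pideal P I" and u: "\<Union>((\<lambda>b. \<Sqinter>\<^bsub>presented P\<^esub>(gen P ` b)) ` B) \<subseteq> I" for I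
  proof -
    have "b \<in> \<Sqinter>\<^bsub>presented P\<^esub>(gen P ` b)" if "b \<in> Fpow (gens P)" for b
      unfolding inf[OF that]
      using that gen_mem[OF wf that] by simp
    then have "B \<subseteq> I" using u aB(2) by blast
    then have "a \<union> {} \<in> I" using r I by (intro pidealD(5)) (auto simp: Fpow_def)
    then have "a \<in> I" by simp
    show ?thesis unfolding inf[OF aB(1)] by (rule Inter_gen[OF wf aB(1) I \<open>a \<in> I\<close>])
  qed
  then have "\<Sqinter>\<^bsub>presented P\<^esub>(gen P ` a)
      \<subseteq> \<Inter>{I \<in> {I. pideal P I}. \<Union>((\<lambda>b. \<Sqinter>\<^bsub>presented P\<^esub>(gen P ` b)) ` B) \<subseteq> I}" by blast
  moreover have "(\<lambda>b. \<Sqinter>\<^bsub>presented P\<^esub>(gen P ` b)) ` B \<subseteq> {I. pideal P I}"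
    using aB(2) inf_closed by blast
  moreover have "le (presented P) = (\<subseteq>)" by (simp add: presented_def)
  ultimately show "\<Sqinter>\<^bsub>presented P\<^esub>(gen P ` a)
      \<sqsubseteq>\<^bsub>presented P\<^esub> \<Squnion>\<^bsub>presented P\<^esub>((\<lambda>b. \<Sqinter>\<^bsub>presented P\<^esub>(gen P ` b)) ` B)"
    by (simp only: presented_lattice(3)[OF wf])
qed

theorem presented_universal:
  assumes wf: "wf_presentation P" and L: "frame_lattice L" and sat: "satisfies P L \<phi>"
  shows "\<exists>!h. h \<in> frame_homs (presented P) L \<and> (\<forall>g\<in>gens P. h (gen P g) = \<phi> g)"
proof -
  interpret L: frame_lattice L by fact
  interpret P: frame_lattice "presented P" by (rule presented_frame[OF wf])
  have carr: "carrier (presented P) = {I. pideal P I}" and le: "le (presented P) = (\<subseteq>)"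
    by (simp_all add: presented_def)
  have \<phi>: "\<phi> ` a \<subseteq> carrier L" if "a \<in> Fpow (gens P)" for a
    using sat that by (auto simp: satisfies_def Fpow_def)
  let ?m = "\<lambda>a. \<Sqinter>\<^bsub>L\<^esub>(\<phi> ` a)"
  have m: "?m a \<in> carrier L" if "a \<in> Fpow (gens P)" for a using \<phi>[OF that] by simp
  have mI: "?m ` I \<subseteq> carrier L" if "pideal P I" for I using m pidealD(1)[OF that] by auto
  have mUn: "?m (a \<union> b) = ?m a \<sqinter>\<^bsub>L\<^esub> ?m b" if "a \<in> Fpow (gens P)" "b \<in> Fpow (gens P)" for a b
    using L.inf_Un[OF \<phi> \<phi>, OF that] by (simp add: image_Un)
  define D where "D s = {a \<in> Fpow (gens P). ?m a \<sqsubseteq>\<^bsub>L\<^esub> s}" for s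
  have D: "pideal P (D s)" if s: "s \<in> carrier L" for s
    unfolding pideal_def
  proof (intro conjI allI impI)
    fix b c assume *: "b \<in> D s" "c \<in> Fpow (gens P)" "b \<subseteq> c"
    then have "?m c \<sqsubseteq>\<^bsub>L\<^esub> ?m b"
      using m mUn[of b c] L.bin_meet(2)[of "?m b" "?m c"] by (auto simp: D_def Un_absorb1)
    then show "c \<in> D s" using * s m by (auto simp: D_def intro: L.le_trans)
  next
    fix a B c assume r: "(a, B) \<in> rels P" and c: "c \<in> Fpow (gens P)" and b: "\<forall>b\<in>B. b \<union> c \<in> D s"
    have aB: "a \<in> Fpow (gens P)" "B \<subseteq> Fpow (gens P)" using wf r by (auto simp: wf_presentation_def)
    have sB: "\<Squnion>\<^bsub>L\<^esub>(?m ` B) \<in> carrier L" using m aB by (intro L.sup_closed) auto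
    have "?m a \<sqinter>\<^bsub>L\<^esub> ?m c \<sqsubseteq>\<^bsub>L\<^esub> \<Squnion>\<^bsub>L\<^esub>(?m ` B) \<sqinter>\<^bsub>L\<^esub> ?m c"
    proof (rule L.bin_meet(4))
      have "?m a \<sqsubseteq>\<^bsub>L\<^esub> \<Squnion>\<^bsub>L\<^esub>(?m ` B)" using sat r by (auto simp: satisfies_def)
      then show "?m a \<sqinter>\<^bsub>L\<^esub> ?m c \<sqsubseteq>\<^bsub>L\<^esub> \<Squnion>\<^bsub>L\<^esub>(?m ` B)"
        using m[OF aB(1)] m[OF c] sB by (intro L.le_trans[OF L.bin_meet(2)]) (auto simp: L.bin_meet(1))
    qed (use m[OF aB(1)] m[OF c] sB in \<open>auto intro: L.bin_meet\<close>)
    also have "\<dots> \<sqsubseteq>\<^bsub>L\<^esub> s"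
    proof -
      have "\<Squnion>\<^bsub>L\<^esub>(?m ` B) \<sqinter>\<^bsub>L\<^esub> \<Squnion>\<^bsub>L\<^esub>{?m c} \<sqsubseteq>\<^bsub>L\<^esub> s"
        using m aB c s b mUn by (intro L.Sup_meet_Sup) (auto simp: D_def subset_iff)
      then show ?thesis using m[OF c] by simp
    qed
    finally show "a \<union> c \<in> D s"
      using aB(1) c s sB m[OF c] m[OF aB(1)] L.bin_meet(1) by (simp add: D_def Fpow_Un mUn[OF aB(1) c])
  qed (auto simp: D_def)
  define h where "h = (\<lambda>I\<in>carrier (presented P). \<Squnion>\<^bsub>L\<^esub>(?m ` I))"
  have h_le: "h I \<sqsubseteq>\<^bsub>L\<^esub> s \<longleftrightarrow> I \<subseteq> D s" if "pideal P I" "s \<in> carrier L" for I s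
    using that mI[OF that(1)] pidealD(1)[OF that(1)]
    by (auto simp: h_def carr L.sup_le_iff D_def)
  have hc: "h I \<in> carrier L" if "pideal P I" for I using that mI by (auto simp: h_def carr)
  have h_up: "?m a \<sqsubseteq>\<^bsub>L\<^esub> h I" if "pideal P I" "a \<in> I" for a I
    using that mI by (auto simp: h_def carr intro!: L.sup_upper)
  have mono: "h I \<sqsubseteq>\<^bsub>L\<^esub> h J" if "pideal P I" "pideal P J" "I \<subseteq> J" for I J
    using h_le[OF that(1) hc[OF that(2)]] h_le[OF that(2) hc[OF that(2)]] hc[OF that(2)] that by auto
  have mg: "?m {g} = \<phi> g" if "g \<in> gens P" for g using \<phi>[of "{g}"] that by (simp add: Fpow_def)
  have pmeet: "I \<sqinter>\<^bsub>presented P\<^esub> J = I \<inter> J" if "pideal P I" "pideal P J" for I J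
    using that pidealD(1)[of P I] presented_lattice(2)[OF wf, of "{I, J}"] by (auto simp: meet_def)
  have hgen: "h (gen P g) = \<phi> g" if g: "g \<in> gens P" for g
  proof (rule L.le_antisym)
    have "\<phi> g \<in> carrier L" using sat g by (auto simp: satisfies_def)
    then show "h (gen P g) \<sqsubseteq>\<^bsub>L\<^esub> \<phi> g"
      using h_le pideal_gen[OF wf g] D gen_subset[OF D, of "\<phi> g" g] mg[OF g] g
      by (auto simp: D_def Fpow_def)
    show "\<phi> g \<sqsubseteq>\<^bsub>L\<^esub> h (gen P g)" using h_up[OF pideal_gen[OF wf g]] mg[OF g] by simp
  qed (use sat g hc pideal_gen[OF wf g] in \<open>auto simp: satisfies_def\<close>)
  have h_hom: "h \<in> frame_homs (presented P) L"
  proof (rule frame_homsI[OF P.frame_lattice_axioms L])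
    show "h \<in> carrier (presented P) \<rightarrow>\<^sub>E carrier L" using hc by (auto simp: h_def carr)
    have top: "\<top>\<^bsub>presented P\<^esub> = Fpow (gens P)"
      using presented_lattice(2)[OF wf, of "{}"] P.inf_empty' by simp
    have "?m {} \<sqsubseteq>\<^bsub>L\<^esub> h \<top>\<^bsub>presented P\<^esub>"
      using pideal_Fpow[OF wf] by (intro h_up) (auto simp: top Fpow_def)
    then show "h \<top>\<^bsub>presented P\<^esub> = \<top>\<^bsub>L\<^esub>"
      using hc[OF pideal_Fpow[OF wf]]
      by (intro L.le_antisym) (auto simp: top L.inf_empty' intro!: L.top_higher)
  next
    fix I J assume "I \<in> carrier (presented P)" "J \<in> carrier (presented P)"
    then have I: "pideal P I" and J: "pideal P J" by (auto simp: carr)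
    have IJ: "pideal P (I \<inter> J)" using pideal_Inter[of "{I, J}" P] I J by auto
    have "h I \<sqinter>\<^bsub>L\<^esub> h J \<sqsubseteq>\<^bsub>L\<^esub> h (I \<inter> J)"
    proof -
      have "\<Squnion>\<^bsub>L\<^esub>(?m ` I) \<sqinter>\<^bsub>L\<^esub> \<Squnion>\<^bsub>L\<^esub>(?m ` J) \<sqsubseteq>\<^bsub>L\<^esub> h (I \<inter> J)"
      proof (rule L.Sup_meet_Sup[OF mI[OF I] mI[OF J] hc[OF IJ]])
        fix p q assume "p \<in> ?m ` I" "q \<in> ?m ` J"
        then obtain a b where ab: "a \<in> I" "b \<in> J" "p = ?m a" "q = ?m b" by blast
        have "a \<union> b \<in> I \<inter> J" using ab pidealD(1,2)[OF I] pidealD(1,3)[OF J] by auto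
        then show "p \<sqinter>\<^bsub>L\<^esub> q \<sqsubseteq>\<^bsub>L\<^esub> h (I \<inter> J)"
          using h_up[OF IJ] mUn[of a b] ab pidealD(1)[OF I] pidealD(1)[OF J] by metis
      qed
      then show ?thesis using I J by (simp add: h_def carr)
    qed
    then show "h (I \<sqinter>\<^bsub>presented P\<^esub> J) = h I \<sqinter>\<^bsub>L\<^esub> h J"
      unfolding pmeet[OF I J]
      by (intro L.le_antisym L.bin_meet) (use I J IJ in \<open>auto intro!: mono hc L.bin_meet(1)\<close>)
  next
    fix A assume A: "A \<subseteq> carrier (presented P)"
    then have A': "A \<subseteq> {I. pideal P I}" by (simp add: carr)
    have hA: "h ` A \<subseteq> carrier L" using A' hc by auto
    have sA: "pideal P (\<Squnion>\<^bsub>presented P\<^esub>A)" using P.sup_closed[OF A] by (simp add: carr)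
    let ?s = "\<Squnion>\<^bsub>L\<^esub>(h ` A)"
    have s: "?s \<in> carrier L" using hA by simp
    have "I \<subseteq> D ?s" if "I \<in> A" for I
      using that A' h_le[of I ?s] s L.sup_upper[OF hA] by auto
    then have "\<Squnion>\<^bsub>presented P\<^esub>A \<subseteq> D ?s"
      using D[OF s] by (subst presented_lattice(3)[OF wf A']) auto
    then have 1: "h (\<Squnion>\<^bsub>presented P\<^esub>A) \<sqsubseteq>\<^bsub>L\<^esub> ?s" using h_le[OF sA s] by simp
    have "I \<subseteq> \<Squnion>\<^bsub>presented P\<^esub>A" if "I \<in> A" for I using P.sup_upper[OF A that] by (simp add: le)
    then have 2: "?s \<sqsubseteq>\<^bsub>L\<^esub> h (\<Squnion>\<^bsub>presented P\<^esub>A)"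
      using mono[OF _ sA] A' hA hc[OF sA] by (auto simp: L.sup_le_iff)
    show "h (\<Squnion>\<^bsub>presented P\<^esub>A) = ?s" by (rule L.le_antisym[OF 1 2 hc[OF sA] s])
  qed
  have uniq: "k = h" if k: "k \<in> frame_homs (presented P) L" "\<forall>g\<in>gens P. k (gen P g) = \<phi> g" for k
  proof -
    note kD = frame_homsD[OF P.frame_lattice_axioms L k(1)] and hD = frame_homsD[OF P.frame_lattice_axioms L h_hom]
    have gc: "gen P ` a \<subseteq> carrier (presented P)" "finite (gen P ` a)" if "a \<in> Fpow (gens P)" for a
      by (rule gen_image_pideal(2,3)[OF wf that])+
    have "k I = h I" if I: "pideal P I" for I
    proof -
      let ?G = "\<lambda>a. \<Sqinter>\<^bsub>presented P\<^esub>(gen P ` a)"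
      have G: "?G ` I \<subseteq> carrier (presented P)"
        by (intro image_subsetI P.inf_closed gc pidealD(1)[OF I])
      have Ga: "?G a = Fpow (gens P) \<inter> \<Inter>(gen P ` a)" if "a \<in> Fpow (gens P)" for a
        by (rule presented_lattice(2)[OF wf gen_image_pideal(1)[OF wf that]])
      have G1: "?G a \<subseteq> I" if "a \<in> I" for a
        unfolding Ga[OF pidealD(1)[OF I that]]
        by (rule Inter_gen[OF wf pidealD(1)[OF I that] I that])
      have G2: "a \<in> ?G a" if "a \<in> I" for a
        unfolding Ga[OF pidealD(1)[OF I that]]
        using pidealD(1)[OF I that] gen_mem[OF wf pidealD(1)[OF I that]] by simp
      have S1: "\<Squnion>\<^bsub>presented P\<^esub>(?G ` I) \<subseteq> I"
        by (rule presented_sup_subset[OF wf G[unfolded carr] I]) (use G1 in blast)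
      have "?G a \<subseteq> \<Squnion>\<^bsub>presented P\<^esub>(?G ` I)" if "a \<in> I" for a
        using P.sup_upper[OF G, of "?G a"] that unfolding le by blast
      then have S: "I = \<Squnion>\<^bsub>presented P\<^esub>(?G ` I)"
        using S1 G2 by blast
      have "k (?G a) = h (?G a)" if a: "a \<in> I" for a
      proof -
        have F: "a \<in> Fpow (gens P)" using pidealD(1)[OF I a] .
        have "k ` gen P ` a = h ` gen P ` a"
          unfolding image_image
        proof (rule image_cong[OF refl])
          fix g assume "g \<in> a"
          then have "g \<in> gens P" using F by (auto simp: Fpow_def)
          then show "k (gen P g) = h (gen P g)" using k(2) hgen by simp
        qed
        then show ?thesis using kD(5)[OF gc[OF F]] hD(5)[OF gc[OF F]] by simp
      qed
      then have "k ` ?G ` I = h ` ?G ` I" unfolding image_image by (rule image_cong[OF refl])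
      then show ?thesis using kD(4)[OF G] hD(4)[OF G] S by metis
    qed
    then show ?thesis
      by (intro PiE_ext[OF kD(1) hD(1)]) (simp add: carr)
  qed
  show ?thesis
  proof (rule ex1I[of _ h])
    show "h \<in> frame_homs (presented P) L \<and> (\<forall>g\<in>gens P. h (gen P g) = \<phi> g)"
      using h_hom hgen by blast
  qed (use uniq in blast)
qed

corollary gen_hom:
  assumes "wf_presentation P" "frame_lattice L" "satisfies P L \<phi>"
  shows "gen_hom P L \<phi> \<in> frame_homs (presented P) L"
    and "\<And>g. g \<in> gens P \<Longrightarrow> gen_hom P L \<phi> (gen P g) = \<phi> g"
  using theI'[OF presented_universal[OF assms], folded gen_hom_def] by blast+


section \<open>Universal property of the coproduct\<close>

lemma (in frame_lattice) Sup_meet_distrib: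
  "\<lbrakk>x \<in> carrier L; A \<subseteq> carrier L\<rbrakk> \<Longrightarrow> \<Squnion>A \<sqinter> x = \<Squnion>((\<lambda>a. a \<sqinter> x) ` A)"
  using meet_Sup_distrib[of x A] meet_comm[of L] by simp

lemma (in frame_lattice) bin_meet_mono:
  assumes c: "p \<in> carrier L" "q \<in> carrier L" "p' \<in> carrier L" "q' \<in> carrier L"
    and le: "p \<sqsubseteq> p'" "q \<sqsubseteq> q'"
  shows "p \<sqinter> q \<sqsubseteq> p' \<sqinter> q'"
proof (rule bin_meet(4)[OF c(3,4)])
  note m = bin_meet(1-3)[OF c(1,2)]
  show "p \<sqinter> q \<in> carrier L" by (rule m)
  show "p \<sqinter> q \<sqsubseteq> p'" by (rule le_trans[OF m(2) le(1) m(1) c(1) c(3)])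
  show "p \<sqinter> q \<sqsubseteq> q'" by (rule le_trans[OF m(3) le(2) m(1) c(2) c(4)])
qed

lemma biidealD:
  assumes "biideal L M I"
  shows "(a, b) \<in> I \<Longrightarrow> a \<in> carrier L" "(a, b) \<in> I \<Longrightarrow> b \<in> carrier M"
    "I \<subseteq> carrier L \<times> carrier M"
    "\<lbrakk>(a, b) \<in> I; a' \<in> carrier L; b' \<in> carrier M; a' \<sqsubseteq>\<^bsub>L\<^esub> a; b' \<sqsubseteq>\<^bsub>M\<^esub> b\<rbrakk> \<Longrightarrow> (a', b') \<in> I"
    "\<lbrakk>A \<subseteq> carrier L; b \<in> carrier M; \<And>a. a \<in> A \<Longrightarrow> (a, b) \<in> I\<rbrakk> \<Longrightarrow> (\<Squnion>\<^bsub>L\<^esub>A, b) \<in> I"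
    "\<lbrakk>a \<in> carrier L; B \<subseteq> carrier M; \<And>b. b \<in> B \<Longrightarrow> (a, b) \<in> I\<rbrakk> \<Longrightarrow> (a, \<Squnion>\<^bsub>M\<^esub>B) \<in> I"
proof -
  note p = assms[unfolded biideal_def]
  show 3: "I \<subseteq> carrier L \<times> carrier M" by (rule p[THEN conjunct1])
  show "(a, b) \<in> I \<Longrightarrow> a \<in> carrier L" "(a, b) \<in> I \<Longrightarrow> b \<in> carrier M" using 3 by blast+
  show "(a', b') \<in> I"
    if "(a, b) \<in> I" "a' \<in> carrier L" "b' \<in> carrier M" "a' \<sqsubseteq>\<^bsub>L\<^esub> a" "b' \<sqsubseteq>\<^bsub>M\<^esub> b"
    using p[THEN conjunct2, THEN conjunct1] that by blast
  show "(\<Squnion>\<^bsub>L\<^esub>A, b) \<in> I"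
    if "A \<subseteq> carrier L" "b \<in> carrier M" "\<And>a. a \<in> A \<Longrightarrow> (a, b) \<in> I"
  proof -
    have "A \<times> {b} \<subseteq> I" using that(3) by blast
    then show ?thesis using p[THEN conjunct2, THEN conjunct2, THEN conjunct1] that(1,2) by blast
  qed
  show "(a, \<Squnion>\<^bsub>M\<^esub>B) \<in> I"
    if "a \<in> carrier L" "B \<subseteq> carrier M" "\<And>b. b \<in> B \<Longrightarrow> (a, b) \<in> I"
  proof -
    have "{a} \<times> B \<subseteq> I" using that(3) by blast
    then show ?thesis using p[THEN conjunct2, THEN conjunct2, THEN conjunct2] that(1,2) by blast
  qed
qed

lemma biidealI:
  assumes "I \<subseteq> carrier L \<times> carrier M"
    "\<And>a b a' b'. \<lbrakk>(a, b) \<in> I; a' \<in> carrier L; b' \<in> carrier M; a' \<sqsubseteq>\<^bsub>L\<^esub> a; b' \<sqsubseteq>\<^bsub>M\<^esub> b\<rbrakk> \<Longrightarrow> (a', b') \<in> I"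
    "\<And>A b. \<lbrakk>A \<subseteq> carrier L; b \<in> carrier M; \<And>a. a \<in> A \<Longrightarrow> (a, b) \<in> I\<rbrakk> \<Longrightarrow> (\<Squnion>\<^bsub>L\<^esub>A, b) \<in> I"
    "\<And>a B. \<lbrakk>a \<in> carrier L; B \<subseteq> carrier M; \<And>b. b \<in> B \<Longrightarrow> (a, b) \<in> I\<rbrakk> \<Longrightarrow> (a, \<Squnion>\<^bsub>M\<^esub>B) \<in> I"
  shows "biideal L M I"
  unfolding biideal_def
proof (intro conjI allI impI)
  fix A b assume "A \<subseteq> carrier L" "b \<in> carrier M" "A \<times> {b} \<subseteq> I"
  then show "(\<Squnion>\<^bsub>L\<^esub>A, b) \<in> I" using assms(3)[of A b] by blast
next
  fix a B assume "a \<in> carrier L" "B \<subseteq> carrier M" "{a} \<times> B \<subseteq> I"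
  then show "(a, \<Squnion>\<^bsub>M\<^esub>B) \<in> I" using assms(4)[of a B] by blast
qed (use assms(1,2) in blast)+

lemma biideal_Inter:
  assumes "A \<noteq> {}" "\<And>I. I \<in> A \<Longrightarrow> biideal L M I"
  shows "biideal L M (\<Inter>A)"
proof (rule biidealI)
  show "\<Inter>A \<subseteq> carrier L \<times> carrier M" using assms biidealD(3) by blast
next
  fix a b a' b'
  assume "(a, b) \<in> \<Inter>A" "a' \<in> carrier L" "b' \<in> carrier M" "a' \<sqsubseteq>\<^bsub>L\<^esub> a" "b' \<sqsubseteq>\<^bsub>M\<^esub> b"
  then show "(a', b') \<in> \<Inter>A" using biidealD(4)[OF assms(2)] by blast
next
  fix S b assume "S \<subseteq> carrier L" "b \<in> carrier M" "\<And>a. a \<in> S \<Longrightarrow> (a, b) \<in> \<Inter>A"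
  then show "(\<Squnion>\<^bsub>L\<^esub>S, b) \<in> \<Inter>A" using biidealD(5)[OF assms(2)] by blast
next
  fix a S assume "a \<in> carrier L" "S \<subseteq> carrier M" "\<And>b. b \<in> S \<Longrightarrow> (a, b) \<in> \<Inter>A"
  then show "(a, \<Squnion>\<^bsub>M\<^esub>S) \<in> \<Inter>A" using biidealD(6)[OF assms(2)] by blast
qed

locale frame_pair = L: frame_lattice L + M: frame_lattice M for L :: "'a gorder" and M :: "'b gorder"
begin

lemma biideal_top: "biideal L M (carrier L \<times> carrier M)"
  by (rule biidealI) auto

lemma tensor_lattice:
  shows "complete_lattice (L \<otimes> M)"
    and "\<And>A. A \<subseteq> {I. biideal L M I} \<Longrightarrow> \<Sqinter>\<^bsub>L \<otimes> M\<^esub>A = (carrier L \<times> carrier M) \<inter> \<Inter>A"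
    and "\<And>A. A \<subseteq> {I. biideal L M I} \<Longrightarrow> \<Squnion>\<^bsub>L \<otimes> M\<^esub>A = \<Inter>{I \<in> {I. biideal L M I}. \<Union>A \<subseteq> I}"
proof -
  have *: "carrier L \<times> carrier M \<in> {I. biideal L M I}"
    "\<And>I. I \<in> {I. biideal L M I} \<Longrightarrow> I \<subseteq> carrier L \<times> carrier M"
    "\<And>A. A \<subseteq> {I. biideal L M I} \<Longrightarrow> A \<noteq> {} \<Longrightarrow> \<Inter>A \<in> {I. biideal L M I}"
    using biideal_top biidealD(3) biideal_Inter[of _ L M] by blast+
  note i = inter_system_lattice[where K = "{I. biideal L M I}" and U = "carrier L \<times> carrier M", folded tensor_def]
  show "complete_lattice (L \<otimes> M)" by (rule i(1)) (use * in auto)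
  show "\<Sqinter>\<^bsub>L \<otimes> M\<^esub>A = (carrier L \<times> carrier M) \<inter> \<Inter>A" if "A \<subseteq> {I. biideal L M I}" for A
    by (rule i(2)[OF _ _ _ that]) (use * in auto)
  show "\<Squnion>\<^bsub>L \<otimes> M\<^esub>A = \<Inter>{I \<in> {I. biideal L M I}. \<Union>A \<subseteq> I}" if "A \<subseteq> {I. biideal L M I}" for A
    by (rule i(3)[OF _ _ _ that]) (use * in auto)
qed

lemma tensor_carrier: "carrier (L \<otimes> M) = {I. biideal L M I}"
  and tensor_le: "le (L \<otimes> M) = (\<subseteq>)"
  by (simp_all add: tensor_def)

lemma tensor_sup_subset:
  assumes "A \<subseteq> {I. biideal L M I}" "biideal L M I" "\<And>J. J \<in> A \<Longrightarrow> J \<subseteq> I"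
  shows "\<Squnion>\<^bsub>L \<otimes> M\<^esub>A \<subseteq> I"
  unfolding tensor_lattice(3)[OF assms(1)] using assms(2,3) by blast

lemma tensor_meet:
  assumes "biideal L M I" "biideal L M J" shows "I \<sqinter>\<^bsub>L \<otimes> M\<^esub> J = I \<inter> J"
  using tensor_lattice(2)[of "{I, J}"] biidealD(3)[OF assms(1)] assms by (auto simp: meet_def)

lemma biideal_residual:
  assumes T: "biideal L M T" and x: "x \<subseteq> carrier L \<times> carrier M"
  shows "biideal L M {(p, q) \<in> carrier L \<times> carrier M.
    \<forall>(p', q')\<in>x. (p \<sqinter>\<^bsub>L\<^esub> p', q \<sqinter>\<^bsub>M\<^esub> q') \<in> T}" (is "biideal L M ?R")
proof -
  have mem: "(p, q) \<in> ?R \<longleftrightarrow> p \<in> carrier L \<and> q \<in> carrier M \<and>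
    (\<forall>p' q'. (p', q') \<in> x \<longrightarrow> (p \<sqinter>\<^bsub>L\<^esub> p', q \<sqinter>\<^bsub>M\<^esub> q') \<in> T)" for p q by auto
  have xc: "p \<in> carrier L" "q \<in> carrier M" if "(p, q) \<in> x" for p q using that x by blast+
show ?thesis
proof (rule biidealI)
  show "?R \<subseteq> carrier L \<times> carrier M" by auto
next
  fix a b a' b'
  assume ab: "(a, b) \<in> ?R" and a': "a' \<in> carrier L" "b' \<in> carrier M" "a' \<sqsubseteq>\<^bsub>L\<^esub> a" "b' \<sqsubseteq>\<^bsub>M\<^esub> b"
  have "(a' \<sqinter>\<^bsub>L\<^esub> p, b' \<sqinter>\<^bsub>M\<^esub> q) \<in> T" if pq: "(p, q) \<in> x" for p q
  proof -
    have c: "p \<in> carrier L" "q \<in> carrier M" "a \<in> carrier L" "b \<in> carrier M" using xc[OF pq] ab[unfolded mem] by simp_all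
    have "a' \<sqinter>\<^bsub>L\<^esub> p \<sqsubseteq>\<^bsub>L\<^esub> a \<sqinter>\<^bsub>L\<^esub> p"
      by (rule L.bin_meet_mono[OF a'(1) c(1) c(3) c(1) a'(3) L.le_refl[OF c(1)]])
    moreover have "b' \<sqinter>\<^bsub>M\<^esub> q \<sqsubseteq>\<^bsub>M\<^esub> b \<sqinter>\<^bsub>M\<^esub> q"
      by (rule M.bin_meet_mono[OF a'(2) c(2) c(4) c(2) a'(4) M.le_refl[OF c(2)]])
    moreover have "(a \<sqinter>\<^bsub>L\<^esub> p, b \<sqinter>\<^bsub>M\<^esub> q) \<in> T" using ab[unfolded mem] pq by simp
    ultimately show ?thesis
      using biidealD(4)[OF T _ L.bin_meet(1)[OF a'(1) c(1)] M.bin_meet(1)[OF a'(2) c(2)]] by simp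
  qed
  then show "(a', b') \<in> ?R" unfolding mem using a' by simp
next
  fix A b assume A: "A \<subseteq> carrier L" "b \<in> carrier M" "\<And>a. a \<in> A \<Longrightarrow> (a, b) \<in> ?R"
  have "(\<Squnion>\<^bsub>L\<^esub>A \<sqinter>\<^bsub>L\<^esub> p, b \<sqinter>\<^bsub>M\<^esub> q) \<in> T" if pq: "(p, q) \<in> x" for p q
  proof -
    have c: "p \<in> carrier L" "q \<in> carrier M" using xc[OF pq] by simp_all
    show ?thesis unfolding L.Sup_meet_distrib[OF c(1) A(1)]
    proof (rule biidealD(5)[OF T])
      show "(\<lambda>a. a \<sqinter>\<^bsub>L\<^esub> p) ` A \<subseteq> carrier L" using A(1) c by (intro image_subsetI L.bin_meet(1)) auto
      show "b \<sqinter>\<^bsub>M\<^esub> q \<in> carrier M" by (rule M.bin_meet(1)[OF A(2) c(2)])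
      show "(a, b \<sqinter>\<^bsub>M\<^esub> q) \<in> T" if "a \<in> (\<lambda>a. a \<sqinter>\<^bsub>L\<^esub> p) ` A" for a
        using that A(3)[unfolded mem] pq by auto
    qed
  qed
  then show "(\<Squnion>\<^bsub>L\<^esub>A, b) \<in> ?R" unfolding mem using A(2) L.sup_closed[OF A(1)] by simp
next
  fix a B assume B: "a \<in> carrier L" "B \<subseteq> carrier M" "\<And>b. b \<in> B \<Longrightarrow> (a, b) \<in> ?R"
  have "(a \<sqinter>\<^bsub>L\<^esub> p, \<Squnion>\<^bsub>M\<^esub>B \<sqinter>\<^bsub>M\<^esub> q) \<in> T" if pq: "(p, q) \<in> x" for p q
  proof -
    have c: "p \<in> carrier L" "q \<in> carrier M" using xc[OF pq] by simp_all
    show ?thesis unfolding M.Sup_meet_distrib[OF c(2) B(2)]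
    proof (rule biidealD(6)[OF T])
      show "(\<lambda>a. a \<sqinter>\<^bsub>M\<^esub> q) ` B \<subseteq> carrier M" using B(2) c by (intro image_subsetI M.bin_meet(1)) auto
      show "a \<sqinter>\<^bsub>L\<^esub> p \<in> carrier L" by (rule L.bin_meet(1)[OF B(1) c(1)])
      show "(a \<sqinter>\<^bsub>L\<^esub> p, b) \<in> T" if "b \<in> (\<lambda>a. a \<sqinter>\<^bsub>M\<^esub> q) ` B" for b
        using that B(3)[unfolded mem] pq by auto
    qed
  qed
  then show "(a, \<Squnion>\<^bsub>M\<^esub>B) \<in> ?R" unfolding mem using B(1) M.sup_closed[OF B(2)] by simp
qed
qed

lemma tensor_frame: "frame_lattice (L \<otimes> M)"
proof -
  interpret T: complete_lattice "L \<otimes> M" by (rule tensor_lattice)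
  show ?thesis
  proof unfold_locales
    fix x A assume x: "x \<in> carrier (L \<otimes> M)" and A: "A \<subseteq> carrier (L \<otimes> M)"
    have px: "biideal L M x" using x by (simp add: tensor_carrier)
    have pA: "biideal L M a" if "a \<in> A" for a using A that by (auto simp: tensor_carrier)
    have sA: "biideal L M (\<Squnion>\<^bsub>L \<otimes> M\<^esub>A)" using T.sup_closed[OF A] by (simp add: tensor_carrier)
    let ?xA = "(\<lambda>a. x \<sqinter>\<^bsub>L \<otimes> M\<^esub> a) ` A"
    let ?T = "\<Squnion>\<^bsub>L \<otimes> M\<^esub>?xA"
    have sub: "?xA \<subseteq> carrier (L \<otimes> M)" using x A by auto
    have T: "biideal L M ?T" using T.sup_closed[OF sub] by (simp add: tensor_carrier)
    let ?R = "{(p, q) \<in> carrier L \<times> carrier M. \<forall>(p', q')\<in>x. (p \<sqinter>\<^bsub>L\<^esub> p', q \<sqinter>\<^bsub>M\<^esub> q') \<in> ?T}"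
    have up: "x \<inter> a \<subseteq> ?T" if "a \<in> A" for a
      using T.sup_upper[OF sub imageI[OF that]] unfolding tensor_le tensor_meet[OF px pA[OF that]] .
    have R: "a \<subseteq> ?R" if a: "a \<in> A" for a
    proof
      fix y assume "y \<in> a"
      then obtain p q where y: "y = (p, q)" and pq: "(p, q) \<in> a" by (cases y) auto
      have c: "p \<in> carrier L" "q \<in> carrier M" using biidealD(1,2)[OF pA[OF a] pq] .
      have "(p \<sqinter>\<^bsub>L\<^esub> p', q \<sqinter>\<^bsub>M\<^esub> q') \<in> x \<inter> a" if "(p', q') \<in> x" for p' q'
      proof -
        have c': "p' \<in> carrier L" "q' \<in> carrier M" using biidealD(1,2)[OF px that] .
        show ?thesis
          using biidealD(4)[OF pA[OF a] pq] biidealD(4)[OF px that] L.bin_meet[OF c(1) c'(1)] M.bin_meet[OF c(2) c'(2)]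
          by blast
      qed
      then show "y \<in> ?R"
        unfolding y using c up[OF a] by blast
    qed
    have "\<Squnion>\<^bsub>L \<otimes> M\<^esub>A \<subseteq> ?R"
      by (rule tensor_sup_subset[OF A[unfolded tensor_carrier] biideal_residual[OF T biidealD(3)[OF px]] R])
    have "x \<inter> \<Squnion>\<^bsub>L \<otimes> M\<^esub>A \<subseteq> ?T"
    proof clarify
      fix p q assume pq: "(p, q) \<in> x" "(p, q) \<in> \<Squnion>\<^bsub>L \<otimes> M\<^esub>A"
      have c: "p \<in> carrier L" "q \<in> carrier M" using biidealD(1,2)[OF px pq(1)] .
      have "(p \<sqinter>\<^bsub>L\<^esub> p, q \<sqinter>\<^bsub>M\<^esub> q) \<in> ?T" using \<open>\<Squnion>\<^bsub>L \<otimes> M\<^esub>A \<subseteq> ?R\<close> pq by blast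
      then show "(p, q) \<in> ?T"
        using c L.bin_meet(4)[OF c(1) c(1) c(1)] M.bin_meet(4)[OF c(2) c(2) c(2)]
        by (intro biidealD(4)[OF T, of "p \<sqinter>\<^bsub>L\<^esub> p" "q \<sqinter>\<^bsub>M\<^esub> q" p q]) auto
    qed
    moreover have "?T \<subseteq> x \<inter> \<Squnion>\<^bsub>L \<otimes> M\<^esub>A"
    proof (rule tensor_sup_subset[OF sub[unfolded tensor_carrier]])
      show "biideal L M (x \<inter> \<Squnion>\<^bsub>L \<otimes> M\<^esub>A)"
        using T.meet_closed[OF x T.sup_closed[OF A]] unfolding tensor_meet[OF px sA] tensor_carrier by simp
      fix J assume "J \<in> ?xA"
      then obtain a where a: "a \<in> A" "J = x \<inter> a" using tensor_meet[OF px pA] by blast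
      then show "J \<subseteq> x \<inter> \<Squnion>\<^bsub>L \<otimes> M\<^esub>A" using T.sup_upper[OF A a(1)] unfolding tensor_le by blast
    qed
    ultimately show "x \<sqinter>\<^bsub>L \<otimes> M\<^esub> \<Squnion>\<^bsub>L \<otimes> M\<^esub>A = ?T"
      unfolding tensor_meet[OF px sA] by blast
  qed
qed

lemma tens:
  assumes "a \<in> carrier L" "b \<in> carrier M"
  shows "biideal L M (tens L M a b)" "(a, b) \<in> tens L M a b" "tens L M a b \<in> carrier (L \<otimes> M)"
proof -
  show 1: "biideal L M (tens L M a b)"
    unfolding tens_def using biideal_top assms by (intro biideal_Inter) blast+
  show "(a, b) \<in> tens L M a b" unfolding tens_def by blast
  show "tens L M a b \<in> carrier (L \<otimes> M)" using 1 by (simp add: tensor_carrier)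
qed

lemma tens_subset: "biideal L M I \<Longrightarrow> (a, b) \<in> I \<Longrightarrow> tens L M a b \<subseteq> I"
  unfolding tens_def by blast

lemma tensor_Sup_tens:
  assumes I: "biideal L M I"
  shows "I = \<Squnion>\<^bsub>L \<otimes> M\<^esub>((\<lambda>(a, b). tens L M a b) ` I)"
    "(\<lambda>(a, b). tens L M a b) ` I \<subseteq> carrier (L \<otimes> M)"
proof -
  interpret T: complete_lattice "L \<otimes> M" by (rule tensor_lattice)
  show sub: "(\<lambda>(a, b). tens L M a b) ` I \<subseteq> carrier (L \<otimes> M)"
    using tens(3) biidealD(1,2)[OF I] by (intro image_subsetI) (auto split: prod.split)
  have "\<Squnion>\<^bsub>L \<otimes> M\<^esub>((\<lambda>(a, b). tens L M a b) ` I) \<subseteq> I"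
    by (rule tensor_sup_subset[OF sub[unfolded tensor_carrier] I]) (use tens_subset[OF I] in blast)
  moreover have "(a, b) \<in> \<Squnion>\<^bsub>L \<otimes> M\<^esub>((\<lambda>(a, b). tens L M a b) ` I)" if "(a, b) \<in> I" for a b
    using T.sup_upper[OF sub imageI[OF that]] tens(2)[OF biidealD(1,2)[OF I that]]
    unfolding tensor_le by auto
  ultimately show "I = \<Squnion>\<^bsub>L \<otimes> M\<^esub>((\<lambda>(a, b). tens L M a b) ` I)" by auto
qed

theorem tensor_universal:
  assumes N: "frame_lattice N" and f: "f \<in> frame_homs L N" and g: "g \<in> frame_homs M N"
  defines "h \<equiv> \<lambda>I\<in>carrier (L \<otimes> M). \<Squnion>\<^bsub>N\<^esub> {f a \<sqinter>\<^bsub>N\<^esub> g b | a b. (a, b) \<in> I}"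
  shows "h \<in> frame_homs (L \<otimes> M) N"
    and "\<And>a b. a \<in> carrier L \<Longrightarrow> b \<in> carrier M \<Longrightarrow> h (tens L M a b) = f a \<sqinter>\<^bsub>N\<^esub> g b"
    and "\<And>k. k \<in> frame_homs (L \<otimes> M) N \<Longrightarrow>
      (\<And>a b. a \<in> carrier L \<Longrightarrow> b \<in> carrier M \<Longrightarrow> k (tens L M a b) = f a \<sqinter>\<^bsub>N\<^esub> g b) \<Longrightarrow> k = h"
proof -
  interpret N: frame_lattice N by fact
  interpret T: frame_lattice "L \<otimes> M" by (rule tensor_frame)
  note fD = frame_homsD[OF L.frame_lattice_axioms N f] and gD = frame_homsD[OF M.frame_lattice_axioms N g]
  have fc: "f a \<in> carrier N" if "a \<in> carrier L" for a using fD(1) that by blast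
  have gc: "g a \<in> carrier N" if "a \<in> carrier M" for a using gD(1) that by blast
  have fmono: "f a \<sqsubseteq>\<^bsub>N\<^esub> f b" if "a \<in> carrier L" "b \<in> carrier L" "a \<sqsubseteq>\<^bsub>L\<^esub> b" for a b
  proof -
    have "a \<sqinter>\<^bsub>L\<^esub> b = a"
      using that L.bin_meet[OF that(1,2)] by (intro L.le_antisym) auto
    then have "f a = f a \<sqinter>\<^bsub>N\<^esub> f b" using fD(3)[OF that(1,2)] by simp
    then show ?thesis using N.bin_meet(3)[OF fc[OF that(1)] fc[OF that(2)]] by simp
  qed
  have gmono: "g a \<sqsubseteq>\<^bsub>N\<^esub> g b" if "a \<in> carrier M" "b \<in> carrier M" "a \<sqsubseteq>\<^bsub>M\<^esub> b" for a b
  proof -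
    have "a \<sqinter>\<^bsub>M\<^esub> b = a"
      using that M.bin_meet[OF that(1,2)] by (intro M.le_antisym) auto
    then have "g a = g a \<sqinter>\<^bsub>N\<^esub> g b" using gD(3)[OF that(1,2)] by simp
    then show ?thesis using N.bin_meet(3)[OF gc[OF that(1)] gc[OF that(2)]] by simp
  qed
  note mmono = N.bin_meet_mono
  let ?S = "\<lambda>I. {f a \<sqinter>\<^bsub>N\<^esub> g b | a b. (a, b) \<in> I}"
  have S: "?S I \<subseteq> carrier N" if "biideal L M I" for I
    using biidealD(1,2)[OF that] fc gc N.bin_meet(1) by blast
  have hI: "h I = \<Squnion>\<^bsub>N\<^esub>(?S I)" if "biideal L M I" for I
    using that by (simp add: h_def tensor_carrier)
  have hc: "h I \<in> carrier N" if "biideal L M I" for I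
    unfolding hI[OF that] by (rule N.sup_closed[OF S[OF that]])
  define D where "D s = {(a, b) \<in> carrier L \<times> carrier M. f a \<sqinter>\<^bsub>N\<^esub> g b \<sqsubseteq>\<^bsub>N\<^esub> s}" for s
  have D: "biideal L M (D s)" if s: "s \<in> carrier N" for s
  proof (rule biidealI)
    show "D s \<subseteq> carrier L \<times> carrier M" by (auto simp: D_def)
  next
    fix a b a' b'
    assume "(a, b) \<in> D s" and a': "a' \<in> carrier L" "b' \<in> carrier M" "a' \<sqsubseteq>\<^bsub>L\<^esub> a" "b' \<sqsubseteq>\<^bsub>M\<^esub> b"
    then have ab: "a \<in> carrier L" "b \<in> carrier M" "f a \<sqinter>\<^bsub>N\<^esub> g b \<sqsubseteq>\<^bsub>N\<^esub> s" by (auto simp: D_def)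
    have "f a' \<sqinter>\<^bsub>N\<^esub> g b' \<sqsubseteq>\<^bsub>N\<^esub> f a \<sqinter>\<^bsub>N\<^esub> g b"
      by (rule mmono[OF fc gc fc gc fmono gmono]) (use ab a' in auto)
    then have "f a' \<sqinter>\<^bsub>N\<^esub> g b' \<sqsubseteq>\<^bsub>N\<^esub> s"
      by (rule N.le_trans) (use ab a' s fc gc N.bin_meet(1) in auto)
    then show "(a', b') \<in> D s" using a' by (simp add: D_def)
  next
    fix A b assume A: "A \<subseteq> carrier L" "b \<in> carrier M" "\<And>a. a \<in> A \<Longrightarrow> (a, b) \<in> D s"
    have fA: "f ` A \<subseteq> carrier N" using A(1) fc by blast
    have "f (\<Squnion>\<^bsub>L\<^esub>A) \<sqinter>\<^bsub>N\<^esub> g b = \<Squnion>\<^bsub>N\<^esub>((\<lambda>a. a \<sqinter>\<^bsub>N\<^esub> g b) ` f ` A)"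
      unfolding fD(4)[OF A(1)] by (rule N.Sup_meet_distrib[OF gc[OF A(2)] fA])
    also have "\<dots> \<sqsubseteq>\<^bsub>N\<^esub> s"
    proof (rule N.sup_least)
      show "(\<lambda>a. a \<sqinter>\<^bsub>N\<^esub> g b) ` f ` A \<subseteq> carrier N" using fA gc[OF A(2)] N.bin_meet(1) by blast
      show "x \<sqsubseteq>\<^bsub>N\<^esub> s" if "x \<in> (\<lambda>a. a \<sqinter>\<^bsub>N\<^esub> g b) ` f ` A" for x
        using that A(3) unfolding D_def by blast
    qed fact
    finally show "(\<Squnion>\<^bsub>L\<^esub>A, b) \<in> D s" using A(2) L.sup_closed[OF A(1)] by (simp add: D_def)
  next
    fix a B assume B: "a \<in> carrier L" "B \<subseteq> carrier M" "\<And>b. b \<in> B \<Longrightarrow> (a, b) \<in> D s"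
    have gB: "g ` B \<subseteq> carrier N" using B(2) gc by blast
    have "f a \<sqinter>\<^bsub>N\<^esub> g (\<Squnion>\<^bsub>M\<^esub>B) = \<Squnion>\<^bsub>N\<^esub>((\<lambda>b. f a \<sqinter>\<^bsub>N\<^esub> b) ` g ` B)"
      unfolding gD(4)[OF B(2)] by (rule N.meet_Sup_distrib[OF fc[OF B(1)] gB])
    also have "\<dots> \<sqsubseteq>\<^bsub>N\<^esub> s"
    proof (rule N.sup_least)
      show "(\<lambda>b. f a \<sqinter>\<^bsub>N\<^esub> b) ` g ` B \<subseteq> carrier N" using gB fc[OF B(1)] N.bin_meet(1) by blast
      show "x \<sqsubseteq>\<^bsub>N\<^esub> s" if "x \<in> (\<lambda>b. f a \<sqinter>\<^bsub>N\<^esub> b) ` g ` B" for x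
        using that B(3) unfolding D_def by blast
    qed fact
    finally show "(a, \<Squnion>\<^bsub>M\<^esub>B) \<in> D s" using B(1) M.sup_closed[OF B(2)] by (simp add: D_def)
  qed
  have h_le: "h I \<sqsubseteq>\<^bsub>N\<^esub> s \<longleftrightarrow> I \<subseteq> D s" if I: "biideal L M I" and s: "s \<in> carrier N" for I s
    unfolding hI[OF I] N.sup_le_iff[OF S[OF I] s] D_def using biidealD(1,2)[OF I] by blast
  have h_up: "f a \<sqinter>\<^bsub>N\<^esub> g b \<sqsubseteq>\<^bsub>N\<^esub> h I" if I: "biideal L M I" and ab: "(a, b) \<in> I" for a b I
    unfolding hI[OF I] using ab by (intro N.sup_upper[OF S[OF I]]) blast
  have mono: "h I \<sqsubseteq>\<^bsub>N\<^esub> h J" if IJ: "biideal L M I" "biideal L M J" "I \<subseteq> J" for I J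
    using h_le[OF IJ(1) hc[OF IJ(2)]] h_le[OF IJ(2) hc[OF IJ(2)]] hc[OF IJ(2)] IJ(3) by auto
  show htens: "h (tens L M a b) = f a \<sqinter>\<^bsub>N\<^esub> g b" if ab: "a \<in> carrier L" "b \<in> carrier M" for a b
  proof (rule N.le_antisym)
    have c: "f a \<sqinter>\<^bsub>N\<^esub> g b \<in> carrier N" using N.bin_meet(1)[OF fc gc] ab by blast
    have "(a, b) \<in> D (f a \<sqinter>\<^bsub>N\<^esub> g b)" using ab c by (simp add: D_def)
    then show "h (tens L M a b) \<sqsubseteq>\<^bsub>N\<^esub> f a \<sqinter>\<^bsub>N\<^esub> g b"
      using h_le[OF tens(1)[OF ab] c] tens_subset[OF D[OF c]] by blast
    show "f a \<sqinter>\<^bsub>N\<^esub> g b \<sqsubseteq>\<^bsub>N\<^esub> h (tens L M a b)" by (rule h_up[OF tens(1,2)[OF ab]])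
    show "h (tens L M a b) \<in> carrier N" "f a \<sqinter>\<^bsub>N\<^esub> g b \<in> carrier N" by (rule hc[OF tens(1)[OF ab]], rule c)
  qed
  show h_hom: "h \<in> frame_homs (L \<otimes> M) N"
  proof (rule frame_homsI[OF T.frame_lattice_axioms N])
    show "h \<in> carrier (L \<otimes> M) \<rightarrow>\<^sub>E carrier N"
    proof (rule PiE_I)
      show "h I \<in> carrier N" if "I \<in> carrier (L \<otimes> M)" for I using that hc by (simp add: tensor_carrier)
      show "h I = undefined" if "I \<notin> carrier (L \<otimes> M)" for I using that by (simp add: h_def)
    qed
    have top: "\<top>\<^bsub>L \<otimes> M\<^esub> = carrier L \<times> carrier M"
      using tensor_lattice(2)[of "{}"] T.inf_empty' by simp
    have "f \<top>\<^bsub>L\<^esub> \<sqinter>\<^bsub>N\<^esub> g \<top>\<^bsub>M\<^esub> \<sqsubseteq>\<^bsub>N\<^esub> h (carrier L \<times> carrier M)"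
      by (rule h_up[OF biideal_top]) simp
    then have "\<top>\<^bsub>N\<^esub> \<sqinter>\<^bsub>N\<^esub> \<top>\<^bsub>N\<^esub> \<sqsubseteq>\<^bsub>N\<^esub> h (carrier L \<times> carrier M)" using fD(2) gD(2) by simp
    moreover have "\<top>\<^bsub>N\<^esub> \<sqinter>\<^bsub>N\<^esub> \<top>\<^bsub>N\<^esub> = \<top>\<^bsub>N\<^esub>"
      using N.bin_meet[OF N.top_closed N.top_closed] by (intro N.le_antisym) auto
    ultimately have "\<top>\<^bsub>N\<^esub> \<sqsubseteq>\<^bsub>N\<^esub> h (carrier L \<times> carrier M)" by simp
    then show "h \<top>\<^bsub>L \<otimes> M\<^esub> = \<top>\<^bsub>N\<^esub>"
      unfolding top using hc[OF biideal_top] by (intro N.le_antisym N.top_higher) auto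
  next
    fix I J assume "I \<in> carrier (L \<otimes> M)" "J \<in> carrier (L \<otimes> M)"
    then have I: "biideal L M I" and J: "biideal L M J" by (auto simp: tensor_carrier)
    have IJ: "biideal L M (I \<inter> J)" using biideal_Inter[of "{I, J}" L M] I J by auto
    have "\<Squnion>\<^bsub>N\<^esub>(?S I) \<sqinter>\<^bsub>N\<^esub> \<Squnion>\<^bsub>N\<^esub>(?S J) \<sqsubseteq>\<^bsub>N\<^esub> h (I \<inter> J)"
    proof (rule N.Sup_meet_Sup[OF S[OF I] S[OF J] hc[OF IJ]])
      fix p q assume "p \<in> ?S I" "q \<in> ?S J"
      then obtain a b c d where ab: "(a, b) \<in> I" "p = f a \<sqinter>\<^bsub>N\<^esub> g b" and cd: "(c, d) \<in> J" "q = f c \<sqinter>\<^bsub>N\<^esub> g d"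
        by blast
      have car: "a \<in> carrier L" "b \<in> carrier M" "c \<in> carrier L" "d \<in> carrier M"
        using biidealD(1,2)[OF I ab(1)] biidealD(1,2)[OF J cd(1)] .
      note l = L.bin_meet(1-3)[OF car(1,3)] and m = M.bin_meet(1-3)[OF car(2,4)]
      have "(a \<sqinter>\<^bsub>L\<^esub> c, b \<sqinter>\<^bsub>M\<^esub> d) \<in> I \<inter> J"
        using biidealD(4)[OF I ab(1) l(1) m(1) l(2) m(2)] biidealD(4)[OF J cd(1) l(1) m(1) l(3) m(3)] by blast
      from h_up[OF IJ this] have "f (a \<sqinter>\<^bsub>L\<^esub> c) \<sqinter>\<^bsub>N\<^esub> g (b \<sqinter>\<^bsub>M\<^esub> d) \<sqsubseteq>\<^bsub>N\<^esub> h (I \<inter> J)" .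
      moreover have "f (a \<sqinter>\<^bsub>L\<^esub> c) \<sqinter>\<^bsub>N\<^esub> g (b \<sqinter>\<^bsub>M\<^esub> d) = p \<sqinter>\<^bsub>N\<^esub> q"
      proof -
        have "(f a \<sqinter>\<^bsub>N\<^esub> f c) \<sqinter>\<^bsub>N\<^esub> (g b \<sqinter>\<^bsub>N\<^esub> g d) = (f a \<sqinter>\<^bsub>N\<^esub> g b) \<sqinter>\<^bsub>N\<^esub> (f c \<sqinter>\<^bsub>N\<^esub> g d)"
        proof -
          note c = fc[OF car(1)] gc[OF car(2)] fc[OF car(3)] gc[OF car(4)]
          have "(f a \<sqinter>\<^bsub>N\<^esub> f c) \<sqinter>\<^bsub>N\<^esub> (g b \<sqinter>\<^bsub>N\<^esub> g d) = f a \<sqinter>\<^bsub>N\<^esub> ((f c \<sqinter>\<^bsub>N\<^esub> g b) \<sqinter>\<^bsub>N\<^esub> g d)"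
            by (simp only: N.meet_assoc c N.bin_meet(1))
          also have "\<dots> = f a \<sqinter>\<^bsub>N\<^esub> ((g b \<sqinter>\<^bsub>N\<^esub> f c) \<sqinter>\<^bsub>N\<^esub> g d)"
            by (simp only: meet_comm[of N "f c" "g b"])
          also have "\<dots> = (f a \<sqinter>\<^bsub>N\<^esub> g b) \<sqinter>\<^bsub>N\<^esub> (f c \<sqinter>\<^bsub>N\<^esub> g d)"
            by (simp only: N.meet_assoc c N.bin_meet(1))
          finally show ?thesis .
        qed
        then show ?thesis using fD(3) gD(3) car ab(2) cd(2) by simp
      qed
      ultimately show "p \<sqinter>\<^bsub>N\<^esub> q \<sqsubseteq>\<^bsub>N\<^esub> h (I \<inter> J)" by simp
    qed
    then have 1: "h I \<sqinter>\<^bsub>N\<^esub> h J \<sqsubseteq>\<^bsub>N\<^esub> h (I \<inter> J)" unfolding hI[OF I] hI[OF J] .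
    have 2: "h (I \<inter> J) \<sqsubseteq>\<^bsub>N\<^esub> h I \<sqinter>\<^bsub>N\<^esub> h J"
      by (rule N.bin_meet(4)[OF hc[OF I] hc[OF J] hc[OF IJ] mono[OF IJ I] mono[OF IJ J]]) auto
    show "h (I \<sqinter>\<^bsub>L \<otimes> M\<^esub> J) = h I \<sqinter>\<^bsub>N\<^esub> h J"
      unfolding tensor_meet[OF I J]
      by (rule N.le_antisym[OF 2 1 hc[OF IJ] N.bin_meet(1)[OF hc[OF I] hc[OF J]]])
  next
    fix A assume A: "A \<subseteq> carrier (L \<otimes> M)"
    then have A': "A \<subseteq> {I. biideal L M I}" by (simp add: tensor_carrier)
    have hA: "h ` A \<subseteq> carrier N" using A' hc by blast
    have sA: "biideal L M (\<Squnion>\<^bsub>L \<otimes> M\<^esub>A)" using T.sup_closed[OF A] by (simp add: tensor_carrier)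
    let ?s = "\<Squnion>\<^bsub>N\<^esub>(h ` A)"
    have s: "?s \<in> carrier N" by (rule N.sup_closed[OF hA])
    have "I \<subseteq> D ?s" if "I \<in> A" for I
      using N.sup_upper[OF hA imageI[OF that]] h_le[OF _ s, of I] A' that by blast
    then have "\<Squnion>\<^bsub>L \<otimes> M\<^esub>A \<subseteq> D ?s" by (rule tensor_sup_subset[OF A' D[OF s]])
    then have 1: "h (\<Squnion>\<^bsub>L \<otimes> M\<^esub>A) \<sqsubseteq>\<^bsub>N\<^esub> ?s" using h_le[OF sA s] by simp
    have up: "I \<subseteq> \<Squnion>\<^bsub>L \<otimes> M\<^esub>A" if "I \<in> A" for I using T.sup_upper[OF A that] by (simp add: tensor_le)
    have 2: "?s \<sqsubseteq>\<^bsub>N\<^esub> h (\<Squnion>\<^bsub>L \<otimes> M\<^esub>A)"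
    proof (rule N.sup_least[OF hA hc[OF sA]])
      fix x assume "x \<in> h ` A"
      then show "x \<sqsubseteq>\<^bsub>N\<^esub> h (\<Squnion>\<^bsub>L \<otimes> M\<^esub>A)" using mono[OF _ sA up] A' by blast
    qed
    show "h (\<Squnion>\<^bsub>L \<otimes> M\<^esub>A) = ?s" by (rule N.le_antisym[OF 1 2 hc[OF sA] s])
  qed
  show "k = h" if k: "k \<in> frame_homs (L \<otimes> M) N"
    and kt: "\<And>a b. a \<in> carrier L \<Longrightarrow> b \<in> carrier M \<Longrightarrow> k (tens L M a b) = f a \<sqinter>\<^bsub>N\<^esub> g b" for k
  proof -
    note kD = frame_homsD[OF T.frame_lattice_axioms N k] and hD = frame_homsD[OF T.frame_lattice_axioms N h_hom]
    show ?thesis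
    proof (rule PiE_ext[OF kD(1) hD(1)])
      fix I assume "I \<in> carrier (L \<otimes> M)"
      then have I: "biideal L M I" by (simp add: tensor_carrier)
      let ?t = "(\<lambda>(a, b). tens L M a b) ` I"
      have "k ` ?t = h ` ?t"
        unfolding image_image
      proof (rule image_cong[OF refl])
        fix x assume "x \<in> I"
        then obtain a b where x: "x = (a, b)" "a \<in> carrier L" "b \<in> carrier M" using biidealD(3)[OF I] by blast
        show "k (case x of (a, b) \<Rightarrow> tens L M a b) = h (case x of (a, b) \<Rightarrow> tens L M a b)"
          using kt[OF x(2,3)] htens[OF x(2,3)] x(1) by simp
      qed
      then have "k (\<Squnion>\<^bsub>L \<otimes> M\<^esub>?t) = h (\<Squnion>\<^bsub>L \<otimes> M\<^esub>?t)"
        unfolding kD(4)[OF tensor_Sup_tens(2)[OF I]] hD(4)[OF tensor_Sup_tens(2)[OF I]] by simp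
      then show "k I = h I" unfolding tensor_Sup_tens(1)[OF I, symmetric] .
    qed
  qed
qed

lemma tens_meet:
  assumes "a \<in> carrier L" "b \<in> carrier M" "c \<in> carrier L" "d \<in> carrier M"
  shows "tens L M a b \<inter> tens L M c d = tens L M (a \<sqinter>\<^bsub>L\<^esub> c) (b \<sqinter>\<^bsub>M\<^esub> d)"
proof
  let ?e = "tens L M (a \<sqinter>\<^bsub>L\<^esub> c) (b \<sqinter>\<^bsub>M\<^esub> d)"
  note l = L.bin_meet(1-3)[OF assms(1,3)] and m = M.bin_meet(1-3)[OF assms(2,4)]
  note e = tens(1,2)[OF l(1) m(1)]
  have ab: "tens L M a b \<subseteq> {(p, q) \<in> carrier L \<times> carrier M. \<forall>(p', q')\<in>{(c, d)}. (p \<sqinter>\<^bsub>L\<^esub> p', q \<sqinter>\<^bsub>M\<^esub> q') \<in> ?e}"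
    by (rule tens_subset[OF biideal_residual[OF e(1)]]) (use assms e in auto)
  have "tens L M c d \<subseteq> {(p, q) \<in> carrier L \<times> carrier M. \<forall>(p', q')\<in>tens L M a b. (p \<sqinter>\<^bsub>L\<^esub> p', q \<sqinter>\<^bsub>M\<^esub> q') \<in> ?e}"
  proof (rule tens_subset[OF biideal_residual[OF e(1) biidealD(3)[OF tens(1)[OF assms(1,2)]]]])
    have "(c \<sqinter>\<^bsub>L\<^esub> p', d \<sqinter>\<^bsub>M\<^esub> q') \<in> ?e" if "(p', q') \<in> tens L M a b" for p' q'
      using that ab meet_comm[of L c p'] meet_comm[of M d q'] by auto
    then show "(c, d) \<in> {(p, q) \<in> carrier L \<times> carrier M. \<forall>(p', q')\<in>tens L M a b. (p \<sqinter>\<^bsub>L\<^esub> p', q \<sqinter>\<^bsub>M\<^esub> q') \<in> ?e}"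
      using assms by blast
  qed
  then have r: "(p \<sqinter>\<^bsub>L\<^esub> p', q \<sqinter>\<^bsub>M\<^esub> q') \<in> ?e" if "(p, q) \<in> tens L M c d" "(p', q') \<in> tens L M a b" for p q p' q'
    using that by blast
  show "tens L M a b \<inter> tens L M c d \<subseteq> ?e"
  proof clarify
    fix p q assume pq: "(p, q) \<in> tens L M a b" "(p, q) \<in> tens L M c d"
    have car: "p \<in> carrier L" "q \<in> carrier M" using biidealD(1,2)[OF tens(1)[OF assms(1,2)] pq(1)] .
    show "(p, q) \<in> ?e"
      by (rule biidealD(4)[OF e(1) r[OF pq(2,1)] car L.bin_meet(4)[OF car(1) car(1) car(1)] M.bin_meet(4)[OF car(2) car(2) car(2)]])
        (use car in auto)
  qed
  show "?e \<subseteq> tens L M a b \<inter> tens L M c d"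
    using tens_subset[OF tens(1)[OF assms(1,2)] biidealD(4)[OF tens(1,2)[OF assms(1,2)] l(1) m(1) l(2) m(2)]]
      tens_subset[OF tens(1)[OF assms(3,4)] biidealD(4)[OF tens(1,2)[OF assms(3,4)] l(1) m(1) l(3) m(3)]]
    by blast
qed

end


section \<open>The morphisms \<open>\<lambda>\<^sub>X\<^sup>*\<close>\<close>

lemma wf_lFunc: "wf_presentation (lFunc X Y)"
  unfolding wf_presentation_def lFunc_def rel_u_def rel_e_def by (auto simp: Fpow_def)

lemma wf_lBij: "wf_presentation (lBij X Y)"
  unfolding wf_presentation_def lBij_def rel_u_def rel_e_def rel_i_def rel_s_def
  by (auto simp: Fpow_def)

lemma gens_lFunc: "gens (lFunc X Y) = X \<times> Y" and gens_lBij: "gens (lBij X Y) = X \<times> Y"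
  by (simp_all add: lFunc_def lBij_def)

lemma wf_nat_pres:
  assumes wf: "\<And>X Y. wf_presentation (R X Y)" and g: "\<And>X Y. gens (R X Y) = X \<times> Y"
    and F: "F \<in> set_functors C" and G: "G \<in> set_functors C"
  shows "wf_presentation (nat_pres R C F G)"
  unfolding wf_presentation_def
proof clarify
  fix a B assume "(a, B) \<in> rels (nat_pres R C F G)"
  then consider
    (nat) X Y f x y where "X \<in> Ob C" "Y \<in> Ob C" "f \<in> Mor C X Y" "x \<in> fOb F X" "y \<in> fOb G X"
      "a = {(X, x, y)}" "B = {{(Y, fMor F X Y f x, fMor G X Y f y)}}"
  | (rel) X a' B' where "X \<in> Ob C" "(a', B') \<in> rels (R (fOb F X) (fOb G X))"
      "a = Pair X ` a'" "B = (\<lambda>b. Pair X ` b) ` B'"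
    unfolding nat_pres_def by auto
  then show "a \<in> Fpow (gens (nat_pres R C F G)) \<and> B \<subseteq> Fpow (gens (nat_pres R C F G))"
  proof cases
    case nat
    have maps: "fMor H X Y f \<in> fOb H X \<rightarrow> fOb H Y" if "H \<in> set_functors C" for H
    proof -
      have H: "cat_functor C set_cat H" using that by (simp add: functor_cat_def)
      show ?thesis
        using PiE_mem[OF PiE_mem[OF PiE_mem[OF cat_functor.fMor_closed[OF H] nat(1)] nat(2)] nat(3)]
        by (simp add: set_cat_def PiE_def)
    qed
    show ?thesis
      using nat funcset_mem[OF maps[OF F]] funcset_mem[OF maps[OF G]]
      by (simp add: Fpow_def nat_pres_def)
  next
    case rel
    have "a' \<in> Fpow (fOb F X \<times> fOb G X)" "B' \<subseteq> Fpow (fOb F X \<times> fOb G X)"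
      using wf[of "fOb F X" "fOb G X"] rel(2) by (auto simp: wf_presentation_def g)
    then show ?thesis using rel(1,3,4) by (auto simp: Fpow_def nat_pres_def subset_iff)
  qed
qed

lemma lam:
  assumes wf: "\<And>X Y. wf_presentation (R X Y)" and g: "\<And>X Y. gens (R X Y) = X \<times> Y"
    and F: "F \<in> set_functors C" and G: "G \<in> set_functors C" and X: "X \<in> Ob C"
  shows "lam R C X F G \<in> frame_homs (presented (R (fOb F X) (fOb G X))) (nat_loc R C F G)"
    and "\<And>x y. x \<in> fOb F X \<Longrightarrow> y \<in> fOb G X \<Longrightarrow>
      lam R C X F G (gen (R (fOb F X) (fOb G X)) (x, y)) = gen (nat_pres R C F G) (X, x, y)"
proof -
  let ?P = "nat_pres R C F G"
  have wfP: "wf_presentation ?P" by (rule wf_nat_pres[OF wf g F G])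
  have sat: "satisfies ?P (presented ?P) (gen ?P)" by (rule gen_satisfies[OF wfP])
  let ?\<phi> = "\<lambda>(x, y). gen ?P (X, x, y)"
  have im: "?\<phi> ` b = gen ?P ` Pair X ` b" for b
    unfolding image_image by (rule image_cong) auto
  have "satisfies (R (fOb F X) (fOb G X)) (presented ?P) ?\<phi>"
    unfolding satisfies_def
  proof (intro conjI ballI)
    show "?\<phi> \<in> gens (R (fOb F X) (fOb G X)) \<rightarrow> carrier (presented ?P)"
      using sat X by (auto simp: satisfies_def g nat_pres_def)
    fix r assume r: "r \<in> rels (R (fOb F X) (fOb G X))"
    then obtain a B where ab: "r = (a, B)" "(a, B) \<in> rels (R (fOb F X) (fOb G X))" by (cases r) auto
    have "(Pair X ` a, (\<lambda>b. Pair X ` b) ` B) \<in> rels ?P" using ab X unfolding nat_pres_def by auto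
    with sat have "\<Sqinter>\<^bsub>presented ?P\<^esub>(gen ?P ` Pair X ` a) \<sqsubseteq>\<^bsub>presented ?P\<^esub>
      \<Squnion>\<^bsub>presented ?P\<^esub>((\<lambda>b. \<Sqinter>\<^bsub>presented ?P\<^esub>(gen ?P ` b)) ` (\<lambda>b. Pair X ` b) ` B)"
      unfolding satisfies_def by blast
    then show "case r of (a, B) \<Rightarrow> \<Sqinter>\<^bsub>presented ?P\<^esub>(?\<phi> ` a) \<sqsubseteq>\<^bsub>presented ?P\<^esub>
      \<Squnion>\<^bsub>presented ?P\<^esub>((\<lambda>b. \<Sqinter>\<^bsub>presented ?P\<^esub>(?\<phi> ` b)) ` B)"
      unfolding ab(1) by (simp add: im image_image)
  qed
  note h = gen_hom[OF wf presented_frame[OF wfP] this, folded lam_def]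
  show "lam R C X F G \<in> frame_homs (presented (R (fOb F X) (fOb G X))) (nat_loc R C F G)" by (rule h)
  show "lam R C X F G (gen (R (fOb F X) (fOb G X)) (x, y)) = gen ?P (X, x, y)"
    if "x \<in> fOb F X" "y \<in> fOb G X" for x y
    using h(2)[of "(x, y)"] that by (simp add: g)
qed

end

theory Submission
  imports Defs
begin

text \<open>A locale presented by the relations for \<open>lFunc X Y\<close> classifies functional relations from \<open>X\<close>
  to \<open>Y\<close> with values in a frame: \<open>\<phi> : lFunc X Y \<rightarrow> N\<close> is a matrix of elements of \<open>N\<close> whose rows are
  partitions of the top element, and for \<open>lBij X Y\<close> the columns are partitions too. Such matrices
  compose by \<open>\<Or>\<^sub>z \<phi> x z \<and> \<psi> z y\<close>, have the diagonal matrices as units, and are preserved by frame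
  maps; applied to the two coprojections into a coproduct this gives \<open>m\<^sup>*\<close>, and naturality of \<open>F\<close>, \<open>G\<close>
  and \<open>H\<close> carries it over to \<open>lFunc F G\<close>. Since frame maps are determined by their values on
  generators, the enrichment axioms become associativity and unit laws of matrix multiplication,
  and the inverse laws say that a matrix with partitioned rows and columns is inverse to its
  transpose.\<close>

text \<open>\<open>gen_hom\<close> is a definite description, so nothing is known about a structure
  map until the relations have been verified for its prescribed values. Each structure map therefore
  takes two moves: a certain matrix is shown to be functional, and only then is the map evaluated on
  generators. For multiplication the entries lie in a coproduct. An elementary tensor is the meet of
  its two coprojections, so this product becomes an ordinary product of matrices over one frame,
  where the calculus is developed. Naturality of multiplication asks nothing of \<open>H f\<close>
  beyond being a function: the summand for \<open>z\<close> at \<open>X\<close> lies below the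
  summand for \<open>H f z\<close> at \<open>Y\<close>, which bounds one join by the other. Read in
  the hom-locales themselves, the naturality relation says that the functions \<open>F f\<close>
  form an enriched transformation. Points show where the two cases part. Over \<open>two\<close> a
  functional relation is the graph of a function, so the points of \<open>lFunc F G\<close> are the
  natural transformations and form the functor category; column conditions leave only natural
  bijections. Hence the enrichment statement concerns \<open>lFunc\<close>, while
  \<open>lBij\<close> carries inverses.\<close>

section \<open>Frame maps\<close>

text \<open>Unlike \<open>frame_homs\<close>, frame maps need not be extensional, so that they contain \<open>id\<close> and are
  closed under plain composition.\<close>

definition frame_map :: "'a gorder \<Rightarrow> 'b gorder \<Rightarrow> ('a \<Rightarrow> 'b) \<Rightarrow> bool" where
  "frame_map L M f \<longleftrightarrow> frame_lattice L \<and> frame_lattice M \<and> f \<in> carrier L \<rightarrow> carrier M \<and>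
    f \<top>\<^bsub>L\<^esub> = \<top>\<^bsub>M\<^esub> \<and>
    (\<forall>a\<in>carrier L. \<forall>b\<in>carrier L. f (a \<sqinter>\<^bsub>L\<^esub> b) = f a \<sqinter>\<^bsub>M\<^esub> f b) \<and>
    (\<forall>A. A \<subseteq> carrier L \<longrightarrow> f (\<Squnion>\<^bsub>L\<^esub>A) = \<Squnion>\<^bsub>M\<^esub>(f ` A))"

lemma frame_mapD:
  assumes "frame_map L M f"
  shows "frame_lattice L" "frame_lattice M"
    "a \<in> carrier L \<Longrightarrow> f a \<in> carrier M"
    "f \<top>\<^bsub>L\<^esub> = \<top>\<^bsub>M\<^esub>"
    "a \<in> carrier L \<Longrightarrow> b \<in> carrier L \<Longrightarrow> f (a \<sqinter>\<^bsub>L\<^esub> b) = f a \<sqinter>\<^bsub>M\<^esub> f b"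
    "A \<subseteq> carrier L \<Longrightarrow> f (\<Squnion>\<^bsub>L\<^esub>A) = \<Squnion>\<^bsub>M\<^esub>(f ` A)"
  using assms by (auto simp: frame_map_def)

lemma frame_map_homs_iff:
  assumes "frame_lattice L" "frame_lattice M"
  shows "h \<in> frame_homs L M \<longleftrightarrow> frame_map L M h \<and> h \<in> extensional (carrier L)"
proof
  assume "h \<in> frame_homs L M"
  note h = frame_homsD[OF assms this]
  then show "frame_map L M h \<and> h \<in> extensional (carrier L)"
    using assms by (auto simp: frame_map_def PiE_def)
next
  assume "frame_map L M h \<and> h \<in> extensional (carrier L)"
  then show "h \<in> frame_homs L M"
    by (intro frame_homsI[OF assms]) (auto simp: frame_map_def PiE_def)
qed

lemma frame_mapI:
  "frame_lattice L \<Longrightarrow> frame_lattice M \<Longrightarrow> h \<in> frame_homs L M \<Longrightarrow> frame_map L M h"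
  by (simp add: frame_map_homs_iff)

text \<open>The structure maps are restrictions to a carrier, or have their formulas rewritten
  there; this carries the frame map property from one form to the other.\<close>

lemma frame_map_cong:
  assumes "frame_map L M f" "\<And>x. x \<in> carrier L \<Longrightarrow> f x = g x"
  shows "frame_map L M g"
proof -
  interpret L: frame_lattice L by (rule frame_mapD(1)[OF assms(1)])
  have "g ` A = f ` A" if "A \<subseteq> carrier L" for A
    using that assms(2) by (intro image_cong[OF refl]) auto
  then show ?thesis
    using frame_mapD[OF assms(1)] L.bin_meet(1) unfolding frame_map_def
    by (simp add: assms(2)[symmetric] Pi_def)
qed

lemma frame_map_restrict: "frame_map L M f \<Longrightarrow> (\<lambda>x\<in>carrier L. f x) \<in> frame_homs L M"
  using frame_map_cong[of L M f "\<lambda>x\<in>carrier L. f x"]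
  by (simp add: frame_map_homs_iff frame_mapD(1,2))

lemma frame_map_id: "frame_lattice L \<Longrightarrow> frame_map L L id"
  by (simp add: frame_map_def)

lemma frame_map_comp:
  assumes f: "frame_map L M f" and g: "frame_map M N g"
  shows "frame_map L N (\<lambda>x. g (f x))"
proof -
  have "g (f (\<Squnion>\<^bsub>L\<^esub>A)) = \<Squnion>\<^bsub>N\<^esub>((\<lambda>x. g (f x)) ` A)" if A: "A \<subseteq> carrier L" for A
  proof -
    have "f ` A \<subseteq> carrier M" using frame_mapD(3)[OF f] A by auto
    then show ?thesis by (simp add: frame_mapD(6)[OF f A] frame_mapD(6)[OF g] image_image)
  qed
  then show ?thesis
    using frame_mapD[OF f] frame_mapD[OF g] by (simp add: frame_map_def)
qed

lemma frame_map_SUP: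
  assumes f: "frame_map L M f" and p: "\<And>i. i \<in> I \<Longrightarrow> p i \<in> carrier L"
  shows "f (\<Squnion>\<^bsub>L\<^esub>(p ` I)) = \<Squnion>\<^bsub>M\<^esub>((\<lambda>i. f (p i)) ` I)"
  using frame_mapD(6)[OF f, of "p ` I"] p by (simp add: image_subset_iff image_image)

lemma frame_map_bot:
  assumes f: "frame_map L M f"
  shows "f \<bottom>\<^bsub>L\<^esub> = \<bottom>\<^bsub>M\<^esub>"
proof -
  interpret L: frame_lattice L by (rule frame_mapD(1)[OF f])
  interpret M: frame_lattice M by (rule frame_mapD(2)[OF f])
  show ?thesis using frame_mapD(6)[OF f, of "{}"] by (simp add: L.sup_empty' M.sup_empty')
qed

lemma (in frame_lattice) le_iff_meet:
  assumes "a \<in> carrier L" "b \<in> carrier L"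
  shows "a \<sqsubseteq> b \<longleftrightarrow> a \<sqinter> b = a"
proof
  show "a \<sqinter> b = a" if "a \<sqsubseteq> b"
    using that assms bin_meet[OF assms] by (intro le_antisym) auto
  show "a \<sqsubseteq> b" if "a \<sqinter> b = a"
    using bin_meet(3)[OF assms] that by simp
qed

text \<open>An inequality is the equation \<open>a \<sqinter> b = a\<close>, and frame maps preserve
  meets.\<close>

lemma frame_map_mono:
  assumes f: "frame_map L M f" and ab: "a \<in> carrier L" "b \<in> carrier L" "a \<sqsubseteq>\<^bsub>L\<^esub> b"
  shows "f a \<sqsubseteq>\<^bsub>M\<^esub> f b"
proof -
  interpret L: frame_lattice L by (rule frame_mapD(1)[OF f])
  interpret M: frame_lattice M by (rule frame_mapD(2)[OF f])
  show ?thesis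
    using ab frame_mapD(5)[OF f ab(1,2)] L.le_iff_meet[OF ab(1,2)]
      M.le_iff_meet[OF frame_mapD(3,3)[OF f], OF ab(1,2)] by simp
qed

section \<open>Suprema of indexed families in a frame\<close>

context frame_lattice begin

lemma SUP_closed: "(\<And>i. i \<in> I \<Longrightarrow> p i \<in> carrier L) \<Longrightarrow> \<Squnion>(p ` I) \<in> carrier L"
  by (rule sup_closed) auto

lemma SUP_le:
  assumes "\<And>i. i \<in> I \<Longrightarrow> p i \<in> carrier L" "z \<in> carrier L" "\<And>i. i \<in> I \<Longrightarrow> p i \<sqsubseteq> z"
  shows "\<Squnion>(p ` I) \<sqsubseteq> z"
  using assms by (subst sup_le_iff) auto

lemma SUP_ge:
  assumes "\<And>i. i \<in> I \<Longrightarrow> p i \<in> carrier L" "i \<in> I"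
  shows "p i \<sqsubseteq> \<Squnion>(p ` I)"
  using assms by (intro sup_upper) auto

lemma SUP_le_SUP:
  assumes "\<And>i. i \<in> I \<Longrightarrow> p i \<in> carrier L" "\<And>j. j \<in> J \<Longrightarrow> q j \<in> carrier L"
    "\<And>i. i \<in> I \<Longrightarrow> \<exists>j\<in>J. p i \<sqsubseteq> q j"
  shows "\<Squnion>(p ` I) \<sqsubseteq> \<Squnion>(q ` J)"
proof (rule SUP_le[OF assms(1) SUP_closed[OF assms(2)]])
  fix i assume i: "i \<in> I"
  then obtain j where j: "j \<in> J" "p i \<sqsubseteq> q j" using assms(3) by blast
  show "p i \<sqsubseteq> \<Squnion>(q ` J)"
    by (rule le_trans[OF j(2) SUP_ge[of J q, OF assms(2) j(1)] assms(1)[OF i] assms(2)[OF j(1)] SUP_closed[of J q, OF assms(2)]])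
qed auto

text \<open>Once a dependent double join is flattened to a join over a sigma set, the interchange of
  joins and the flattened definition of \<open>tensor_assoc\<close> are matters of
  reindexing.\<close>

lemma SUP_SUP:
  assumes "\<And>i j. i \<in> I \<Longrightarrow> j \<in> J i \<Longrightarrow> p i j \<in> carrier L"
  shows "\<Squnion>((\<lambda>i. \<Squnion>(p i ` J i)) ` I) = \<Squnion>(case_prod p ` Sigma I J)"
proof (rule le_antisym)
  have c: "\<Squnion>(p i ` J i) \<in> carrier L" if "i \<in> I" for i using assms that by (auto intro: SUP_closed)
  have d: "\<Squnion>(case_prod p ` Sigma I J) \<in> carrier L" using assms by (auto intro: SUP_closed)
  have e: "\<Squnion>((\<lambda>i. \<Squnion>(p i ` J i)) ` I) \<in> carrier L" using c by (auto intro: SUP_closed)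
  show "\<Squnion>((\<lambda>i. \<Squnion>(p i ` J i)) ` I) \<sqsubseteq> \<Squnion>(case_prod p ` Sigma I J)"
  proof (intro SUP_le c d)
    show "p i j \<sqsubseteq> \<Squnion>(case_prod p ` Sigma I J)" if "i \<in> I" "j \<in> J i" for i j
      using SUP_ge[of "Sigma I J" "case_prod p" "(i, j)"] assms that by auto
  qed (use assms in auto)
  show "\<Squnion>(case_prod p ` Sigma I J) \<sqsubseteq> \<Squnion>((\<lambda>i. \<Squnion>(p i ` J i)) ` I)"
  proof (rule SUP_le[OF _ e])
    fix x assume "x \<in> Sigma I J"
    then obtain i j where x: "x = (i, j)" "i \<in> I" "j \<in> J i" by auto
    show "case_prod p x \<sqsubseteq> \<Squnion>((\<lambda>i. \<Squnion>(p i ` J i)) ` I)"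
      using x assms le_trans[OF SUP_ge[of "J i" "p i" j] SUP_ge[of I "\<lambda>i. \<Squnion>(p i ` J i)" i]] c e
      by simp
  qed (use assms in auto)
  show "\<Squnion>((\<lambda>i. \<Squnion>(p i ` J i)) ` I) \<in> carrier L" by (rule e)
  show "\<Squnion>(case_prod p ` Sigma I J) \<in> carrier L" by (rule d)
qed

lemma SUP_swap:
  assumes "\<And>i j. i \<in> I \<Longrightarrow> j \<in> J \<Longrightarrow> p i j \<in> carrier L"
  shows "\<Squnion>((\<lambda>i. \<Squnion>(p i ` J)) ` I) = \<Squnion>((\<lambda>j. \<Squnion>((\<lambda>i. p i j) ` I)) ` J)"
proof -
  have "case_prod p ` (I \<times> J) = (\<lambda>(j, i). p i j) ` (J \<times> I)" by force
  then show ?thesis using assms by (simp add: SUP_SUP)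
qed

lemma meet_SUP:
  assumes "\<And>i. i \<in> I \<Longrightarrow> p i \<in> carrier L" "x \<in> carrier L"
  shows "x \<sqinter> \<Squnion>(p ` I) = \<Squnion>((\<lambda>i. x \<sqinter> p i) ` I)" "\<Squnion>(p ` I) \<sqinter> x = \<Squnion>((\<lambda>i. p i \<sqinter> x) ` I)"
  using assms meet_Sup_distrib[of x "p ` I"] Sup_meet_distrib[of x "p ` I"]
  by (simp_all add: image_image image_subset_iff)

lemma meet_top [simp]: "x \<in> carrier L \<Longrightarrow> x \<sqinter> \<top> = x" "x \<in> carrier L \<Longrightarrow> \<top> \<sqinter> x = x"
  and meet_bot [simp]: "x \<in> carrier L \<Longrightarrow> x \<sqinter> \<bottom> = \<bottom>" "x \<in> carrier L \<Longrightarrow> \<bottom> \<sqinter> x = \<bottom>"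
  using le_iff_meet[of x \<top>] le_iff_meet[of \<bottom> x] top_higher bottom_lower
  by (auto simp: meet_comm[of L \<top>] meet_comm[of L x \<bottom>])

lemma SUP_bot: "(\<And>i. i \<in> I \<Longrightarrow> p i = \<bottom>) \<Longrightarrow> \<Squnion>(p ` I) = \<bottom>"
  by (rule le_antisym) (auto intro!: SUP_le SUP_closed)

text \<open>Evaluates a product with a diagonal matrix, where all terms but the \<open>k\<close>-th
  are bottom; the unit laws rest on it.\<close>

lemma SUP_single:
  assumes "k \<in> I" "p k \<in> carrier L" "\<And>i. i \<in> I \<Longrightarrow> i \<noteq> k \<Longrightarrow> p i = \<bottom>"
  shows "\<Squnion>(p ` I) = p k"
proof -
  have c: "p i \<in> carrier L" if "i \<in> I" for i using assms that by (cases "i = k") auto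
  have "p i \<sqsubseteq> p k" if "i \<in> I" for i using assms that by (cases "i = k") auto
  then show ?thesis by (intro le_antisym SUP_le SUP_ge SUP_closed c assms(1,2))
qed

end

section \<open>Coproduct maps\<close>

text \<open>The comprehensions in the coproduct maps bind two variables; as images of a set of pairs
  they can be rewritten with \<open>image_cong\<close>.\<close>

lemma Collect_pair_image: "{f a b | a b. (a, b) \<in> I} = case_prod f ` I"
  by force

section \<open>The two-element frame\<close>

lemma two_simps: "carrier two = UNIV" "le two = (\<le>)"
  by (simp_all add: two_def)

text \<open>Joins are existential and infima universal: the least upper bound of \<open>A\<close> is
  the truth value of \<open>True \<in> A\<close>, the greatest lower bound that of
  \<open>False \<notin> A\<close>.\<close>

lemma two_frame: "frame_lattice two" (is ?F)
  and two_top: "\<top>\<^bsub>two\<^esub> = True"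
  and two_bot: "\<bottom>\<^bsub>two\<^esub> = False"
  and two_meet: "p \<sqinter>\<^bsub>two\<^esub> q \<longleftrightarrow> p \<and> q"
  and two_Sup: "\<Squnion>\<^bsub>two\<^esub>A \<longleftrightarrow> True \<in> A"
proof -
  interpret partial_order two by unfold_locales (auto simp: two_def)
  have s: "least two (True \<in> A) (Upper two A)" for A
    by (auto simp: least_def Upper_def two_def)
  have i: "greatest two (False \<notin> A) (Lower two A)" for A
    by (cases "False \<in> A") (auto simp: greatest_def Lower_def two_def, metis (full_types))
  interpret complete_lattice two
    by unfold_locales (use s i in blast)+
  have S: "\<Squnion>\<^bsub>two\<^esub>A \<longleftrightarrow> True \<in> A" for A
    unfolding sup_def by (rule some_equality[THEN arg_cong[where f = "\<lambda>x. x"]], rule s, erule least_unique[OF _ s])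
  have I: "\<Sqinter>\<^bsub>two\<^esub>A \<longleftrightarrow> False \<notin> A" for A
    unfolding inf_def by (rule some_equality[THEN arg_cong[where f = "\<lambda>x. x"]], rule i, erule greatest_unique[OF _ i])
  have M: "p \<sqinter>\<^bsub>two\<^esub> q \<longleftrightarrow> p \<and> q" for p q unfolding meet_def I by auto
  show F: ?F
    by unfold_locales (auto simp: S M)
  interpret frame_lattice two by (rule F)
  show "\<top>\<^bsub>two\<^esub> = True" using I[of "{}"] by (simp add: inf_empty')
  show "\<bottom>\<^bsub>two\<^esub> = False" using S[of "{}"] by (simp add: sup_empty')
  show "p \<sqinter>\<^bsub>two\<^esub> q \<longleftrightarrow> p \<and> q" by (rule M)
  show "\<Squnion>\<^bsub>two\<^esub>A \<longleftrightarrow> True \<in> A" by (rule S)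
qed

text \<open>A join in \<open>two\<close> is decided by whether \<open>True\<close> occurs, and
  \<open>False\<close> contributes only bottom to the image. This is the inverse image of the map to
  the terminal space.\<close>

lemma from_two_map:
  assumes L: "frame_lattice L"
  shows "frame_map two L (from_two L)"
proof -
  interpret L: frame_lattice L by (rule L)
  have "from_two L (True \<in> A) = \<Squnion>\<^bsub>L\<^esub>(from_two L ` A)" for A
  proof (cases "True \<in> A")
    case True
    then have "\<Squnion>\<^bsub>L\<^esub>(from_two L ` A) = from_two L True"
      by (intro L.SUP_single) (auto simp: from_two_def)
    then show ?thesis using True by simp
  next
    case False
    then have "\<Squnion>\<^bsub>L\<^esub>(from_two L ` A) = \<bottom>\<^bsub>L\<^esub>"
      by (intro L.SUP_bot) (metis from_two_def)
    then show ?thesis using False by (simp add: from_two_def)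
  qed
  then show ?thesis
    using L by (auto simp: frame_map_def two_frame two_simps two_top two_meet two_Sup from_two_def)
qed

section \<open>Elementary tensors, coprojections and copairing\<close>

context frame_pair begin

lemma tens_mono:
  assumes "a \<in> carrier L" "b \<in> carrier M" "a' \<in> carrier L" "b' \<in> carrier M" "a \<sqsubseteq>\<^bsub>L\<^esub> a'" "b \<sqsubseteq>\<^bsub>M\<^esub> b'"
  shows "tens L M a b \<subseteq> tens L M a' b'"
  using biidealD(4)[OF tens(1,2)[OF assms(3,4)]] assms by (intro tens_subset tens) auto

text \<open>Bi-ideals are closed under joins in the first variable with the second one fixed, so the
  join on the right contains the pair with the joined component; the converse inclusion is
  monotonicity.\<close>

lemma tens_SUP:
  assumes "b \<in> carrier M" "\<And>i. i \<in> I \<Longrightarrow> p i \<in> carrier L"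
  shows "tens L M (\<Squnion>\<^bsub>L\<^esub>(p ` I)) b = \<Squnion>\<^bsub>L \<otimes> M\<^esub>((\<lambda>i. tens L M (p i) b) ` I)"
proof
  interpret T: frame_lattice "L \<otimes> M" by (rule tensor_frame)
  have c: "(\<lambda>i. tens L M (p i) b) ` I \<subseteq> {I. biideal L M I}" using tens(1) assms by auto
  have S: "\<Squnion>\<^bsub>L\<^esub>(p ` I) \<in> carrier L" by (rule L.SUP_closed[OF assms(2)])
  have b: "biideal L M (\<Squnion>\<^bsub>L \<otimes> M\<^esub>((\<lambda>i. tens L M (p i) b) ` I))"
    using T.sup_closed c by (simp add: tensor_carrier)
  have "(a, b) \<in> \<Squnion>\<^bsub>L \<otimes> M\<^esub>((\<lambda>i. tens L M (p i) b) ` I)" if "a \<in> p ` I" for a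
    using T.sup_upper[of "(\<lambda>i. tens L M (p i) b) ` I"] c that tens(2) assms
    by (fastforce simp: tensor_carrier tensor_le)
  then have "(\<Squnion>\<^bsub>L\<^esub>(p ` I), b) \<in> \<Squnion>\<^bsub>L \<otimes> M\<^esub>((\<lambda>i. tens L M (p i) b) ` I)"
    using biidealD(5)[OF b, of "p ` I" b] assms by auto
  then show "tens L M (\<Squnion>\<^bsub>L\<^esub>(p ` I)) b \<subseteq> \<Squnion>\<^bsub>L \<otimes> M\<^esub>((\<lambda>i. tens L M (p i) b) ` I)"
    by (rule tens_subset[OF b])
  show "\<Squnion>\<^bsub>L \<otimes> M\<^esub>((\<lambda>i. tens L M (p i) b) ` I) \<subseteq> tens L M (\<Squnion>\<^bsub>L\<^esub>(p ` I)) b"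
    by (rule tensor_sup_subset[OF c tens(1)[OF S assms(1)]])
      (use assms S in \<open>auto dest!: subsetD[OF tens_mono[OF _ _ S assms(1) L.SUP_ge], rotated -1]\<close>)
qed

lemma tens_SUP_right:
  assumes "a \<in> carrier L" "\<And>i. i \<in> I \<Longrightarrow> p i \<in> carrier M"
  shows "tens L M a (\<Squnion>\<^bsub>M\<^esub>(p ` I)) = \<Squnion>\<^bsub>L \<otimes> M\<^esub>((\<lambda>i. tens L M a (p i)) ` I)"
proof
  interpret T: frame_lattice "L \<otimes> M" by (rule tensor_frame)
  have c: "(\<lambda>i. tens L M a (p i)) ` I \<subseteq> {I. biideal L M I}" using tens(1) assms by auto
  have S: "\<Squnion>\<^bsub>M\<^esub>(p ` I) \<in> carrier M" by (rule M.SUP_closed[OF assms(2)])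
  have b: "biideal L M (\<Squnion>\<^bsub>L \<otimes> M\<^esub>((\<lambda>i. tens L M a (p i)) ` I))"
    using T.sup_closed c by (simp add: tensor_carrier)
  have "(a, b) \<in> \<Squnion>\<^bsub>L \<otimes> M\<^esub>((\<lambda>i. tens L M a (p i)) ` I)" if "b \<in> p ` I" for b
    using T.sup_upper[of "(\<lambda>i. tens L M a (p i)) ` I"] c that tens(2) assms
    by (fastforce simp: tensor_carrier tensor_le)
  then have "(a, \<Squnion>\<^bsub>M\<^esub>(p ` I)) \<in> \<Squnion>\<^bsub>L \<otimes> M\<^esub>((\<lambda>i. tens L M a (p i)) ` I)"
    using biidealD(6)[OF b, of a "p ` I"] assms by auto
  then show "tens L M a (\<Squnion>\<^bsub>M\<^esub>(p ` I)) \<subseteq> \<Squnion>\<^bsub>L \<otimes> M\<^esub>((\<lambda>i. tens L M a (p i)) ` I)"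
    by (rule tens_subset[OF b])
  show "\<Squnion>\<^bsub>L \<otimes> M\<^esub>((\<lambda>i. tens L M a (p i)) ` I) \<subseteq> tens L M a (\<Squnion>\<^bsub>M\<^esub>(p ` I))"
    by (rule tensor_sup_subset[OF c tens(1)[OF assms(1) S]])
      (use assms S in \<open>auto dest!: subsetD[OF tens_mono[OF _ _ assms(1) S _ M.SUP_ge], rotated -1]\<close>)
qed

text \<open>Bi-ideals are down-closed, so one that contains the pair of top elements contains every
  pair.\<close>

lemma tens_top: "tens L M \<top>\<^bsub>L\<^esub> \<top>\<^bsub>M\<^esub> = \<top>\<^bsub>L \<otimes> M\<^esub>"
proof -
  interpret T: frame_lattice "L \<otimes> M" by (rule tensor_frame)
  have top: "\<top>\<^bsub>L \<otimes> M\<^esub> = carrier L \<times> carrier M"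
    using tensor_lattice(2)[of "{}"] T.inf_empty' by simp
  have t: "biideal L M (tens L M \<top>\<^bsub>L\<^esub> \<top>\<^bsub>M\<^esub>)" "(\<top>\<^bsub>L\<^esub>, \<top>\<^bsub>M\<^esub>) \<in> tens L M \<top>\<^bsub>L\<^esub> \<top>\<^bsub>M\<^esub>"
    by (rule tens; simp)+
  have "(a, b) \<in> tens L M \<top>\<^bsub>L\<^esub> \<top>\<^bsub>M\<^esub>" if "a \<in> carrier L" "b \<in> carrier M" for a b
    by (rule biidealD(4)[OF t that L.top_higher[OF that(1)] M.top_higher[OF that(2)]])
  then show ?thesis using biidealD(3)[OF t(1)] unfolding top by blast
qed

text \<open>With the second component fixed at top, \<open>tens_SUP\<close> and
  \<open>tens_meet\<close> become preservation of joins and of meets.\<close>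

lemma inl_map: "frame_map L (L \<otimes> M) (\<lambda>a. tens L M a \<top>\<^bsub>M\<^esub>)"
  unfolding frame_map_def
  using L.frame_lattice_axioms tensor_frame tens(3) tens_top
    tens_SUP[of "\<top>\<^bsub>M\<^esub>" _ "\<lambda>x. x"] tens_meet[of _ "\<top>\<^bsub>M\<^esub>" _ "\<top>\<^bsub>M\<^esub>"] tensor_meet tens(1)
  by (auto simp: subset_iff)

lemma inr_map: "frame_map M (L \<otimes> M) (tens L M \<top>\<^bsub>L\<^esub>)"
  unfolding frame_map_def
  using M.frame_lattice_axioms tensor_frame tens(3) tens_top
    tens_SUP_right[of "\<top>\<^bsub>L\<^esub>" _ "\<lambda>x. x"] tens_meet[of "\<top>\<^bsub>L\<^esub>" _ "\<top>\<^bsub>L\<^esub>"] tensor_meet tens(1)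
  by (auto simp: subset_iff)

text \<open>The bridge from tensors to meets: through the coprojections, matrices over
  \<open>L\<close> and over \<open>M\<close> can be multiplied inside the single frame
  \<open>L \<otimes> M\<close>.\<close>

lemma tens_eq_meet:
  assumes "a \<in> carrier L" "b \<in> carrier M"
  shows "tens L M a b = tens L M a \<top>\<^bsub>M\<^esub> \<sqinter>\<^bsub>L \<otimes> M\<^esub> tens L M \<top>\<^bsub>L\<^esub> b"
  using assms tens_meet[of a "\<top>\<^bsub>M\<^esub>" "\<top>\<^bsub>L\<^esub>" b] tensor_meet tens(1) by simp

text \<open>\<open>tensor_universal\<close> is stated for extensional maps. It applies to the
  restrictions of \<open>f\<close> and \<open>g\<close>, and these give the same joins because pairs
  in a bi-ideal have their components in the carriers.\<close>

lemma cotuple_map: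
  assumes f: "frame_map L N f" and g: "frame_map M N g"
  shows "frame_map (L \<otimes> M) N (\<lambda>I. \<Squnion>\<^bsub>N\<^esub> {f a \<sqinter>\<^bsub>N\<^esub> g b | a b. (a, b) \<in> I})" (is "frame_map _ _ ?h")
    and "a \<in> carrier L \<Longrightarrow> b \<in> carrier M \<Longrightarrow>
      \<Squnion>\<^bsub>N\<^esub> {f a' \<sqinter>\<^bsub>N\<^esub> g b' | a' b'. (a', b') \<in> tens L M a b} = f a \<sqinter>\<^bsub>N\<^esub> g b"
proof -
  have N: "frame_lattice N" by (rule frame_mapD(2)[OF f])
  let ?f = "\<lambda>x\<in>carrier L. f x" and ?g = "\<lambda>x\<in>carrier M. g x"
  note u = tensor_universal[OF N frame_map_restrict[OF f] frame_map_restrict[OF g]]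
  have e: "(\<lambda>I\<in>carrier (L \<otimes> M). \<Squnion>\<^bsub>N\<^esub> {?f a \<sqinter>\<^bsub>N\<^esub> ?g b | a b. (a, b) \<in> I}) I = ?h I"
    if "I \<in> carrier (L \<otimes> M)" for I
    using biidealD(1,2)[of L M I] that unfolding Collect_pair_image restrict_apply'[OF that]
    by (intro arg_cong[where f = "\<lambda>A. \<Squnion>\<^bsub>N\<^esub>A"] image_cong) (auto simp: tensor_carrier)
  show "frame_map (L \<otimes> M) N ?h"
    by (rule frame_map_cong[OF frame_mapI[OF tensor_frame N u(1)] e])
  show "\<Squnion>\<^bsub>N\<^esub> {f a' \<sqinter>\<^bsub>N\<^esub> g b' | a' b'. (a', b') \<in> tens L M a b} = f a \<sqinter>\<^bsub>N\<^esub> g b"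
    if "a \<in> carrier L" "b \<in> carrier M"
    using u(2)[OF that] that unfolding e[OF tens(3)[OF that]] by simp
qed

end

section \<open>The structure maps of the coproduct on elementary tensors\<close>

lemma frame_pairI: "frame_lattice L \<Longrightarrow> frame_lattice M \<Longrightarrow> frame_pair L M"
  by (simp add: frame_pair_def)

text \<open>\<open>tensor_map\<close> is the copairing of \<open>f\<close> and \<open>g\<close>,
  each followed by a coprojection of the target, so both claims are instances of the universal
  property.\<close>

lemma tensor_map:
  assumes f: "frame_map L L' f" and g: "frame_map M M' g"
  shows "frame_map (L \<otimes> M) (L' \<otimes> M') (tensor_map L M L' M' f g)"
    and "a \<in> carrier L \<Longrightarrow> b \<in> carrier M \<Longrightarrow>
      tensor_map L M L' M' f g (tens L M a b) = tens L' M' (f a) (g b)"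
proof -
  interpret D: frame_pair L M by (intro frame_pairI frame_mapD(1)[OF f] frame_mapD(1)[OF g])
  interpret E: frame_pair L' M' by (intro frame_pairI frame_mapD(2)[OF f] frame_mapD(2)[OF g])
  note c = D.cotuple_map[OF frame_map_comp[OF f E.inl_map] frame_map_comp[OF g E.inr_map]]
  have e: "tensor_map L M L' M' f g I =
      \<Squnion>\<^bsub>L' \<otimes> M'\<^esub> {tens L' M' (f a) \<top>\<^bsub>M'\<^esub> \<sqinter>\<^bsub>L' \<otimes> M'\<^esub> tens L' M' \<top>\<^bsub>L'\<^esub> (g b) | a b. (a, b) \<in> I}"
    if "I \<in> carrier (L \<otimes> M)" for I
  proof -
    have "(a, b) \<in> I \<Longrightarrow> tens L' M' (f a) (g b) =
        tens L' M' (f a) \<top>\<^bsub>M'\<^esub> \<sqinter>\<^bsub>L' \<otimes> M'\<^esub> tens L' M' \<top>\<^bsub>L'\<^esub> (g b)" for a b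
      using biidealD(1,2)[of L M I a b] that frame_mapD(3)[OF f] frame_mapD(3)[OF g]
      unfolding D.tensor_carrier by (intro E.tens_eq_meet) auto
    then show ?thesis
      unfolding tensor_map_def restrict_apply'[OF that] Collect_pair_image
      by (intro arg_cong[where f = "\<lambda>A. \<Squnion>\<^bsub>L' \<otimes> M'\<^esub>A"] image_cong) auto
  qed
  show "frame_map (L \<otimes> M) (L' \<otimes> M') (tensor_map L M L' M' f g)"
    by (rule frame_map_cong[OF c(1)]) (simp add: e)
  show "tensor_map L M L' M' f g (tens L M a b) = tens L' M' (f a) (g b)"
    if "a \<in> carrier L" "b \<in> carrier M"
    unfolding e[OF D.tens(3)[OF that]] c(2)[OF that]
    by (rule E.tens_eq_meet[symmetric]) (use that frame_mapD(3)[OF f] frame_mapD(3)[OF g] in auto)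
qed

lemma codiag:
  assumes L: "frame_lattice L"
  shows "frame_map (L \<otimes> L) L (codiag L)"
    and "a \<in> carrier L \<Longrightarrow> b \<in> carrier L \<Longrightarrow> codiag L (tens L L a b) = a \<sqinter>\<^bsub>L\<^esub> b"
proof -
  interpret D: frame_pair L L by (intro frame_pairI L)
  note c = D.cotuple_map[OF frame_map_id frame_map_id, OF L L]
  show "frame_map (L \<otimes> L) L (codiag L)"
    by (rule frame_map_cong[OF c(1)]) (simp add: codiag_def)
  show "codiag L (tens L L a b) = a \<sqinter>\<^bsub>L\<^esub> b" if "a \<in> carrier L" "b \<in> carrier L"
    using c(2)[OF that] D.tens(3)[OF that] by (simp add: codiag_def)
qed

text \<open>The unitor is the copairing of \<open>from_two L\<close> with the identity, although its
  definition mentions only the pairs over \<open>True\<close>.\<close>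

lemma left_unitor:
  assumes L: "frame_lattice L"
  shows "frame_map (two \<otimes> L) L (left_unitor L)"
    and "a \<in> carrier L \<Longrightarrow> left_unitor L (tens two L p a) = from_two L p \<sqinter>\<^bsub>L\<^esub> a"
proof -
  interpret L: frame_lattice L by fact
  interpret D: frame_pair two L by (intro frame_pairI L two_frame)
  note c = D.cotuple_map[OF from_two_map frame_map_id, OF L L]
  have e: "left_unitor L I = \<Squnion>\<^bsub>L\<^esub> {from_two L p \<sqinter>\<^bsub>L\<^esub> id a | p a. (p, a) \<in> I}"
    if "I \<in> carrier (two \<otimes> L)" for I
  proof -
    have I: "biideal two L I" using that by (simp add: D.tensor_carrier)
    have c: "(p, a) \<in> I \<Longrightarrow> a \<in> carrier L" for p a by (rule biidealD(2)[OF I])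
    have "\<Squnion>\<^bsub>L\<^esub> {a. (True, a) \<in> I} = \<Squnion>\<^bsub>L\<^esub> {from_two L p \<sqinter>\<^bsub>L\<^esub> id a | p a. (p, a) \<in> I}" (is "\<Squnion>\<^bsub>L\<^esub>?A = \<Squnion>\<^bsub>L\<^esub>?B")
    proof (rule L.le_antisym)
      have A: "?A \<subseteq> carrier L" and B: "?B \<subseteq> carrier L" using c by (auto simp: from_two_def)
      show "\<Squnion>\<^bsub>L\<^esub>?A \<in> carrier L" "\<Squnion>\<^bsub>L\<^esub>?B \<in> carrier L" using A B by auto
      have "a \<sqsubseteq>\<^bsub>L\<^esub> \<Squnion>\<^bsub>L\<^esub>?B" if "(True, a) \<in> I" for a
      proof (rule L.sup_upper[OF B])
        have "a = from_two L True \<sqinter>\<^bsub>L\<^esub> id a" using c[OF that] by (simp add: from_two_def)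
        then show "a \<in> ?B" using that by blast
      qed
      then show "\<Squnion>\<^bsub>L\<^esub>?A \<sqsubseteq>\<^bsub>L\<^esub> \<Squnion>\<^bsub>L\<^esub>?B" using A B by (subst L.sup_le_iff) auto
      \<comment> \<open>Pairs over \<open>False\<close> contribute bottom and leave the join
        unchanged.\<close>
      have "from_two L p \<sqinter>\<^bsub>L\<^esub> id a \<sqsubseteq>\<^bsub>L\<^esub> \<Squnion>\<^bsub>L\<^esub>?A" if "(p, a) \<in> I" for p a
        using that c[OF that] L.sup_upper[OF A, of a] A by (cases p) (auto simp: from_two_def)
      then show "\<Squnion>\<^bsub>L\<^esub>?B \<sqsubseteq>\<^bsub>L\<^esub> \<Squnion>\<^bsub>L\<^esub>?A" using A B by (subst L.sup_le_iff) auto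
    qed
    then show ?thesis using that by (simp add: left_unitor_def)
  qed
  show "frame_map (two \<otimes> L) L (left_unitor L)"
    by (rule frame_map_cong[OF c(1)]) (simp add: e)
  show "left_unitor L (tens two L p a) = from_two L p \<sqinter>\<^bsub>L\<^esub> a" if "a \<in> carrier L"
    using c(2)[of p a] that D.tens(3)[of p a] by (simp add: e two_simps)
qed

lemma right_unitor:
  assumes L: "frame_lattice L"
  shows "frame_map (L \<otimes> two) L (right_unitor L)"
    and "a \<in> carrier L \<Longrightarrow> right_unitor L (tens L two a p) = a \<sqinter>\<^bsub>L\<^esub> from_two L p"
proof -
  interpret L: frame_lattice L by fact
  interpret D: frame_pair L two by (intro frame_pairI L two_frame)
  note c = D.cotuple_map[OF frame_map_id from_two_map, OF L L]
  have e: "right_unitor L I = \<Squnion>\<^bsub>L\<^esub> {id a \<sqinter>\<^bsub>L\<^esub> from_two L p | a p. (a, p) \<in> I}"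
    if "I \<in> carrier (L \<otimes> two)" for I
  proof -
    have I: "biideal L two I" using that by (simp add: D.tensor_carrier)
    have c: "(a, p) \<in> I \<Longrightarrow> a \<in> carrier L" for p a by (rule biidealD(1)[OF I])
    have "\<Squnion>\<^bsub>L\<^esub> {a. (a, True) \<in> I} = \<Squnion>\<^bsub>L\<^esub> {id a \<sqinter>\<^bsub>L\<^esub> from_two L p | a p. (a, p) \<in> I}" (is "\<Squnion>\<^bsub>L\<^esub>?A = \<Squnion>\<^bsub>L\<^esub>?B")
    proof (rule L.le_antisym)
      have A: "?A \<subseteq> carrier L" and B: "?B \<subseteq> carrier L" using c by (auto simp: from_two_def)
      show "\<Squnion>\<^bsub>L\<^esub>?A \<in> carrier L" "\<Squnion>\<^bsub>L\<^esub>?B \<in> carrier L" using A B by auto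
      have "a \<sqsubseteq>\<^bsub>L\<^esub> \<Squnion>\<^bsub>L\<^esub>?B" if "(a, True) \<in> I" for a
      proof (rule L.sup_upper[OF B])
        have "a = id a \<sqinter>\<^bsub>L\<^esub> from_two L True" using c[OF that] by (simp add: from_two_def)
        then show "a \<in> ?B" using that by blast
      qed
      then show "\<Squnion>\<^bsub>L\<^esub>?A \<sqsubseteq>\<^bsub>L\<^esub> \<Squnion>\<^bsub>L\<^esub>?B" using A B by (subst L.sup_le_iff) auto
      have "id a \<sqinter>\<^bsub>L\<^esub> from_two L p \<sqsubseteq>\<^bsub>L\<^esub> \<Squnion>\<^bsub>L\<^esub>?A" if "(a, p) \<in> I" for p a
        using that c[OF that] L.sup_upper[OF A, of a] A by (cases p) (auto simp: from_two_def)
      then show "\<Squnion>\<^bsub>L\<^esub>?B \<sqsubseteq>\<^bsub>L\<^esub> \<Squnion>\<^bsub>L\<^esub>?A" using A B by (subst L.sup_le_iff) auto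
    qed
    then show ?thesis using that by (simp add: right_unitor_def)
  qed
  show "frame_map (L \<otimes> two) L (right_unitor L)"
    by (rule frame_map_cong[OF c(1)]) (simp add: e)
  show "right_unitor L (tens L two a p) = a \<sqinter>\<^bsub>L\<^esub> from_two L p" if "a \<in> carrier L"
    using c(2)[of a p] that D.tens(3)[of a p] by (simp add: e two_simps)
qed

text \<open>The associator is an iterated copairing of the three coprojections into
  \<open>L \<otimes> (M \<otimes> N)\<close>. Its definition as one join over triples agrees with
  this nested form because meeting with \<open>f3 c\<close> distributes over the inner join.\<close>

lemma tensor_assoc:
  fixes L :: "'a gorder" and M :: "'b gorder" and N :: "'c gorder"
  assumes L: "frame_lattice L" and M: "frame_lattice M" and N: "frame_lattice N"
  shows "frame_map ((L \<otimes> M) \<otimes> N) (L \<otimes> (M \<otimes> N)) (tensor_assoc L M N)"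
    and "a \<in> carrier L \<Longrightarrow> b \<in> carrier M \<Longrightarrow> c \<in> carrier N \<Longrightarrow>
      tensor_assoc L M N (tens (L \<otimes> M) N (tens L M a b) c) = tens L (M \<otimes> N) a (tens M N b c)"
proof -
  interpret LM: frame_pair L M by (intro frame_pairI assms)
  interpret MN: frame_pair M N by (intro frame_pairI assms)
  interpret T: frame_pair L "M \<otimes> N" by (intro frame_pairI assms MN.tensor_frame)
  interpret S: frame_pair "L \<otimes> M" N by (intro frame_pairI assms LM.tensor_frame)
  interpret F: frame_lattice "L \<otimes> (M \<otimes> N)" by (rule T.tensor_frame)
  let ?R = "L \<otimes> (M \<otimes> N)"
  define f1 where "f1 a = tens L (M \<otimes> N) a \<top>\<^bsub>M \<otimes> N\<^esub>" for a
  define f2 where "f2 b = tens L (M \<otimes> N) \<top>\<^bsub>L\<^esub> (tens M N b \<top>\<^bsub>N\<^esub>)" for b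
  define f3 where "f3 c = tens L (M \<otimes> N) \<top>\<^bsub>L\<^esub> (tens M N \<top>\<^bsub>M\<^esub> c)" for c
  have f1: "frame_map L ?R f1" unfolding f1_def by (rule T.inl_map)
  have f2: "frame_map M ?R f2" unfolding f2_def by (rule frame_map_comp[OF MN.inl_map T.inr_map])
  have f3: "frame_map N ?R f3" unfolding f3_def by (rule frame_map_comp[OF MN.inr_map T.inr_map])
  define f where "f J = \<Squnion>\<^bsub>?R\<^esub> {f1 a \<sqinter>\<^bsub>?R\<^esub> f2 b | a b. (a, b) \<in> J}" for J
  note c = LM.cotuple_map[OF f1 f2, folded f_def]
  define h where "h I = \<Squnion>\<^bsub>?R\<^esub> {f J \<sqinter>\<^bsub>?R\<^esub> f3 c | J c. (J, c) \<in> I}" for I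
  note d = S.cotuple_map[OF c(1) f3, folded h_def]
  have tens3: "f1 a \<sqinter>\<^bsub>?R\<^esub> f2 b \<sqinter>\<^bsub>?R\<^esub> f3 c = tens L (M \<otimes> N) a (tens M N b c)"
    if "a \<in> carrier L" "b \<in> carrier M" "c \<in> carrier N" for a b c
  proof -
    have "f2 b \<sqinter>\<^bsub>?R\<^esub> f3 c = tens L (M \<otimes> N) \<top>\<^bsub>L\<^esub> (tens M N b c)"
      unfolding MN.tens_eq_meet[OF that(2,3)] f2_def f3_def
      using that by (subst frame_mapD(5)[OF T.inr_map]) (auto intro: MN.tens(3))
    moreover have "f1 a \<sqinter>\<^bsub>?R\<^esub> f2 b \<sqinter>\<^bsub>?R\<^esub> f3 c = f1 a \<sqinter>\<^bsub>?R\<^esub> (f2 b \<sqinter>\<^bsub>?R\<^esub> f3 c)"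
      using that frame_mapD(3)[OF f1] frame_mapD(3)[OF f2] frame_mapD(3)[OF f3]
      by (intro F.meet_assoc) auto
    ultimately show ?thesis
      using T.tens_eq_meet[OF that(1) MN.tens(3)[OF that(2,3)]] by (simp add: f1_def)
  qed
  \<comment> \<open>Arranging a triple as \<open>((J, c), (a, b))\<close> brings the nested join
    into the form of \<open>SUP_SUP\<close>, with \<open>fst\<close> as the inner index set.\<close>
  define t where "t x y = (case x of (J, c) \<Rightarrow> case y of (a, b) \<Rightarrow> tens L (M \<otimes> N) a (tens M N b c))"
    for x :: "('a \<times> 'b) set \<times> 'c" and y
  have e: "tensor_assoc L M N I = h I" if I: "I \<in> carrier ((L \<otimes> M) \<otimes> N)" for I
  proof -
    have I': "biideal (L \<otimes> M) N I" using I by (simp add: S.tensor_carrier)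
    have J: "biideal L M J" "c \<in> carrier N" if "(J, c) \<in> I" for J c
      using biidealD(1,2)[OF I' that] by (auto simp: LM.tensor_carrier)
    have "f J \<sqinter>\<^bsub>?R\<^esub> f3 c = \<Squnion>\<^bsub>?R\<^esub>((\<lambda>(a, b). tens L (M \<otimes> N) a (tens M N b c)) ` J)"
      if "(J, c) \<in> I" for J c
    proof -
      have ab: "a \<in> carrier L" "b \<in> carrier M" if "(a, b) \<in> J" for a b
        using biidealD(1,2)[OF J(1)[OF \<open>(J, c) \<in> I\<close>] that] .
      have "f J = \<Squnion>\<^bsub>?R\<^esub>((\<lambda>(a, b). f1 a \<sqinter>\<^bsub>?R\<^esub> f2 b) ` J)"
        unfolding f_def by (rule arg_cong[where f = "\<lambda>A. \<Squnion>\<^bsub>?R\<^esub>A"]) force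
      then have "f J \<sqinter>\<^bsub>?R\<^esub> f3 c = \<Squnion>\<^bsub>?R\<^esub>((\<lambda>x. (case x of (a, b) \<Rightarrow> f1 a \<sqinter>\<^bsub>?R\<^esub> f2 b) \<sqinter>\<^bsub>?R\<^esub> f3 c) ` J)"
        using ab J(2)[OF that] frame_mapD(3)[OF f1] frame_mapD(3)[OF f2] frame_mapD(3)[OF f3]
        by (simp only:) (subst F.meet_SUP(2), auto)
      also have "\<dots> = \<Squnion>\<^bsub>?R\<^esub>((\<lambda>(a, b). tens L (M \<otimes> N) a (tens M N b c)) ` J)"
        using tens3 ab J(2)[OF that] by (intro arg_cong[where f = "\<lambda>A. \<Squnion>\<^bsub>?R\<^esub>A"] image_cong) auto
      finally show ?thesis .
    qed
    then have 1: "(\<lambda>(J, c). f J \<sqinter>\<^bsub>?R\<^esub> f3 c) ` I = (\<lambda>x. \<Squnion>\<^bsub>?R\<^esub>(t x ` fst x)) ` I"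
      by (intro image_cong) (auto simp: t_def)
    have "t x y \<in> carrier ?R" if "x \<in> I" "y \<in> fst x" for x y
      unfolding t_def
      using that J[of "fst x" "snd x"] biidealD(1,2)[OF J(1), of "fst x" "snd x" "fst y" "snd y"]
      by (simp add: case_prod_beta T.tens(3) MN.tens(3))
    then have "h I = \<Squnion>\<^bsub>?R\<^esub>(case_prod t ` Sigma I fst)"
      unfolding h_def Collect_pair_image 1 by (rule F.SUP_SUP)
    also have "case_prod t ` Sigma I fst =
        {tens L (M \<otimes> N) a (tens M N b c) | a b c. \<exists>J. (J, c) \<in> I \<and> (a, b) \<in> J}" (is "?A = ?B")
    proof
      show "?A \<subseteq> ?B" by (auto simp: t_def) blast
      show "?B \<subseteq> ?A"
      proof clarify
        fix a b c J assume "(J, c) \<in> I" "(a, b) \<in> J"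
        then show "tens L (M \<otimes> N) a (tens M N b c) \<in> ?A"
          by (intro image_eqI[of _ _ "((J, c), (a, b))"]) (auto simp: t_def)
      qed
    qed
    finally show ?thesis using I by (simp add: tensor_assoc_def)
  qed
  show "frame_map ((L \<otimes> M) \<otimes> N) (L \<otimes> (M \<otimes> N)) (tensor_assoc L M N)"
    by (rule frame_map_cong[OF d(1)]) (simp add: e)
  show "tensor_assoc L M N (tens (L \<otimes> M) N (tens L M a b) c) = tens L (M \<otimes> N) a (tens M N b c)"
    if "a \<in> carrier L" "b \<in> carrier M" "c \<in> carrier N"
    unfolding e[OF S.tens(3)[OF LM.tens(3)[OF that(1,2)] that(3)]]
      d(2)[OF LM.tens(3)[OF that(1,2)] that(3)] c(2)[OF that(1,2)]
    by (rule tens3[OF that])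
qed

section \<open>Functional relations with values in a frame\<close>

lemma Sup_image_cong: "(\<And>i. i \<in> I \<Longrightarrow> p i = q i) \<Longrightarrow> \<Squnion>\<^bsub>L\<^esub>(p ` I) = \<Squnion>\<^bsub>L\<^esub>(q ` I)"
  by (simp cong: image_cong)

text \<open>The frame is arbitrary because presented locales, coproducts and \<open>two\<close> all
  occur. Conditions on columns are expressed as \<open>functional\<close> of the transpose.\<close>

definition functional :: "'n gorder \<Rightarrow> 'x set \<Rightarrow> 'y set \<Rightarrow> ('x \<Rightarrow> 'y \<Rightarrow> 'n) \<Rightarrow> bool" where
  "functional N X Y \<phi> \<longleftrightarrow> (\<forall>x\<in>X. \<forall>y\<in>Y. \<phi> x y \<in> carrier N) \<and>
    (\<forall>x\<in>X. \<forall>y\<in>Y. \<forall>y'\<in>Y. y \<noteq> y' \<longrightarrow> \<phi> x y \<sqinter>\<^bsub>N\<^esub> \<phi> x y' = \<bottom>\<^bsub>N\<^esub>) \<and>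
    (\<forall>x\<in>X. \<Squnion>\<^bsub>N\<^esub>(\<phi> x ` Y) = \<top>\<^bsub>N\<^esub>)"

lemma functionalD:
  assumes "functional N X Y \<phi>"
  shows "x \<in> X \<Longrightarrow> y \<in> Y \<Longrightarrow> \<phi> x y \<in> carrier N"
    "x \<in> X \<Longrightarrow> y \<in> Y \<Longrightarrow> y' \<in> Y \<Longrightarrow> y \<noteq> y' \<Longrightarrow> \<phi> x y \<sqinter>\<^bsub>N\<^esub> \<phi> x y' = \<bottom>\<^bsub>N\<^esub>"
    "x \<in> X \<Longrightarrow> \<Squnion>\<^bsub>N\<^esub>(\<phi> x ` Y) = \<top>\<^bsub>N\<^esub>"
  using assms by (auto simp: functional_def)

lemma functional_cong:
  assumes "functional N X Y \<phi>" "\<And>x y. x \<in> X \<Longrightarrow> y \<in> Y \<Longrightarrow> \<phi> x y = \<psi> x y"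
  shows "functional N X Y \<psi>"
  using functionalD[OF assms(1)] assms(2) unfolding functional_def by (simp cong: image_cong)

text \<open>The conditions involve only bottom, top, binary meets and joins, all of which frame maps
  preserve.\<close>

lemma functional_map:
  assumes h: "frame_map N M h" and \<phi>: "functional N X Y \<phi>"
  shows "functional M X Y (\<lambda>x y. h (\<phi> x y))"
  unfolding functional_def
proof (intro conjI ballI impI)
  note D = functionalD[OF \<phi>]
  show "h (\<phi> x y) \<in> carrier M" if "x \<in> X" "y \<in> Y" for x y
    using frame_mapD(3)[OF h D(1)[OF that]] .
  show "h (\<phi> x y) \<sqinter>\<^bsub>M\<^esub> h (\<phi> x y') = \<bottom>\<^bsub>M\<^esub>" if "x \<in> X" "y \<in> Y" "y' \<in> Y" "y \<noteq> y'" for x y y'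
    using frame_mapD(5)[OF h D(1)[OF that(1,2)] D(1)[OF that(1,3)]] D(2)[OF that] frame_map_bot[OF h]
    by simp
  show "\<Squnion>\<^bsub>M\<^esub>((\<lambda>y. h (\<phi> x y)) ` Y) = \<top>\<^bsub>M\<^esub>" if "x \<in> X" for x
    using frame_map_SUP[OF h D(1)[OF that], of Y "\<lambda>y. y"] D(3)[OF that] frame_mapD(4)[OF h] by simp
qed

locale frame = frame_lattice L for L :: "'a gorder" (structure)
begin

text \<open>For \<open>y \<noteq> y'\<close> a term of one join meets a term of the other in bottom:
  if the intermediate indices differ, the row of \<open>\<phi>\<close> separates them; if they
  agree, the row of \<open>\<psi>\<close> does.\<close>

lemma functional_comp:
  assumes \<phi>: "functional L X Z \<phi>" and \<psi>: "functional L Z Y \<psi>"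
  shows "functional L X Y (\<lambda>x y. \<Squnion>((\<lambda>z. \<phi> x z \<sqinter> \<psi> z y) ` Z))"
  unfolding functional_def
proof (intro conjI ballI impI)
  note p = functionalD[OF \<phi>] and q = functionalD[OF \<psi>]
  have c: "\<phi> x z \<sqinter> \<psi> z y \<in> carrier L" if "x \<in> X" "y \<in> Y" "z \<in> Z" for x y z
    using that p(1) q(1) by (intro bin_meet(1))
  show "\<Squnion>((\<lambda>z. \<phi> x z \<sqinter> \<psi> z y) ` Z) \<in> carrier L" if "x \<in> X" "y \<in> Y" for x y
    by (rule SUP_closed[OF c[OF that]])
  show "\<Squnion>((\<lambda>z. \<phi> x z \<sqinter> \<psi> z y) ` Z) \<sqinter> \<Squnion>((\<lambda>z. \<phi> x z \<sqinter> \<psi> z y') ` Z) = \<bottom>"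
    if x: "x \<in> X" and y: "y \<in> Y" "y' \<in> Y" "y \<noteq> y'" for x y y'
  proof (rule le_antisym)
    show "\<Squnion>((\<lambda>z. \<phi> x z \<sqinter> \<psi> z y) ` Z) \<sqinter> \<Squnion>((\<lambda>z. \<phi> x z \<sqinter> \<psi> z y') ` Z) \<sqsubseteq> \<bottom>"
    proof (rule Sup_meet_Sup)
      fix a b assume "a \<in> (\<lambda>z. \<phi> x z \<sqinter> \<psi> z y) ` Z" "b \<in> (\<lambda>z. \<phi> x z \<sqinter> \<psi> z y') ` Z"
      then obtain z z' where z: "z \<in> Z" "z' \<in> Z" and ab: "a = \<phi> x z \<sqinter> \<psi> z y" "b = \<phi> x z' \<sqinter> \<psi> z' y'"
        by blast
      note cc = p(1)[OF x z(1)] p(1)[OF x z(2)] q(1)[OF z(1) y(1)] q(1)[OF z(2) y(2)]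
      \<comment> \<open>Regrouping brings the two entries of \<open>\<phi>\<close> together, and the
        two entries of \<open>\<psi>\<close>.\<close>
      have "a \<sqinter> b = (\<phi> x z \<sqinter> \<phi> x z') \<sqinter> (\<psi> z y \<sqinter> \<psi> z' y')"
        unfolding ab using cc bin_meet(1) meet_comm[of L "\<psi> z y" "\<phi> x z'"]
        by (simp add: meet_assoc flip: meet_assoc[of "\<psi> z y"])
      also have "\<dots> = \<bottom>"
      proof (cases "z = z'")
        case True
        then show ?thesis using q(2)[OF z(1) y] cc bin_meet(1) by simp
      next
        case False
        then show ?thesis using p(2)[OF x z] cc bin_meet(1) by simp
      qed
      finally show "a \<sqinter> b \<sqsubseteq> \<bottom>" by simp
    qed (use c x y in auto)
  qed (use x y p(1) q(1) in \<open>auto intro!: bottom_lower bin_meet(1) SUP_closed\<close>)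
  show "\<Squnion>((\<lambda>y. \<Squnion>((\<lambda>z. \<phi> x z \<sqinter> \<psi> z y) ` Z)) ` Y) = \<top>" if x: "x \<in> X" for x
  proof -
    \<comment> \<open>After the interchange the join over \<open>y\<close> comes first, and a whole
      row of \<open>\<psi>\<close> gives top.\<close>
    have "\<Squnion>((\<lambda>y. \<Squnion>((\<lambda>z. \<phi> x z \<sqinter> \<psi> z y) ` Z)) ` Y) = \<Squnion>((\<lambda>z. \<Squnion>((\<lambda>y. \<phi> x z \<sqinter> \<psi> z y) ` Y)) ` Z)"
      by (rule SUP_swap) (use c x in auto)
    also have "\<dots> = \<Squnion>(\<phi> x ` Z)"
      using p(1)[OF x] q(1,3) by (intro Sup_image_cong) (simp flip: meet_SUP)
    finally show ?thesis using p(3)[OF x] by simp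
  qed
qed

text \<open>The product of a matrix with its transpose is the identity matrix: on the diagonal a row
  joins to top, off the diagonal two entries of one column are disjoint. Both inverse laws come down
  to this.\<close>

lemma bijective_meet:
  assumes \<phi>: "functional L X Y \<phi>" "functional L Y X (\<lambda>y x. \<phi> x y)" and x: "x \<in> X" "x' \<in> X"
  shows "\<Squnion>((\<lambda>y. \<phi> x y \<sqinter> \<phi> x' y) ` Y) = from_two L (x = x')"
proof (cases "x = x'")
  case True
  have "\<phi> x y \<sqinter> \<phi> x y = \<phi> x y" if "y \<in> Y" for y
    using functionalD(1)[OF \<phi>(1) x(1) that] le_iff_meet by blast
  then show ?thesis
    using True functionalD(3)[OF \<phi>(1) x(1)] by (simp add: from_two_def cong: image_cong)
next
  case False
  then show ?thesis
    using functionalD(2)[OF \<phi>(2) _ x] by (simp add: from_two_def SUP_bot)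
qed

end

text \<open>Over truth values, disjointness means uniqueness and a row with join top means
  existence, so functional matrices are graphs of functions.\<close>

lemma functional_two_iff:
  "functional two X Y \<phi> \<longleftrightarrow> (\<forall>x\<in>X. \<exists>!y. y \<in> Y \<and> \<phi> x y)"
  unfolding functional_def two_simps two_meet two_Sup two_top two_bot by (simp add: image_iff) blast

section \<open>Models of the presentations as matrices\<close>

lemma ball_rel:
  "(\<forall>(a, B)\<in>rel_u X Y. P a B) \<longleftrightarrow> (\<forall>z\<in>X. \<forall>x\<in>Y. \<forall>y\<in>Y. x \<noteq> y \<longrightarrow> P {(z, x), (z, y)} {})"
  "(\<forall>(a, B)\<in>rel_e X Y. P a B) \<longleftrightarrow> (\<forall>z\<in>X. P {} {{(z, x)} | x. x \<in> Y})"
  "(\<forall>(a, B)\<in>rel_i X Y. P a B) \<longleftrightarrow> (\<forall>z\<in>Y. \<forall>x\<in>X. \<forall>y\<in>X. x \<noteq> y \<longrightarrow> P {(x, z), (y, z)} {})"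
  "(\<forall>(a, B)\<in>rel_s X Y. P a B) \<longleftrightarrow> (\<forall>z\<in>Y. P {} {{(x, z)} | x. x \<in> X})"
  unfolding rel_u_def rel_e_def rel_i_def rel_s_def by blast+

text \<open>A relation into the empty join says that a meet is bottom, and one out of the empty
  infimum says that a join is top. These are the matrix conditions, for rows in (u) and (e) and for
  columns in (i) and (s).\<close>

lemma (in frame) satisfies_lFunc:
  "satisfies (lFunc X Y) L f \<longleftrightarrow> functional L X Y (\<lambda>x y. f (x, y))" (is "?l \<longleftrightarrow> ?r")
  and satisfies_lBij:
  "satisfies (lBij X Y) L f \<longleftrightarrow>
    functional L X Y (\<lambda>x y. f (x, y)) \<and> functional L Y X (\<lambda>y x. f (x, y))" (is "?l' \<longleftrightarrow> ?r'")
proof -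
  let ?sat = "\<lambda>S. \<forall>(a, B)\<in>S. \<Sqinter>(f ` a) \<sqsubseteq> \<Squnion>((\<lambda>b. \<Sqinter>(f ` b)) ` B)"
  have bot: "a \<sqsubseteq> \<bottom> \<longleftrightarrow> a = \<bottom>" if "a \<in> carrier L" for a
    using that le_antisym[of a \<bottom>] by auto
  have top: "\<top> \<sqsubseteq> a \<longleftrightarrow> a = \<top>" if "a \<in> carrier L" for a
    using that le_antisym[of \<top> a] top_higher by auto
  have pair: "\<Sqinter>{a, b} = a \<sqinter> b" for a b by (simp add: meet_def)
  have u: "?sat (rel_u X Y) \<longleftrightarrow>
      (\<forall>z\<in>X. \<forall>x\<in>Y. \<forall>y\<in>Y. x \<noteq> y \<longrightarrow> f (z, x) \<sqinter> f (z, y) = \<bottom>)"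
    and i: "?sat (rel_i X Y) \<longleftrightarrow>
      (\<forall>z\<in>Y. \<forall>x\<in>X. \<forall>y\<in>X. x \<noteq> y \<longrightarrow> f (x, z) \<sqinter> f (y, z) = \<bottom>)"
    and e: "?sat (rel_e X Y) \<longleftrightarrow> (\<forall>z\<in>X. \<Squnion>((\<lambda>x. f (z, x)) ` Y) = \<top>)"
    and s: "?sat (rel_s X Y) \<longleftrightarrow> (\<forall>z\<in>Y. \<Squnion>((\<lambda>x. f (x, z)) ` X) = \<top>)"
    if c: "\<And>x y. x \<in> X \<Longrightarrow> y \<in> Y \<Longrightarrow> f (x, y) \<in> carrier L"
  proof -
    show "?sat (rel_u X Y) \<longleftrightarrow>
      (\<forall>z\<in>X. \<forall>x\<in>Y. \<forall>y\<in>Y. x \<noteq> y \<longrightarrow> f (z, x) \<sqinter> f (z, y) = \<bottom>)"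
      unfolding ball_rel using c by (auto simp: pair sup_empty' bot bin_meet(1))
    show "?sat (rel_i X Y) \<longleftrightarrow>
      (\<forall>z\<in>Y. \<forall>x\<in>X. \<forall>y\<in>X. x \<noteq> y \<longrightarrow> f (x, z) \<sqinter> f (y, z) = \<bottom>)"
      unfolding ball_rel using c by (auto simp: pair sup_empty' bot bin_meet(1))
    have 1: "\<Squnion>((\<lambda>b. \<Sqinter>(f ` b)) ` {{(z, x)} | x. x \<in> Y}) = \<Squnion>((\<lambda>x. f (z, x)) ` Y)" if "z \<in> X" for z
      unfolding Setcompr_eq_image image_image using c[OF that] by (intro Sup_image_cong) simp
    show "?sat (rel_e X Y) \<longleftrightarrow> (\<forall>z\<in>X. \<Squnion>((\<lambda>x. f (z, x)) ` Y) = \<top>)"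
      unfolding ball_rel using c by (auto simp: inf_empty' 1 top SUP_closed)
    have 2: "\<Squnion>((\<lambda>b. \<Sqinter>(f ` b)) ` {{(x, z)} | x. x \<in> X}) = \<Squnion>((\<lambda>x. f (x, z)) ` X)" if "z \<in> Y" for z
      unfolding Setcompr_eq_image image_image using c[OF _ that] by (intro Sup_image_cong) simp
    show "?sat (rel_s X Y) \<longleftrightarrow> (\<forall>z\<in>Y. \<Squnion>((\<lambda>x. f (x, z)) ` X) = \<top>)"
      unfolding ball_rel using c by (auto simp: inf_empty' 2 top SUP_closed)
  qed
  show "?l \<longleftrightarrow> ?r"
  \<comment> \<open>If some generator is sent outside the carrier, both sides are false; otherwise
    the equivalences \<open>u\<close> and \<open>e\<close> apply.\<close>
  proof (cases "\<forall>x\<in>X. \<forall>y\<in>Y. f (x, y) \<in> carrier L")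
    case True
    then have "?l \<longleftrightarrow> ?sat (rel_u X Y) \<and> ?sat (rel_e X Y)"
      by (simp add: satisfies_def gens_lFunc ball_Un) (auto simp: lFunc_def)
    then show ?thesis using True u e by (simp add: functional_def)
  qed (auto simp: satisfies_def gens_lFunc functional_def)
  show "?l' \<longleftrightarrow> ?r'"
  proof (cases "\<forall>x\<in>X. \<forall>y\<in>Y. f (x, y) \<in> carrier L")
    case True
    then have "?l' \<longleftrightarrow> ?sat (rel_u X Y) \<and> ?sat (rel_e X Y) \<and> ?sat (rel_i X Y) \<and> ?sat (rel_s X Y)"
      by (simp add: satisfies_def gens_lBij ball_Un) (auto simp: lBij_def)
    then show ?thesis using True u e i s by (auto simp: functional_def)
  qed (auto simp: satisfies_def gens_lBij functional_def)
qed

text \<open>Relations compare finite infima with joins of finite infima, finiteness coming from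
  \<open>wf_presentation\<close>, and frame maps preserve both.\<close>

lemma satisfies_map:
  assumes wf: "wf_presentation P" and sat: "satisfies P L \<phi>" and h: "frame_map L M h"
  shows "satisfies P M (\<lambda>g. h (\<phi> g))"
proof -
  interpret L: frame_lattice L by (rule frame_mapD(1)[OF h])
  have c: "\<phi> g \<in> carrier L" if "g \<in> gens P" for g using sat that by (auto simp: satisfies_def)
  have Fp: "\<phi> ` a \<subseteq> carrier L" "finite (\<phi> ` a)" if "a \<in> Fpow (gens P)" for a
    using that c by (auto simp: Fpow_def)
  have inf: "h (\<Sqinter>\<^bsub>L\<^esub>(\<phi> ` a)) = \<Sqinter>\<^bsub>M\<^esub>((\<lambda>g. h (\<phi> g)) ` a)" if "a \<in> Fpow (gens P)" for a
  proof -
    \<comment> \<open>Preservation of finite infima is recorded for extensional maps, hence the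
      restriction of \<open>h\<close>.\<close>
    have "(\<lambda>x\<in>carrier L. h x) ` \<phi> ` a = (\<lambda>g. h (\<phi> g)) ` a"
      unfolding image_image using Fp(1)[OF that] by (intro image_cong) auto
    then show ?thesis
      using frame_homsD(5)[OF frame_mapD(1,2)[OF h] frame_map_restrict[OF h] Fp[OF that]] Fp(1)[OF that]
      by simp
  qed
  show ?thesis
    unfolding satisfies_def
  proof (intro conjI ballI funcsetI; clarify?)
    show "h (\<phi> g) \<in> carrier M" if "g \<in> gens P" for g using c[OF that] frame_mapD(3)[OF h] by auto
    fix a B assume r: "(a, B) \<in> rels P"
    then have aB: "a \<in> Fpow (gens P)" "B \<subseteq> Fpow (gens P)" using wf by (auto simp: wf_presentation_def)
    have cB: "\<Sqinter>\<^bsub>L\<^esub>(\<phi> ` b) \<in> carrier L" if "b \<in> B" for b using Fp(1) aB(2) that by auto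
    have "h (\<Sqinter>\<^bsub>L\<^esub>(\<phi> ` a)) \<sqsubseteq>\<^bsub>M\<^esub> h (\<Squnion>\<^bsub>L\<^esub>((\<lambda>b. \<Sqinter>\<^bsub>L\<^esub>(\<phi> ` b)) ` B))"
      using sat r Fp(1)[OF aB(1)] cB by (intro frame_map_mono[OF h] L.SUP_closed) (auto simp: satisfies_def)
    also have "\<dots> = \<Squnion>\<^bsub>M\<^esub>((\<lambda>b. \<Sqinter>\<^bsub>M\<^esub>((\<lambda>g. h (\<phi> g)) ` b)) ` B)"
      using inf aB(2) by (intro trans[OF frame_map_SUP[OF h cB] Sup_image_cong]) auto
    finally show "\<Sqinter>\<^bsub>M\<^esub>((\<lambda>g. h (\<phi> g)) ` a) \<sqsubseteq>\<^bsub>M\<^esub> \<Squnion>\<^bsub>M\<^esub>((\<lambda>b. \<Sqinter>\<^bsub>M\<^esub>((\<lambda>g. h (\<phi> g)) ` b)) ` B)"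
      by (simp add: inf[OF aB(1)])
  qed
qed

text \<open>\<open>h\<close> composed with \<open>gen\<close> is a model of the relations, and the
  restrictions of \<open>h\<close> and \<open>k\<close> both extend it; the uniqueness half of
  \<open>presented_universal\<close> identifies them.\<close>

lemma presented_ext:
  assumes wf: "wf_presentation P"
    and h: "frame_map (presented P) N h" and k: "frame_map (presented P) N k"
    and eq: "\<And>g. g \<in> gens P \<Longrightarrow> h (gen P g) = k (gen P g)"
    and u: "u \<in> carrier (presented P)"
  shows "h u = k u"
proof -
  have c: "gen P g \<in> carrier (presented P)" if "g \<in> gens P" for g
    using pideal_gen(1)[OF wf that] by (simp add: presented_def)
  have "restrict h (carrier (presented P)) = restrict k (carrier (presented P))"
    using presented_universal[OF wf frame_mapD(2)[OF h] satisfies_map[OF wf gen_satisfies[OF wf] h]]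
  proof (rule Uniq_D[OF ex1_iff_ex_Uniq[THEN iffD1, THEN conjunct2]])
    show "restrict h (carrier (presented P)) \<in> frame_homs (presented P) N \<and>
        (\<forall>g\<in>gens P. restrict h (carrier (presented P)) (gen P g) = h (gen P g))"
      using frame_map_restrict[OF h] c by simp
    show "restrict k (carrier (presented P)) \<in> frame_homs (presented P) N \<and>
        (\<forall>g\<in>gens P. restrict k (carrier (presented P)) (gen P g) = h (gen P g))"
      using frame_map_restrict[OF k] c eq by simp
  qed
  from fun_cong[OF this, of u] show ?thesis using u by simp
qed

section \<open>Enriched categories with matrix multiplication on generators\<close>

text \<open>Both kinds of enriched categories in the theorem have hom-locales generated by matrices
  \<open>e F G i\<close> with rows \<open>S F i\<close> and columns \<open>S G i\<close>, indexed by a set \<open>K\<close>: it is a singleton for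
  the enriched categories of sets and \<open>Ob C\<close> for functor categories. All equations between
  composites of frame maps then reduce to identities between matrix entries.\<close>

locale matrix_lcat =
  fixes A :: "('o, 'g set set) lcat" and Q :: "'o \<Rightarrow> 'o \<Rightarrow> 'g presentation"
    and K :: "'i set" and S :: "'o \<Rightarrow> 'i \<Rightarrow> 'v set" and g :: "'i \<Rightarrow> 'v \<Rightarrow> 'v \<Rightarrow> 'g"
  assumes hom: "\<lbrakk>F \<in> lObj A; G \<in> lObj A\<rbrakk> \<Longrightarrow> lHom A F G = presented (Q F G)"
    and wf: "\<lbrakk>F \<in> lObj A; G \<in> lObj A\<rbrakk> \<Longrightarrow> wf_presentation (Q F G)"
    and gens: "\<lbrakk>F \<in> lObj A; G \<in> lObj A\<rbrakk> \<Longrightarrow>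
      gens (Q F G) = {g i x y | i x y. i \<in> K \<and> x \<in> S F i \<and> y \<in> S G i}"
    and mul_hom: "\<lbrakk>F \<in> lObj A; H \<in> lObj A; G \<in> lObj A\<rbrakk>
      \<Longrightarrow> lMul A F H G \<in> frame_homs (lHom A F G) (lHom A F H \<otimes> lHom A H G)"
    and mul_gen: "\<lbrakk>F \<in> lObj A; H \<in> lObj A; G \<in> lObj A; i \<in> K; x \<in> S F i; y \<in> S G i\<rbrakk>
      \<Longrightarrow> lMul A F H G (gen (Q F G) (g i x y)) =
        \<Squnion>\<^bsub>lHom A F H \<otimes> lHom A H G\<^esub> ((\<lambda>z. tens (lHom A F H) (lHom A H G)
          (gen (Q F H) (g i x z)) (gen (Q H G) (g i z y))) ` S H i)"
    and unit_hom: "F \<in> lObj A \<Longrightarrow> lUnit A F \<in> frame_homs (lHom A F F) two"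
    and unit_gen: "\<lbrakk>F \<in> lObj A; i \<in> K; x \<in> S F i; y \<in> S F i\<rbrakk>
      \<Longrightarrow> lUnit A F (gen (Q F F) (g i x y)) \<longleftrightarrow> x = y"
begin

abbreviation e where "e F G i x y \<equiv> gen (Q F G) (g i x y)"

lemma frame_hom: "\<lbrakk>F \<in> lObj A; G \<in> lObj A\<rbrakk> \<Longrightarrow> frame_lattice (lHom A F G)"
  by (simp add: hom presented_frame wf)

lemma frame_pair_hom:
  "\<lbrakk>F \<in> lObj A; G \<in> lObj A; F' \<in> lObj A; G' \<in> lObj A\<rbrakk> \<Longrightarrow> frame_pair (lHom A F G) (lHom A F' G')"
  by (intro frame_pairI frame_hom)

lemma mul_map:
  assumes "F \<in> lObj A" "H \<in> lObj A" "G \<in> lObj A"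
  shows "frame_map (lHom A F G) (lHom A F H \<otimes> lHom A H G) (lMul A F H G)"
  using assms
  by (intro frame_mapI frame_hom frame_pair.tensor_frame[OF frame_pair_hom] mul_hom)

lemma unit_map: "F \<in> lObj A \<Longrightarrow> frame_map (lHom A F F) two (lUnit A F)"
  by (intro frame_mapI frame_hom two_frame unit_hom)

lemma e_closed:
  assumes "F \<in> lObj A" "G \<in> lObj A" "i \<in> K" "x \<in> S F i" "y \<in> S G i"
  shows "e F G i x y \<in> carrier (lHom A F G)"
proof -
  have "g i x y \<in> gens (Q F G)" using gens assms by blast
  then show ?thesis using pideal_gen(1)[OF wf] assms(1,2) by (simp add: hom presented_def)
qed

text \<open>The form in which equations between frame maps out of a hom-locale are verified: by
  comparison on matrix entries.\<close>

lemma hom_ext: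
  assumes "F \<in> lObj A" "G \<in> lObj A"
    and "frame_map (lHom A F G) N h" "frame_map (lHom A F G) N k"
    and "\<And>i x y. i \<in> K \<Longrightarrow> x \<in> S F i \<Longrightarrow> y \<in> S G i \<Longrightarrow> h (e F G i x y) = k (e F G i x y)"
    and "u \<in> carrier (lHom A F G)"
  shows "h u = k u"
  using assms(3-6) presented_ext[OF wf[OF assms(1,2)], of N h k u]
  unfolding hom[OF assms(1,2)] gens[OF assms(1,2)] by blast

lemma homs_ext:
  assumes "F \<in> lObj A" "G \<in> lObj A" "frame_lattice N"
    and "h \<in> frame_homs (lHom A F G) N" "k \<in> frame_homs (lHom A F G) N"
    and "\<And>i x y. i \<in> K \<Longrightarrow> x \<in> S F i \<Longrightarrow> y \<in> S G i \<Longrightarrow> h (e F G i x y) = k (e F G i x y)"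
  shows "h = k"
proof (rule extensionalityI)
  note h = assms(4,5)[unfolded frame_map_homs_iff[OF frame_hom[OF assms(1,2)] assms(3)]]
  show "h \<in> extensional (carrier (lHom A F G))" "k \<in> extensional (carrier (lHom A F G))"
    using h by simp_all
  show "h u = k u" if "u \<in> carrier (lHom A F G)" for u
    by (rule hom_ext[OF assms(1,2) h[THEN conjunct1] assms(6) that])
qed

text \<open>The common shape of the composites in the associativity, unit and inverse laws and in
  the composition of points: \<open>p \<otimes> q\<close> after multiplication, then some
  \<open>h\<close> such as an associator, a unitor or a codiagonal. On an entry it is a matrix
  product in which \<open>h\<close> of a tensor plays the role of multiplication.\<close>

lemma tensor_map_mul:
  assumes obj: "F \<in> lObj A" "H \<in> lObj A" "G \<in> lObj A"
    and p: "frame_map (lHom A F H) L p" and q: "frame_map (lHom A H G) M q"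
    and h: "frame_map (L \<otimes> M) N h"
  defines "t \<equiv> \<lambda>u. h (tensor_map (lHom A F H) (lHom A H G) L M p q (lMul A F H G u))"
  shows "frame_map (lHom A F G) N t"
    and "\<lbrakk>i \<in> K; x \<in> S F i; y \<in> S G i\<rbrakk> \<Longrightarrow>
      t (e F G i x y) = \<Squnion>\<^bsub>N\<^esub>((\<lambda>z. h (tens L M (p (e F H i x z)) (q (e H G i z y)))) ` S H i)"
proof -
  interpret P: frame_pair "lHom A F H" "lHom A H G" by (intro frame_pair_hom obj)
  note tm = tensor_map[OF p q]
  show "frame_map (lHom A F G) N t"
    unfolding t_def by (rule frame_map_comp[OF frame_map_comp[OF mul_map[OF obj] tm(1)] h])
  assume i: "i \<in> K" "x \<in> S F i" "y \<in> S G i"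
  have c: "e F H i x z \<in> carrier (lHom A F H)" "e H G i z y \<in> carrier (lHom A H G)" if "z \<in> S H i" for z
    using obj i that by (auto intro: e_closed)
  show "t (e F G i x y) = \<Squnion>\<^bsub>N\<^esub>((\<lambda>z. h (tens L M (p (e F H i x z)) (q (e H G i z y)))) ` S H i)"
    unfolding t_def mul_gen[OF obj i]
    by (rule trans[OF frame_map_SUP[OF frame_map_comp[OF tm(1) h], of "S H i"
          "\<lambda>z. tens (lHom A F H) (lHom A H G) (e F H i x z) (e H G i z y)"] Sup_image_cong])
      (simp_all add: tm(2) c P.tens(3))
qed

lemma tensor_map_mul':
  assumes obj: "F \<in> lObj A" "H \<in> lObj A" "G \<in> lObj A"
    and p: "frame_map (lHom A F H) L p" and q: "frame_map (lHom A H G) M q"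
  defines "t \<equiv> \<lambda>u. tensor_map (lHom A F H) (lHom A H G) L M p q (lMul A F H G u)"
  shows "frame_map (lHom A F G) (L \<otimes> M) t"
    and "\<lbrakk>i \<in> K; x \<in> S F i; y \<in> S G i\<rbrakk> \<Longrightarrow>
      t (e F G i x y) = \<Squnion>\<^bsub>L \<otimes> M\<^esub>((\<lambda>z. tens L M (p (e F H i x z)) (q (e H G i z y))) ` S H i)"
  using tensor_map_mul[OF obj p q frame_map_id[OF frame_mapD(2)[OF tensor_map(1)[OF p q]]]]
  by (simp_all add: t_def)

text \<open>Associativity becomes the interchange of a double join of triple tensors, and the unit
  laws become multiplication by a diagonal matrix.\<close>

lemma is_localic_category: "localic_category A"
proof (rule localic_category.intro)
  fix F H K' G u
  assume obj: "F \<in> lObj A" "H \<in> lObj A" "K' \<in> lObj A" "G \<in> lObj A" and u: "u \<in> carrier (lHom A F G)"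
  note fr = frame_hom[OF obj(1,2)] frame_hom[OF obj(2,3)] frame_hom[OF obj(3,4)]
  let ?FH = "lHom A F H" and ?HK = "lHom A H K'" and ?KG = "lHom A K' G"
  interpret P: frame_pair ?FH ?HK by (intro frame_pair_hom obj)
  interpret P': frame_pair ?HK ?KG by (intro frame_pair_hom obj)
  interpret R: frame_pair ?FH "?HK \<otimes> ?KG" by (intro frame_pairI fr P'.tensor_frame)
  interpret R': frame_pair "?FH \<otimes> ?HK" ?KG by (intro frame_pairI fr P.tensor_frame)
  interpret N: frame_lattice "?FH \<otimes> (?HK \<otimes> ?KG)" by (rule R.tensor_frame)
  note as = tensor_assoc[OF fr]
  note l = tensor_map_mul[OF obj(1,3,4) mul_map[OF obj(1-3)] frame_map_id[OF fr(3)] as(1)]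
  note r = tensor_map_mul'[OF obj(1,2,4) frame_map_id[OF fr(1)] mul_map[OF obj(2-4)]]
  show "tensor_assoc ?FH ?HK ?KG
      (tensor_map (lHom A F K') ?KG (?FH \<otimes> ?HK) ?KG (lMul A F H K') id (lMul A F K' G u)) =
    tensor_map ?FH (lHom A H G) ?FH (?HK \<otimes> ?KG) id (lMul A H K' G) (lMul A F H G u)"
  proof (rule hom_ext[OF obj(1,4) l(1) r(1) _ u])
    fix i x y assume i: "i \<in> K" "x \<in> S F i" "y \<in> S G i"
    let ?t = "\<lambda>z w. tens ?FH (?HK \<otimes> ?KG) (e F H i x z) (tens ?HK ?KG (e H K' i z w) (e K' G i w y))"
    have c: "e F H i x z \<in> carrier ?FH" if "z \<in> S H i" for z using i that obj by (auto intro: e_closed)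
    have d: "e K' G i w y \<in> carrier ?KG" if "w \<in> S K' i" for w using i that obj by (auto intro: e_closed)
    have f: "e H K' i z w \<in> carrier ?HK" if "z \<in> S H i" "w \<in> S K' i" for z w
      using i that obj by (auto intro: e_closed)
    have t: "?t z w \<in> carrier (?FH \<otimes> (?HK \<otimes> ?KG))" if "z \<in> S H i" "w \<in> S K' i" for z w
      using that c d f by (intro R.tens(3) P'.tens(3)) auto
    have "tensor_assoc ?FH ?HK ?KG (tens (?FH \<otimes> ?HK) ?KG (lMul A F H K' (e F K' i x w)) (e K' G i w y)) =
        \<Squnion>\<^bsub>?FH \<otimes> (?HK \<otimes> ?KG)\<^esub>((\<lambda>z. ?t z w) ` S H i)" if w: "w \<in> S K' i" for w
    proof -
      \<comment> \<open>The inner product is itself a join, which \<open>tens\<close> preserves in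
        its first variable.\<close>
      have "tens (?FH \<otimes> ?HK) ?KG (lMul A F H K' (e F K' i x w)) (e K' G i w y) =
          \<Squnion>\<^bsub>(?FH \<otimes> ?HK) \<otimes> ?KG\<^esub>((\<lambda>z. tens (?FH \<otimes> ?HK) ?KG (tens ?FH ?HK (e F H i x z) (e H K' i z w)) (e K' G i w y)) ` S H i)"
        unfolding mul_gen[OF obj(1-3) i(1,2) w]
        by (rule R'.tens_SUP[OF d[OF w] P.tens(3)[OF c f[OF _ w]]])
      then show ?thesis
        by (simp only:) (rule trans[OF frame_map_SUP[OF as(1)] Sup_image_cong],
          simp_all add: as(2) R'.tens(3) P.tens(3) c d[OF w] f[OF _ w])
    qed
    then have "tensor_assoc ?FH ?HK ?KG
        (tensor_map (lHom A F K') ?KG (?FH \<otimes> ?HK) ?KG (lMul A F H K') id (lMul A F K' G (e F G i x y))) =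
      \<Squnion>\<^bsub>?FH \<otimes> (?HK \<otimes> ?KG)\<^esub>((\<lambda>w. \<Squnion>\<^bsub>?FH \<otimes> (?HK \<otimes> ?KG)\<^esub>((\<lambda>z. ?t z w) ` S H i)) ` S K' i)"
      unfolding l(2)[OF i] id_apply by (rule Sup_image_cong)
    \<comment> \<open>The two bracketings join over the intermediate indices \<open>w\<close> and
      \<open>z\<close> in opposite orders.\<close>
    also have "\<dots> = \<Squnion>\<^bsub>?FH \<otimes> (?HK \<otimes> ?KG)\<^esub>((\<lambda>z. \<Squnion>\<^bsub>?FH \<otimes> (?HK \<otimes> ?KG)\<^esub>(?t z ` S K' i)) ` S H i)"
      by (rule N.SUP_swap[OF t])
    also have "\<dots> = tensor_map ?FH (lHom A H G) ?FH (?HK \<otimes> ?KG) id (lMul A H K' G) (lMul A F H G (e F G i x y))"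
    proof -
      have "tens ?FH (?HK \<otimes> ?KG) (e F H i x z) (lMul A H K' G (e H G i z y)) =
          \<Squnion>\<^bsub>?FH \<otimes> (?HK \<otimes> ?KG)\<^esub>(?t z ` S K' i)" if z: "z \<in> S H i" for z
        unfolding mul_gen[OF obj(2-4) i(1) z i(3)]
        by (rule R.tens_SUP_right[OF c[OF z] P'.tens(3)[OF f[OF z] d]])
      then show ?thesis
        unfolding r(2)[OF i] id_apply by (intro Sup_image_cong) simp
    qed
    finally show "tensor_assoc ?FH ?HK ?KG
        (tensor_map (lHom A F K') ?KG (?FH \<otimes> ?HK) ?KG (lMul A F H K') id (lMul A F K' G (e F G i x y))) =
      tensor_map ?FH (lHom A H G) ?FH (?HK \<otimes> ?KG) id (lMul A H K' G) (lMul A F H G (e F G i x y))" .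
  qed
next
  fix F G u assume obj: "F \<in> lObj A" "G \<in> lObj A" and u: "u \<in> carrier (lHom A F G)"
  note fr = frame_hom[OF obj]
  interpret N: frame_lattice "lHom A F G" by (rule fr)
  note lu = left_unitor[OF fr] and ru = right_unitor[OF fr]
  note l = tensor_map_mul[OF obj(1,1,2) unit_map[OF obj(1)] frame_map_id[OF fr] lu(1)]
  note r = tensor_map_mul[OF obj(1,2,2) frame_map_id[OF fr] unit_map[OF obj(2)] ru(1)]
  show "left_unitor (lHom A F G)
      (tensor_map (lHom A F F) (lHom A F G) two (lHom A F G) (lUnit A F) id (lMul A F F G u)) = u"
  proof (rule hom_ext[OF obj l(1) frame_map_id[OF fr, unfolded id_def] _ u])
    fix i x y assume i: "i \<in> K" "x \<in> S F i" "y \<in> S G i"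
    have c: "e F G i z y \<in> carrier (lHom A F G)" if "z \<in> S F i" for z using i that obj by (auto intro: e_closed)
    \<comment> \<open>By \<open>unit_gen\<close> the term is bottom unless \<open>z = x\<close>,
      where the unitor returns the entry itself.\<close>
    have "\<Squnion>\<^bsub>lHom A F G\<^esub>((\<lambda>z. left_unitor (lHom A F G) (tens two (lHom A F G) (lUnit A F (e F F i x z)) (id (e F G i z y)))) ` S F i)
      = e F G i x y"
      using i c obj by (subst N.SUP_single[of x]) (auto simp: lu(2) unit_gen from_two_def)
    then show "left_unitor (lHom A F G)
      (tensor_map (lHom A F F) (lHom A F G) two (lHom A F G) (lUnit A F) id (lMul A F F G (e F G i x y))) = e F G i x y"
      unfolding l(2)[OF i] .
  qed
  show "right_unitor (lHom A F G)
      (tensor_map (lHom A F G) (lHom A G G) (lHom A F G) two id (lUnit A G) (lMul A F G G u)) = u"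
  proof (rule hom_ext[OF obj r(1) frame_map_id[OF fr, unfolded id_def] _ u])
    fix i x y assume i: "i \<in> K" "x \<in> S F i" "y \<in> S G i"
    have c: "e F G i x z \<in> carrier (lHom A F G)" if "z \<in> S G i" for z using i that obj by (auto intro: e_closed)
    have "\<Squnion>\<^bsub>lHom A F G\<^esub>((\<lambda>z. right_unitor (lHom A F G) (tens (lHom A F G) two (id (e F G i x z)) (lUnit A G (e G G i z y)))) ` S G i)
      = e F G i x y"
      using i c obj by (subst N.SUP_single[of y]) (auto simp: ru(2) unit_gen from_two_def)
    then show "right_unitor (lHom A F G)
      (tensor_map (lHom A F G) (lHom A G G) (lHom A F G) two id (lUnit A G) (lMul A F G G (e F G i x y))) = e F G i x y"
      unfolding r(2)[OF i] .
  qed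
qed (fact frame_hom mul_hom unit_hom)+

text \<open>The inverse transposes matrices and the codiagonal turns tensors into meets, so each
  inverse law computes the product of a matrix with its transpose.\<close>

lemma is_localic_groupoid:
  assumes inv: "\<And>F G. \<lbrakk>F \<in> lObj A; G \<in> lObj A\<rbrakk> \<Longrightarrow> \<iota> F G \<in> frame_homs (lHom A F G) (lHom A G F)"
    and inv_gen: "\<And>F G i x y. \<lbrakk>F \<in> lObj A; G \<in> lObj A; i \<in> K; x \<in> S F i; y \<in> S G i\<rbrakk>
      \<Longrightarrow> \<iota> F G (e F G i x y) = e G F i y x"
    and fn: "\<And>F G i. \<lbrakk>F \<in> lObj A; G \<in> lObj A; i \<in> K\<rbrakk> \<Longrightarrow>
      functional (lHom A F G) (S F i) (S G i) (e F G i) \<and>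
      functional (lHom A F G) (S G i) (S F i) (\<lambda>y x. e F G i x y)"
  shows "localic_groupoid A \<iota>"
proof (rule localic_groupoid.intro[OF is_localic_category], unfold_locales)
  fix F G u assume obj: "F \<in> lObj A" "G \<in> lObj A" and u: "u \<in> carrier (lHom A F F)"
  note fr = frame_hom[OF obj] frame_hom[OF obj(2,1)]
  have i: "frame_map (lHom A F G) (lHom A G F) (\<iota> F G)" "frame_map (lHom A G F) (lHom A F G) (\<iota> G F)"
    by (rule frame_mapI[OF fr inv[OF obj]], rule frame_mapI[OF fr(2,1) inv[OF obj(2,1)]])
  note cd = codiag[OF fr(1)] codiag[OF fr(2)]
  note r = tensor_map_mul[OF obj(1,2,1) frame_map_id[OF fr(1)] i(2) cd(1)]
  note l = tensor_map_mul[OF obj(1,2,1) i(1) frame_map_id[OF fr(2)] cd(3)]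
  have c: "e F G i x y \<in> carrier (lHom A F G)" "e G F i y x \<in> carrier (lHom A G F)"
    if "i \<in> K" "x \<in> S F i" "y \<in> S G i" for i x y using that obj by (auto intro: e_closed)
  interpret N: frame "lHom A F G" unfolding frame_def by (rule fr)
  interpret N': frame "lHom A G F" unfolding frame_def by (rule fr)
  show "codiag (lHom A F G) (tensor_map (lHom A F G) (lHom A G F) (lHom A F G) (lHom A F G)
      id (\<iota> G F) (lMul A F G F u)) = from_two (lHom A F G) (lUnit A F u)"
  proof (rule hom_ext[OF obj(1,1) r(1) frame_map_comp[OF unit_map[OF obj(1)] from_two_map[OF fr(1)]] _ u])
    fix i x y assume i: "i \<in> K" "x \<in> S F i" "y \<in> S F i"
    have "\<Squnion>\<^bsub>lHom A F G\<^esub>((\<lambda>z. codiag (lHom A F G) (tens (lHom A F G) (lHom A F G) (id (e F G i x z)) (\<iota> G F (e G F i z y)))) ` S G i)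
      = \<Squnion>\<^bsub>lHom A F G\<^esub>((\<lambda>z. e F G i x z \<sqinter>\<^bsub>lHom A F G\<^esub> e F G i y z) ` S G i)"
      using i obj c by (intro Sup_image_cong) (simp add: inv_gen cd(2))
    also have "\<dots> = from_two (lHom A F G) (x = y)"
      by (rule N.bijective_meet[OF fn[OF obj i(1), THEN conjunct1] fn[OF obj i(1), THEN conjunct2] i(2,3)])
    finally show "codiag (lHom A F G) (tensor_map (lHom A F G) (lHom A G F) (lHom A F G) (lHom A F G)
      id (\<iota> G F) (lMul A F G F (e F F i x y))) = from_two (lHom A F G) (lUnit A F (e F F i x y))"
      unfolding r(2)[OF i] using unit_gen[OF obj(1) i] by simp
  qed
  show "codiag (lHom A G F) (tensor_map (lHom A F G) (lHom A G F) (lHom A G F) (lHom A G F)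
      (\<iota> F G) id (lMul A F G F u)) = from_two (lHom A G F) (lUnit A F u)"
  proof (rule hom_ext[OF obj(1,1) l(1) frame_map_comp[OF unit_map[OF obj(1)] from_two_map[OF fr(2)]] _ u])
    fix i x y assume i: "i \<in> K" "x \<in> S F i" "y \<in> S F i"
    have "\<Squnion>\<^bsub>lHom A G F\<^esub>((\<lambda>z. codiag (lHom A G F) (tens (lHom A G F) (lHom A G F) (\<iota> F G (e F G i x z)) (id (e G F i z y)))) ` S G i)
      = \<Squnion>\<^bsub>lHom A G F\<^esub>((\<lambda>z. e G F i z x \<sqinter>\<^bsub>lHom A G F\<^esub> e G F i z y) ` S G i)"
      using i obj c by (intro Sup_image_cong) (simp add: inv_gen cd(4))
    \<comment> \<open>Here the matrix is the transpose of \<open>e G F i\<close>, so its row and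
      column conditions exchange roles.\<close>
    also have "\<dots> = from_two (lHom A G F) (x = y)"
      by (rule N'.bijective_meet[OF fn[OF obj(2,1) i(1), THEN conjunct2] fn[OF obj(2,1) i(1), THEN conjunct1] i(2,3)])
    finally show "codiag (lHom A G F) (tensor_map (lHom A F G) (lHom A G F) (lHom A G F) (lHom A G F)
      (\<iota> F G) id (lMul A F G F (e F F i x y))) = from_two (lHom A G F) (lUnit A F (e F F i x y))"
      unfolding l(2)[OF i] using unit_gen[OF obj(1) i] by simp
  qed
qed (fact inv)

text \<open>Points compose like relations, since \<open>codiag two\<close> is conjunction on
  elementary tensors and joins in \<open>two\<close> are existential.\<close>

lemma underlying_Cmp:
  assumes obj: "F \<in> lObj A" "H \<in> lObj A" "G \<in> lObj A"
    and p: "p \<in> frame_homs (lHom A F H) two" and q: "q \<in> frame_homs (lHom A H G) two"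
  shows "Cmp (underlying_cat A) F H G q p \<in> frame_homs (lHom A F G) two"
    and "\<lbrakk>i \<in> K; x \<in> S F i; y \<in> S G i\<rbrakk> \<Longrightarrow>
      Cmp (underlying_cat A) F H G q p (e F G i x y) \<longleftrightarrow>
        (\<exists>z\<in>S H i. p (e F H i x z) \<and> q (e H G i z y))"
proof -
  note fm = frame_mapI[OF frame_hom[OF obj(1,2)] two_frame p] frame_mapI[OF frame_hom[OF obj(2,3)] two_frame q]
  note t = tensor_map_mul[OF obj fm codiag(1)[OF two_frame]]
  show "Cmp (underlying_cat A) F H G q p \<in> frame_homs (lHom A F G) two"
    using frame_map_restrict[OF t(1)] by (simp add: underlying_cat_def)
  show "Cmp (underlying_cat A) F H G q p (e F G i x y) \<longleftrightarrow>
      (\<exists>z\<in>S H i. p (e F H i x z) \<and> q (e H G i z y))" if i: "i \<in> K" "x \<in> S F i" "y \<in> S G i"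
    using e_closed[OF obj(1,3) i] t(2)[OF i]
    by (auto simp: underlying_cat_def codiag(2)[OF two_frame] two_simps two_meet two_Sup image_iff)
qed

lemma underlying_category: "category (underlying_cat A)"
proof -
  have s: "Ob (underlying_cat A) = lObj A" "Mor (underlying_cat A) F G = frame_homs (lHom A F G) two"
    "Idn (underlying_cat A) = lUnit A" for F G by (simp_all add: underlying_cat_def)
  note c = underlying_Cmp
  show ?thesis
  proof
    fix X assume "X \<in> Ob (underlying_cat A)"
    then show "Idn (underlying_cat A) X \<in> Mor (underlying_cat A) X X" unfolding s by (rule unit_hom)
  next
    fix X Y Z p q assume "X \<in> Ob (underlying_cat A)" "Y \<in> Ob (underlying_cat A)" "Z \<in> Ob (underlying_cat A)"
      "p \<in> Mor (underlying_cat A) X Y" "q \<in> Mor (underlying_cat A) Y Z"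
    then show "Cmp (underlying_cat A) X Y Z q p \<in> Mor (underlying_cat A) X Z" unfolding s by (rule c(1))
  next
    fix X Y p assume "X \<in> Ob (underlying_cat A)" "Y \<in> Ob (underlying_cat A)" "p \<in> Mor (underlying_cat A) X Y"
    then have X: "X \<in> lObj A" and Y: "Y \<in> lObj A" and p: "p \<in> frame_homs (lHom A X Y) two" by (simp_all add: s)
    show "Cmp (underlying_cat A) X X Y p (Idn (underlying_cat A) X) = p"
      unfolding s by (rule homs_ext[OF X Y two_frame c(1)[OF X X Y unit_hom[OF X] p] p])
        (use X Y p in \<open>auto simp: c(2) unit_hom unit_gen\<close>)
    show "Cmp (underlying_cat A) X Y Y (Idn (underlying_cat A) Y) p = p"
      unfolding s by (rule homs_ext[OF X Y two_frame c(1)[OF X Y Y p unit_hom[OF Y]] p])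
        (use X Y p in \<open>auto simp: c(2) unit_hom unit_gen\<close>)
  next
    fix W X Y Z f g h
    assume "W \<in> Ob (underlying_cat A)" "X \<in> Ob (underlying_cat A)" "Y \<in> Ob (underlying_cat A)"
      "Z \<in> Ob (underlying_cat A)" "f \<in> Mor (underlying_cat A) W X" "g \<in> Mor (underlying_cat A) X Y"
      "h \<in> Mor (underlying_cat A) Y Z"
    note a = this[unfolded s]
    note gf = c(1)[OF a(1-3,5,6)] and hg = c(1)[OF a(2-4,6,7)]
    show "Cmp (underlying_cat A) W Y Z h (Cmp (underlying_cat A) W X Y g f) =
        Cmp (underlying_cat A) W X Z (Cmp (underlying_cat A) X Y Z h g) f"
      by (rule homs_ext[OF a(1,4) two_frame c(1)[OF a(1,3,4) gf a(7)] c(1)[OF a(1,2,4,5) hg]])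
        (use a in \<open>auto simp: c(2)[OF a(1,3,4) gf a(7)] c(2)[OF a(1,2,4,5) hg] c(2)[OF a(1-3,5,6)] c(2)[OF a(2-4,6,7)]\<close>)
  qed
qed

end

text \<open>If \<open>P\<close> sends entries to entries and the row and column sets agree, both
  sides of the compatibility with multiplication are joins of the same tensors over the same
  \<open>z\<close>. The map \<open>\<sigma>\<close> tells which matrix of the source a matrix of the
  target goes to; for evaluation at \<open>X\<close> it is constantly \<open>X\<close>.\<close>

lemma matrix_enriched_functor:
  fixes \<sigma> :: "'j \<Rightarrow> 'i"
  assumes "matrix_lcat A Q K S g" and "matrix_lcat B Q' K' S' g'"
    and Ob: "eOb P \<in> lObj A \<rightarrow>\<^sub>E lObj B"
    and Hom: "eHom P \<in>
      (\<Pi>\<^sub>E F\<in>lObj A. \<Pi>\<^sub>E G\<in>lObj A. frame_homs (lHom B (eOb P F) (eOb P G)) (lHom A F G))"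
    and \<sigma>: "\<And>j. j \<in> K' \<Longrightarrow> \<sigma> j \<in> K"
    and S: "\<And>F j. F \<in> lObj A \<Longrightarrow> j \<in> K' \<Longrightarrow> S' (eOb P F) j = S F (\<sigma> j)"
    and gen: "\<And>F G j x y. \<lbrakk>F \<in> lObj A; G \<in> lObj A; j \<in> K'; x \<in> S F (\<sigma> j); y \<in> S G (\<sigma> j)\<rbrakk> \<Longrightarrow>
      eHom P F G (gen (Q' (eOb P F) (eOb P G)) (g' j x y)) = gen (Q F G) (g (\<sigma> j) x y)"
  shows "enriched_functor A B P"
proof -
  interpret A: matrix_lcat A Q K S g by fact
  interpret B: matrix_lcat B Q' K' S' g' by fact
  have o: "eOb P F \<in> lObj B" if "F \<in> lObj A" for F using Ob that by auto
  have h: "frame_map (lHom B (eOb P F) (eOb P G)) (lHom A F G) (eHom P F G)"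
    if "F \<in> lObj A" "G \<in> lObj A" for F G
    using that PiE_mem[OF PiE_mem[OF Hom that(1)] that(2)] by (intro frame_mapI A.frame_hom B.frame_hom o)
  show ?thesis
  proof (intro enriched_functor.intro A.is_localic_category B.is_localic_category, unfold_locales)
    fix F H G u assume obj: "F \<in> lObj A" "H \<in> lObj A" "G \<in> lObj A"
      and u: "u \<in> carrier (lHom B (eOb P F) (eOb P G))"
    note t = B.tensor_map_mul'[OF o[OF obj(1)] o[OF obj(2)] o[OF obj(3)] h[OF obj(1,2)] h[OF obj(2,3)]]
    show "tensor_map (lHom B (eOb P F) (eOb P H)) (lHom B (eOb P H) (eOb P G)) (lHom A F H) (lHom A H G)
        (eHom P F H) (eHom P H G) (lMul B (eOb P F) (eOb P H) (eOb P G) u) = lMul A F H G (eHom P F G u)"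
    proof (rule B.hom_ext[OF o[OF obj(1)] o[OF obj(3)] t(1) frame_map_comp[OF h[OF obj(1,3)] A.mul_map[OF obj]] _ u])
      fix j x y assume j: "j \<in> K'" "x \<in> S' (eOb P F) j" "y \<in> S' (eOb P G) j"
      show "tensor_map (lHom B (eOb P F) (eOb P H)) (lHom B (eOb P H) (eOb P G)) (lHom A F H) (lHom A H G)
          (eHom P F H) (eHom P H G) (lMul B (eOb P F) (eOb P H) (eOb P G) (B.e (eOb P F) (eOb P G) j x y)) =
        lMul A F H G (eHom P F G (B.e (eOb P F) (eOb P G) j x y))"
        unfolding t(2)[OF j] using j obj by (simp add: S gen A.mul_gen \<sigma> cong: image_cong)
    qed
  next
    fix F u assume obj: "F \<in> lObj A" and u: "u \<in> carrier (lHom B (eOb P F) (eOb P F))"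
    show "lUnit A F (eHom P F F u) = lUnit B (eOb P F) u"
      by (rule B.hom_ext[OF o[OF obj] o[OF obj] frame_map_comp[OF h[OF obj obj] A.unit_map[OF obj]] B.unit_map[OF o[OF obj]] _ u])
        (use obj o in \<open>simp add: S gen \<sigma> A.unit_gen B.unit_gen\<close>)
  qed (fact Ob Hom)+
qed

section \<open>The enriched categories of sets and of functors\<close>

text \<open>The matrices are moved into the coproduct by the two coprojections and multiplied there;
  \<open>tens_eq_meet\<close> then turns meets of entries into tensors.\<close>

lemma (in frame_pair) tens_functional:
  assumes \<alpha>: "functional L X Z \<alpha>" and \<beta>: "functional M Z Y \<beta>"
  shows "functional (L \<otimes> M) X Y (\<lambda>x y. \<Squnion>\<^bsub>L \<otimes> M\<^esub>((\<lambda>z. tens L M (\<alpha> x z) (\<beta> z y)) ` Z))"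
proof -
  interpret T: frame "L \<otimes> M" unfolding frame_def by (rule tensor_frame)
  show ?thesis
    by (rule functional_cong[OF T.functional_comp[OF functional_map[OF inl_map \<alpha>] functional_map[OF inr_map \<beta>]]])
      (intro Sup_image_cong tens_eq_meet[symmetric] functionalD(1)[OF \<alpha>] functionalD(1)[OF \<beta>])
qed

text \<open>A transposed product is the product of the transposes in reverse order, so the right
  coprojection comes first and \<open>meet_comm\<close> restores the order of the factors.\<close>

lemma (in frame_pair) tens_functional_converse:
  assumes \<alpha>: "functional L Z X (\<lambda>z x. \<alpha> x z)" and \<beta>: "functional M Y Z (\<lambda>y z. \<beta> z y)"
  shows "functional (L \<otimes> M) Y X (\<lambda>y x. \<Squnion>\<^bsub>L \<otimes> M\<^esub>((\<lambda>z. tens L M (\<alpha> x z) (\<beta> z y)) ` Z))"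
proof -
  interpret T: frame "L \<otimes> M" unfolding frame_def by (rule tensor_frame)
  show ?thesis
    by (rule functional_cong[OF T.functional_comp[OF functional_map[OF inr_map \<beta>] functional_map[OF inl_map \<alpha>]]])
      (intro Sup_image_cong trans[OF meet_comm tens_eq_meet[symmetric]] functionalD(1)[OF \<alpha>] functionalD(1)[OF \<beta>])
qed

lemma set_functor_maps:
  assumes F: "F \<in> set_functors C" and f: "X \<in> Ob C" "Y \<in> Ob C" "f \<in> Mor C X Y"
  shows "fMor F X Y f \<in> fOb F X \<rightarrow>\<^sub>E fOb F Y"
proof -
  have F: "cat_functor C set_cat F" using F by (simp add: functor_cat_def)
  show ?thesis
    using PiE_mem[OF PiE_mem[OF PiE_mem[OF cat_functor.fMor_closed[OF F] f(1)] f(2)] f(3)]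
    by (simp add: set_cat_def)
qed

lemma set_functor_closed:
  assumes "F \<in> set_functors C" "X \<in> Ob C" "Y \<in> Ob C" "f \<in> Mor C X Y" "x \<in> fOb F X"
  shows "fMor F X Y f x \<in> fOb F Y"
  using PiE_mem[OF set_functor_maps[OF assms(1-4)] assms(5)] .

text \<open>Column conditions and statements about inverses are guarded by \<open>b\<close>, so that
  the remaining arguments serve both presentations at once.\<close>

locale bij_or_func =
  fixes R :: "'v set_pres" and b :: bool
  assumes R: "R = (if b then lBij else lFunc)"
begin

lemma wf_R: "wf_presentation (R X Y)"
  by (simp add: R wf_lFunc wf_lBij)

lemma gens_R: "gens (R X Y) = X \<times> Y"
  by (simp add: R gens_lFunc gens_lBij)

lemma frame_R: "frame_lattice (presented (R X Y))"
  by (rule presented_frame[OF wf_R])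

lemma satisfies_R:
  assumes "frame_lattice N"
  shows "satisfies (R X Y) N f \<longleftrightarrow>
    functional N X Y (\<lambda>x y. f (x, y)) \<and> (b \<longrightarrow> functional N Y X (\<lambda>y x. f (x, y)))"
proof -
  interpret frame N unfolding frame_def by (rule assms)
  show ?thesis by (simp add: R satisfies_lFunc satisfies_lBij)
qed

text \<open>The generators form the universal matrix, since they satisfy their own
  relations.\<close>

lemma gen_functional:
  "functional (presented (R X Y)) X Y (\<lambda>x y. gen (R X Y) (x, y))"
  "b \<Longrightarrow> functional (presented (R X Y)) Y X (\<lambda>y x. gen (R X Y) (x, y))"
  using gen_satisfies[OF wf_R, of X Y] satisfies_R[OF frame_R] by auto

text \<open>The prescribed values form the product of two universal matrices. It is functional, and
  so is its transpose when \<open>b\<close> holds, hence \<open>gen_hom\<close> takes these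
  values.\<close>

lemma set_mult:
  shows "set_mult R X Z Y \<in> frame_homs (presented (R X Y)) (presented (R X Z) \<otimes> presented (R Z Y))"
    and "\<lbrakk>x \<in> X; y \<in> Y\<rbrakk> \<Longrightarrow> set_mult R X Z Y (gen (R X Y) (x, y)) =
      \<Squnion>\<^bsub>presented (R X Z) \<otimes> presented (R Z Y)\<^esub>((\<lambda>z. tens (presented (R X Z)) (presented (R Z Y))
        (gen (R X Z) (x, z)) (gen (R Z Y) (z, y))) ` Z)"
proof -
  interpret D: frame_pair "presented (R X Z)" "presented (R Z Y)" by (intro frame_pairI frame_R)
  have "satisfies (R X Y) (presented (R X Z) \<otimes> presented (R Z Y))
      (\<lambda>(x, y). \<Squnion>\<^bsub>presented (R X Z) \<otimes> presented (R Z Y)\<^esub>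
        {tens (presented (R X Z)) (presented (R Z Y)) (gen (R X Z) (x, z)) (gen (R Z Y) (z, y)) | z. z \<in> Z})"
    unfolding satisfies_R[OF D.tensor_frame] Setcompr_eq_image prod.case
    using D.tens_functional[OF gen_functional(1) gen_functional(1)]
      D.tens_functional_converse[of Z X "\<lambda>x z. gen (R X Z) (x, z)", OF gen_functional(2) gen_functional(2)]
    by blast
  note h = gen_hom[OF wf_R D.tensor_frame this, folded set_mult_def]
  show "set_mult R X Z Y \<in> frame_homs (presented (R X Y)) (presented (R X Z) \<otimes> presented (R Z Y))"
    by (rule h(1))
  show "set_mult R X Z Y (gen (R X Y) (x, y)) =
      \<Squnion>\<^bsub>presented (R X Z) \<otimes> presented (R Z Y)\<^esub>((\<lambda>z. tens (presented (R X Z)) (presented (R Z Y))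
        (gen (R X Z) (x, z)) (gen (R Z Y) (z, y))) ` Z)" if "x \<in> X" "y \<in> Y"
    using h(2)[of "(x, y)"] that by (simp add: gens_R Setcompr_eq_image)
qed

lemma set_mult_map:
  "frame_map (presented (R X Y)) (presented (R X Z) \<otimes> presented (R Z Y)) (set_mult R X Z Y)"
  by (intro frame_mapI frame_R frame_pair.tensor_frame[OF frame_pairI] set_mult(1))

text \<open>Equality is the graph of the identity function and is its own transpose.\<close>

lemma set_unit:
  shows "set_unit R X \<in> frame_homs (presented (R X X)) two"
    and "\<lbrakk>x \<in> X; y \<in> X\<rbrakk> \<Longrightarrow> set_unit R X (gen (R X X) (x, y)) \<longleftrightarrow> x = y"
proof -
  have "satisfies (R X X) two (\<lambda>(x, y). x = y)"
    unfolding satisfies_R[OF two_frame] functional_two_iff prod.case by blast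
  note h = gen_hom[OF wf_R two_frame this, folded set_unit_def]
  show "set_unit R X \<in> frame_homs (presented (R X X)) two" by (rule h(1))
  show "set_unit R X (gen (R X X) (x, y)) \<longleftrightarrow> x = y" if "x \<in> X" "y \<in> X"
    using h(2)[of "(x, y)"] that by (simp add: gens_R)
qed

text \<open>Transposition exchanges row and column conditions, so both kinds are called upon; this
  is where \<open>b\<close> enters.\<close>

lemma set_inv:
  assumes b
  shows "set_inv R X Y \<in> frame_homs (presented (R X Y)) (presented (R Y X))"
    and "\<lbrakk>x \<in> X; y \<in> Y\<rbrakk> \<Longrightarrow> set_inv R X Y (gen (R X Y) (x, y)) = gen (R Y X) (y, x)"
proof -
  have "satisfies (R X Y) (presented (R Y X)) (\<lambda>(x, y). gen (R Y X) (y, x))"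
    unfolding satisfies_R[OF frame_R] prod.case
    using gen_functional(1) gen_functional(2)[OF assms] by blast
  note h = gen_hom[OF wf_R frame_R this, folded set_inv_def]
  show "set_inv R X Y \<in> frame_homs (presented (R X Y)) (presented (R Y X))" by (rule h(1))
  show "set_inv R X Y (gen (R X Y) (x, y)) = gen (R Y X) (y, x)" if "x \<in> X" "y \<in> Y"
    using h(2)[of "(x, y)"] that by (simp add: gens_R)
qed

lemma sets_matrix: "matrix_lcat (enriched_sets R) R {()} (\<lambda>X _. X) (\<lambda>_ x y. (x, y))"
  by unfold_locales (auto simp: enriched_sets_def wf_R gens_R set_mult set_unit)

section \<open>The locales of natural relations between two functors\<close>

lemma wf_nat: "\<lbrakk>F \<in> set_functors C; G \<in> set_functors C\<rbrakk> \<Longrightarrow> wf_presentation (nat_pres R C F G)"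
  by (rule wf_nat_pres[OF wf_R gens_R])

lemma frame_nat: "\<lbrakk>F \<in> set_functors C; G \<in> set_functors C\<rbrakk> \<Longrightarrow> frame_lattice (nat_loc R C F G)"
  by (rule presented_frame[OF wf_nat])

text \<open>The relations consist of a copy of those of \<open>R\<close> at each object and of
  naturality, whose two sides are single generators; a model is thus a natural family of
  models.\<close>

lemma satisfies_nat_iff:
  assumes N: "frame_lattice N" and F: "F \<in> set_functors C" and G: "G \<in> set_functors C"
  shows "satisfies (nat_pres R C F G) N \<phi> \<longleftrightarrow>
    (\<forall>X\<in>Ob C. satisfies (R (fOb F X) (fOb G X)) N (\<lambda>p. \<phi> (X, p))) \<and>
    (\<forall>X\<in>Ob C. \<forall>Y\<in>Ob C. \<forall>f\<in>Mor C X Y. \<forall>x\<in>fOb F X. \<forall>y\<in>fOb G X.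
      \<phi> (X, x, y) \<sqsubseteq>\<^bsub>N\<^esub> \<phi> (Y, fMor F X Y f x, fMor G X Y f y))"
proof -
  interpret N: frame_lattice N by fact
  let ?sat = "\<lambda>S. \<forall>(a, B)\<in>S. \<Sqinter>\<^bsub>N\<^esub>(\<phi> ` a) \<sqsubseteq>\<^bsub>N\<^esub> \<Squnion>\<^bsub>N\<^esub>((\<lambda>b. \<Sqinter>\<^bsub>N\<^esub>(\<phi> ` b)) ` B)"
  let ?nat = "{({(X, x, y)}, {{(Y, fMor F X Y f x, fMor G X Y f y)}}) | X Y f x y.
         X \<in> Ob C \<and> Y \<in> Ob C \<and> f \<in> Mor C X Y \<and> x \<in> fOb F X \<and> y \<in> fOb G X}"
  let ?rel = "{(Pair X ` a, (\<lambda>b. Pair X ` b) ` B) | X a B.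
         X \<in> Ob C \<and> (a, B) \<in> rels (R (fOb F X) (fOb G X))}"
  have dom: "\<phi> \<in> gens (nat_pres R C F G) \<rightarrow> carrier N \<longleftrightarrow>
      (\<forall>X\<in>Ob C. (\<lambda>p. \<phi> (X, p)) \<in> gens (R (fOb F X) (fOb G X)) \<rightarrow> carrier N)"
    by (auto simp: nat_pres_def gens_R Pi_def)
  have rel: "?sat ?rel \<longleftrightarrow> (\<forall>X\<in>Ob C. \<forall>(a, B)\<in>rels (R (fOb F X) (fOb G X)).
      \<Sqinter>\<^bsub>N\<^esub>((\<lambda>p. \<phi> (X, p)) ` a) \<sqsubseteq>\<^bsub>N\<^esub> \<Squnion>\<^bsub>N\<^esub>((\<lambda>b. \<Sqinter>\<^bsub>N\<^esub>((\<lambda>p. \<phi> (X, p)) ` b)) ` B))" (is "_ \<longleftrightarrow> ?r")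
  proof
    assume l: "?sat ?rel"
    show ?r
    proof (intro ballI; clarify)
      fix X a B assume "X \<in> Ob C" "(a, B) \<in> rels (R (fOb F X) (fOb G X))"
      then have "(Pair X ` a, (\<lambda>b. Pair X ` b) ` B) \<in> ?rel" by blast
      from bspec[OF l this] show "\<Sqinter>\<^bsub>N\<^esub>((\<lambda>p. \<phi> (X, p)) ` a) \<sqsubseteq>\<^bsub>N\<^esub> \<Squnion>\<^bsub>N\<^esub>((\<lambda>b. \<Sqinter>\<^bsub>N\<^esub>((\<lambda>p. \<phi> (X, p)) ` b)) ` B)"
        by (simp add: image_image)
    qed
  next
    assume r: ?r
    show "?sat ?rel"
    proof clarify
      fix X a B assume "X \<in> Ob C" "(a, B) \<in> rels (R (fOb F X) (fOb G X))"
      from bspec[OF bspec[OF r this(1)] this(2)]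
      show "\<Sqinter>\<^bsub>N\<^esub>(\<phi> ` Pair X ` a) \<sqsubseteq>\<^bsub>N\<^esub> \<Squnion>\<^bsub>N\<^esub>((\<lambda>b. \<Sqinter>\<^bsub>N\<^esub>(\<phi> ` b)) ` (\<lambda>b. Pair X ` b) ` B)"
        by (simp add: image_image)
    qed
  qed
  have nat: "?sat ?nat \<longleftrightarrow> (\<forall>X\<in>Ob C. \<forall>Y\<in>Ob C. \<forall>f\<in>Mor C X Y. \<forall>x\<in>fOb F X. \<forall>y\<in>fOb G X.
      \<phi> (X, x, y) \<sqsubseteq>\<^bsub>N\<^esub> \<phi> (Y, fMor F X Y f x, fMor G X Y f y))"
    if c: "\<phi> \<in> gens (nat_pres R C F G) \<rightarrow> carrier N"
  proof -
    have c: "\<phi> (X, x, y) \<in> carrier N" if "X \<in> Ob C" "x \<in> fOb F X" "y \<in> fOb G X" for X x y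
      using c that by (auto simp: nat_pres_def)
    have "(\<forall>(a, B)\<in>?nat. P a B) \<longleftrightarrow> (\<forall>X\<in>Ob C. \<forall>Y\<in>Ob C. \<forall>f\<in>Mor C X Y. \<forall>x\<in>fOb F X. \<forall>y\<in>fOb G X.
        P {(X, x, y)} {{(Y, fMor F X Y f x, fMor G X Y f y)}})" for P
      by blast
    \<comment> \<open>The functors keep the generator on the right in range, so its singleton
      infimum and supremum collapse.\<close>
    then show ?thesis
      using c set_functor_closed[OF F] set_functor_closed[OF G] by simp
  qed
  have "satisfies (nat_pres R C F G) N \<phi> \<longleftrightarrow>
      \<phi> \<in> gens (nat_pres R C F G) \<rightarrow> carrier N \<and> ?sat ?nat \<and> ?sat ?rel"
    unfolding satisfies_def by (simp only: nat_pres_def presentation.simps ball_Un)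
  then have "satisfies (nat_pres R C F G) N \<phi> \<longleftrightarrow> \<phi> \<in> gens (nat_pres R C F G) \<rightarrow> carrier N \<and> ?r \<and>
      (\<forall>X\<in>Ob C. \<forall>Y\<in>Ob C. \<forall>f\<in>Mor C X Y. \<forall>x\<in>fOb F X. \<forall>y\<in>fOb G X.
        \<phi> (X, x, y) \<sqsubseteq>\<^bsub>N\<^esub> \<phi> (Y, fMor F X Y f x, fMor G X Y f y))"
    using nat rel by argo
  then show ?thesis
    unfolding dom satisfies_def[of "R _ _"] ball_conj_distrib by argo
qed

section \<open>The structure maps of the enriched functor categories\<close>

context
  fixes C :: "('o, 'a) cat"
begin

lemma nat_gen_closed:
  assumes "F \<in> set_functors C" "G \<in> set_functors C" "X \<in> Ob C" "x \<in> fOb F X" "y \<in> fOb G X"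
  shows "gen (nat_pres R C F G) (X, x, y) \<in> carrier (nat_loc R C F G)"
  using pideal_gen(1)[OF wf_nat[OF assms(1,2)], of "(X, x, y)"] assms(3-)
  by (simp add: presented_def) (simp add: nat_pres_def)

lemma nat_gen_natural:
  assumes F: "F \<in> set_functors C" "G \<in> set_functors C"
    and "X \<in> Ob C" "Y \<in> Ob C" "f \<in> Mor C X Y" "x \<in> fOb F X" "y \<in> fOb G X"
  shows "gen (nat_pres R C F G) (X, x, y) \<subseteq> gen (nat_pres R C F G) (Y, fMor F X Y f x, fMor G X Y f y)"
proof -
  have "le (nat_loc R C F G) = (\<subseteq>)" by (simp add: presented_def)
  then show ?thesis
    using gen_satisfies[OF wf_nat[OF F]] assms unfolding satisfies_nat_iff[OF frame_nat[OF F] F] by simp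
qed

lemma nat_gen_functional:
  assumes F: "F \<in> set_functors C" "G \<in> set_functors C" and X: "X \<in> Ob C"
  shows "functional (nat_loc R C F G) (fOb F X) (fOb G X) (\<lambda>x y. gen (nat_pres R C F G) (X, x, y))"
    "b \<Longrightarrow> functional (nat_loc R C F G) (fOb G X) (fOb F X) (\<lambda>y x. gen (nat_pres R C F G) (X, x, y))"
  using gen_satisfies[OF wf_nat[OF F]] X
  unfolding satisfies_nat_iff[OF frame_nat[OF F] F] satisfies_R[OF frame_nat[OF F]] by auto

lemma lam_map:
  assumes "F \<in> set_functors C" "G \<in> set_functors C" "X \<in> Ob C"
  shows "frame_map (presented (R (fOb F X) (fOb G X))) (nat_loc R C F G) (lam R C X F G)"
  by (rule frame_mapI[OF frame_R frame_nat[OF assms(1,2)] lam(1)[OF wf_R gens_R assms]])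

lemmas lam_gen = lam(2)[OF wf_R gens_R]

text \<open>A frame map out of \<open>presented (R (fOb F X) (fOb G X))\<close> respects the
  relations of \<open>R\<close> automatically, so for a family of such maps only naturality on
  generators remains. Multiplication, unit and inverse are all obtained in this way.\<close>

lemma satisfies_nat_homs:
  assumes N: "frame_lattice N" and F: "F \<in> set_functors C" "G \<in> set_functors C"
    and h: "\<And>X. X \<in> Ob C \<Longrightarrow> frame_map (presented (R (fOb F X) (fOb G X))) N (h X)"
    and nat: "\<And>X Y f x y. \<lbrakk>X \<in> Ob C; Y \<in> Ob C; f \<in> Mor C X Y; x \<in> fOb F X; y \<in> fOb G X\<rbrakk> \<Longrightarrow>
      h X (gen (R (fOb F X) (fOb G X)) (x, y)) \<sqsubseteq>\<^bsub>N\<^esub>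
      h Y (gen (R (fOb F Y) (fOb G Y)) (fMor F X Y f x, fMor G X Y f y))"
  shows "satisfies (nat_pres R C F G) N (\<lambda>(X, x, y). h X (gen (R (fOb F X) (fOb G X)) (x, y)))"
proof -
  have "(\<lambda>p. case (X, p) of (X, x, y) \<Rightarrow> h X (gen (R (fOb F X) (fOb G X)) (x, y))) =
      (\<lambda>p. h X (gen (R (fOb F X) (fOb G X)) p))" for X
    by auto
  then show ?thesis
    unfolding satisfies_nat_iff[OF N F]
    using nat satisfies_map[OF wf_R gen_satisfies[OF wf_R] h] by simp
qed

text \<open>Generators are natural and tensors monotone, so each summand at \<open>X\<close> lies
  below one at \<open>Y\<close>. The second clause is the defining formula through
  \<open>lam_tensor\<close>, the third its matrix form.\<close>

lemma nat_mult:
  assumes F: "F \<in> set_functors C" and H: "H \<in> set_functors C" and G: "G \<in> set_functors C"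
  shows "nat_mult R C F H G \<in> frame_homs (nat_loc R C F G) (nat_loc R C F H \<otimes> nat_loc R C H G)"
    and "\<lbrakk>X \<in> Ob C; x \<in> fOb F X; y \<in> fOb G X\<rbrakk> \<Longrightarrow>
      nat_mult R C F H G (gen (nat_pres R C F G) (X, x, y)) =
        lam_tensor R C X F H G (set_mult R (fOb F X) (fOb H X) (fOb G X) (gen (R (fOb F X) (fOb G X)) (x, y)))"
    and "\<lbrakk>X \<in> Ob C; x \<in> fOb F X; y \<in> fOb G X\<rbrakk> \<Longrightarrow>
      nat_mult R C F H G (gen (nat_pres R C F G) (X, x, y)) =
        \<Squnion>\<^bsub>nat_loc R C F H \<otimes> nat_loc R C H G\<^esub>((\<lambda>z. tens (nat_loc R C F H) (nat_loc R C H G)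
          (gen (nat_pres R C F H) (X, x, z)) (gen (nat_pres R C H G) (X, z, y))) ` fOb H X)"
proof -
  let ?FH = "nat_loc R C F H" and ?HG = "nat_loc R C H G"
  interpret D: frame_pair ?FH ?HG by (intro frame_pairI frame_nat F H G)
  interpret T: frame_lattice "?FH \<otimes> ?HG" by (rule D.tensor_frame)
  let ?h = "\<lambda>X u. lam_tensor R C X F H G (set_mult R (fOb F X) (fOb H X) (fOb G X) u)"
  note tm = tensor_map[OF lam_map[OF F H] lam_map[OF H G], of X X for X, folded lam_tensor_def]
  have h: "frame_map (presented (R (fOb F X) (fOb G X))) (?FH \<otimes> ?HG) (?h X)" if X: "X \<in> Ob C" for X
    by (rule frame_map_comp[OF set_mult_map tm(1)[OF X X]])
  let ?t = "\<lambda>X x y z. tens ?FH ?HG (gen (nat_pres R C F H) (X, x, z)) (gen (nat_pres R C H G) (X, z, y))"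
  \<comment> \<open>\<open>lam_tensor\<close> sends tensors of generators to tensors of generators,
    so the product for sets becomes the matrix product at \<open>X\<close>.\<close>
  have val: "?h X (gen (R (fOb F X) (fOb G X)) (x, y)) = \<Squnion>\<^bsub>?FH \<otimes> ?HG\<^esub>(?t X x y ` fOb H X)"
    if X: "X \<in> Ob C" and xy: "x \<in> fOb F X" "y \<in> fOb G X" for X x y
  proof -
    interpret E: frame_pair "presented (R (fOb F X) (fOb H X))" "presented (R (fOb H X) (fOb G X))"
      by (intro frame_pairI frame_R)
    have c: "gen (R (fOb F X) (fOb H X)) (x, z) \<in> carrier (presented (R (fOb F X) (fOb H X)))"
      "gen (R (fOb H X) (fOb G X)) (z, y) \<in> carrier (presented (R (fOb H X) (fOb G X)))"
      if "z \<in> fOb H X" for z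
      using that xy by (auto intro: functionalD(1)[OF gen_functional(1)])
    show ?thesis
      unfolding set_mult(2)[OF xy]
      by (rule trans[OF frame_map_SUP[OF tm(1)[OF X X]] Sup_image_cong])
        (simp_all add: E.tens(3) c tm(2)[OF X X] lam_gen[OF F H X xy(1)] lam_gen[OF H G X _ xy(2)])
  qed
  have c: "?t X x y z \<in> carrier (?FH \<otimes> ?HG)"
    if "X \<in> Ob C" "x \<in> fOb F X" "y \<in> fOb G X" "z \<in> fOb H X" for X x y z
    using that F H G by (intro D.tens(3) nat_gen_closed)
  have "satisfies (nat_pres R C F G) (?FH \<otimes> ?HG) (\<lambda>(X, x, y). ?h X (gen (R (fOb F X) (fOb G X)) (x, y)))"
  proof (rule satisfies_nat_homs[OF D.tensor_frame F G h])
    fix X Y f x y assume a: "X \<in> Ob C" "Y \<in> Ob C" "f \<in> Mor C X Y" "x \<in> fOb F X" "y \<in> fOb G X"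
    note fx = set_functor_closed[OF F a(1-4)] and fy = set_functor_closed[OF G a(1-3,5)]
    have "\<Squnion>\<^bsub>?FH \<otimes> ?HG\<^esub>(?t X x y ` fOb H X) \<sqsubseteq>\<^bsub>?FH \<otimes> ?HG\<^esub>
        \<Squnion>\<^bsub>?FH \<otimes> ?HG\<^esub>(?t Y (fMor F X Y f x) (fMor G X Y f y) ` fOb H Y)"
    proof (rule T.SUP_le_SUP)
      fix z assume z: "z \<in> fOb H X"
      note fz = set_functor_closed[OF H a(1-3) z]
      have le: "le ?FH = (\<subseteq>)" "le ?HG = (\<subseteq>)" by (simp_all add: presented_def)
      \<comment> \<open>The summand at \<open>Y\<close> that bounds the one for \<open>z\<close> is
        indexed by \<open>fMor H X Y f z\<close>.\<close>
      have "?t X x y z \<subseteq> ?t Y (fMor F X Y f x) (fMor G X Y f y) (fMor H X Y f z)"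
        by (rule D.tens_mono[OF nat_gen_closed[OF F H a(1,4) z] nat_gen_closed[OF H G a(1) z a(5)]
              nat_gen_closed[OF F H a(2) fx fz] nat_gen_closed[OF H G a(2) fz fy], unfolded le,
              OF nat_gen_natural[OF F H a(1-4) z] nat_gen_natural[OF H G a(1-3) z a(5)]])
      then show "\<exists>w\<in>fOb H Y. ?t X x y z \<sqsubseteq>\<^bsub>?FH \<otimes> ?HG\<^esub> ?t Y (fMor F X Y f x) (fMor G X Y f y) w"
        unfolding D.tensor_le using fz by blast
    qed (use a fx fy c in auto)
    then show "?h X (gen (R (fOb F X) (fOb G X)) (x, y)) \<sqsubseteq>\<^bsub>?FH \<otimes> ?HG\<^esub>
        ?h Y (gen (R (fOb F Y) (fOb G Y)) (fMor F X Y f x, fMor G X Y f y))"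
      unfolding val[OF a(1,4,5)] val[OF a(2) fx fy] .
  qed
  note g = gen_hom[OF wf_nat[OF F G] D.tensor_frame this, folded nat_mult_def]
  show "nat_mult R C F H G \<in> frame_homs (nat_loc R C F G) (?FH \<otimes> ?HG)" by (rule g(1))
  assume X: "X \<in> Ob C" "x \<in> fOb F X" "y \<in> fOb G X"
  show *: "nat_mult R C F H G (gen (nat_pres R C F G) (X, x, y)) = ?h X (gen (R (fOb F X) (fOb G X)) (x, y))"
    using g(2)[of "(X, x, y)"] X by (simp add: nat_pres_def)
  show "nat_mult R C F H G (gen (nat_pres R C F G) (X, x, y)) = \<Squnion>\<^bsub>?FH \<otimes> ?HG\<^esub>(?t X x y ` fOb H X)"
    using * val[OF X] by simp
qed

text \<open>Naturality says here that \<open>x = y\<close> implies equality of the images under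
  \<open>F f\<close>.\<close>

lemma nat_unit:
  assumes F: "F \<in> set_functors C"
  shows "nat_unit R C F \<in> frame_homs (nat_loc R C F F) two"
    and "\<lbrakk>X \<in> Ob C; x \<in> fOb F X; y \<in> fOb F X\<rbrakk> \<Longrightarrow>
      nat_unit R C F (gen (nat_pres R C F F) (X, x, y)) \<longleftrightarrow>
      set_unit R (fOb F X) (gen (R (fOb F X) (fOb F X)) (x, y))"
proof -
  have "satisfies (nat_pres R C F F) two (\<lambda>(X, x, y). set_unit R (fOb F X) (gen (R (fOb F X) (fOb F X)) (x, y)))"
  proof (rule satisfies_nat_homs[OF two_frame F F])
    show "frame_map (presented (R (fOb F X) (fOb F X))) two (set_unit R (fOb F X))" for X
      by (rule frame_mapI[OF frame_R two_frame set_unit(1)])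
  qed (simp add: two_simps set_unit(2) set_functor_closed[OF F])
  note g = gen_hom[OF wf_nat[OF F F] two_frame this, folded nat_unit_def]
  show "nat_unit R C F \<in> frame_homs (nat_loc R C F F) two" by (rule g(1))
  show "nat_unit R C F (gen (nat_pres R C F F) (X, x, y)) \<longleftrightarrow>
      set_unit R (fOb F X) (gen (R (fOb F X) (fOb F X)) (x, y))"
    if "X \<in> Ob C" "x \<in> fOb F X" "y \<in> fOb F X"
    using g(2)[of "(X, x, y)"] that by (simp add: nat_pres_def)
qed

text \<open>Naturality of the inverse is that of the generators for \<open>G\<close> and
  \<open>F\<close>, with the two arguments exchanged.\<close>

lemma nat_inv:
  assumes F: "F \<in> set_functors C" and G: "G \<in> set_functors C" and b
  shows "nat_inv R C F G \<in> frame_homs (nat_loc R C F G) (nat_loc R C G F)"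
    and "\<lbrakk>X \<in> Ob C; x \<in> fOb F X; y \<in> fOb G X\<rbrakk> \<Longrightarrow>
      nat_inv R C F G (gen (nat_pres R C F G) (X, x, y)) =
      lam R C X G F (set_inv R (fOb F X) (fOb G X) (gen (R (fOb F X) (fOb G X)) (x, y)))"
    and "\<lbrakk>X \<in> Ob C; x \<in> fOb F X; y \<in> fOb G X\<rbrakk> \<Longrightarrow>
      nat_inv R C F G (gen (nat_pres R C F G) (X, x, y)) = gen (nat_pres R C G F) (X, y, x)"
proof -
  have val: "lam R C X G F (set_inv R (fOb F X) (fOb G X) (gen (R (fOb F X) (fOb G X)) (x, y))) =
      gen (nat_pres R C G F) (X, y, x)" if "X \<in> Ob C" "x \<in> fOb F X" "y \<in> fOb G X" for X x y
    using that by (simp add: set_inv(2)[OF \<open>b\<close>] lam_gen[OF G F])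
  have le: "le (nat_loc R C G F) = (\<subseteq>)" by (simp add: presented_def)
  have "satisfies (nat_pres R C F G) (nat_loc R C G F) (\<lambda>(X, x, y). lam R C X G F
      (set_inv R (fOb F X) (fOb G X) (gen (R (fOb F X) (fOb G X)) (x, y))))"
  proof (rule satisfies_nat_homs[OF frame_nat[OF G F] F G])
    show "frame_map (presented (R (fOb F X) (fOb G X))) (nat_loc R C G F)
        (\<lambda>u. lam R C X G F (set_inv R (fOb F X) (fOb G X) u))" if "X \<in> Ob C" for X
      by (rule frame_map_comp[OF frame_mapI[OF frame_R frame_R set_inv(1)[OF \<open>b\<close>]] lam_map[OF G F that]])
  qed (use nat_gen_natural[OF G F] in \<open>simp add: le val set_functor_closed[OF F] set_functor_closed[OF G]\<close>)
  note g = gen_hom[OF wf_nat[OF F G] frame_nat[OF G F] this, folded nat_inv_def]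
  show "nat_inv R C F G \<in> frame_homs (nat_loc R C F G) (nat_loc R C G F)" by (rule g(1))
  assume X: "X \<in> Ob C" "x \<in> fOb F X" "y \<in> fOb G X"
  show *: "nat_inv R C F G (gen (nat_pres R C F G) (X, x, y)) =
      lam R C X G F (set_inv R (fOb F X) (fOb G X) (gen (R (fOb F X) (fOb G X)) (x, y)))"
    using g(2)[of "(X, x, y)"] X by (simp add: nat_pres_def)
  show "nat_inv R C F G (gen (nat_pres R C F G) (X, x, y)) = gen (nat_pres R C G F) (X, y, x)"
    using * val[OF X] by simp
qed

lemma functors_matrix:
  "matrix_lcat (enriched_functors R C) (nat_pres R C) (Ob C) fOb (\<lambda>X x y. (X, x, y))"
proof -
  have "gens (nat_pres R C F G) = {(X, x, y) | X x y. X \<in> Ob C \<and> x \<in> fOb F X \<and> y \<in> fOb G X}" for F G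
    by (auto simp: nat_pres_def)
  then show ?thesis
    by unfold_locales (auto simp: enriched_functors_def wf_nat nat_mult(1,3) nat_unit set_unit(2))
qed

lemma functors_groupoid:
  assumes b
  shows "localic_groupoid (enriched_functors R C) (nat_inv R C)"
proof (rule matrix_lcat.is_localic_groupoid[OF functors_matrix])
qed (use nat_inv[OF _ _ assms] nat_gen_functional assms in \<open>simp_all add: enriched_functors_def\<close>)

lemma ev_enriched:
  assumes X: "X \<in> Ob C"
  shows "enriched_functor (enriched_functors R C) (enriched_sets R) (ev R C X)"
proof (rule matrix_enriched_functor[OF functors_matrix sets_matrix, where \<sigma> = "\<lambda>_. X"])
  show "eHom (ev R C X) \<in> (\<Pi>\<^sub>E F\<in>lObj (enriched_functors R C). \<Pi>\<^sub>E G\<in>lObj (enriched_functors R C).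
    frame_homs (lHom (enriched_sets R) (eOb (ev R C X) F) (eOb (ev R C X) G)) (lHom (enriched_functors R C) F G))"
    using lam(1)[OF wf_R gens_R _ _ X]
    by (auto simp: ev_def enriched_functors_def enriched_sets_def PiE_iff)
qed (use X lam_gen[OF _ _ X] in \<open>auto simp: ev_def enriched_functors_def enriched_sets_def\<close>)

end

end

section \<open>The two instances, and evaluation from bijections to functions\<close>

interpretation func: bij_or_func lFunc False
  by unfold_locales simp

interpretation bij: bij_or_func lBij True
  by unfold_locales simp

text \<open>The quotient from \<open>lFunc\<close> to \<open>lBij\<close> followed by
  \<open>lam\<close> sends generators to generators, so the composite is checked as a single functor
  between matrix categories.\<close>

lemma ev_bij_enriched:
  fixes C :: "('o, 'a) cat"
  assumes X: "X \<in> Ob C"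
  shows "enriched_functor (enriched_functors (lBij :: 'v set_pres) C) (enriched_sets lFunc) (ev_bij C X)"
    and "\<lbrakk>F \<in> set_functors C; G \<in> set_functors C; x \<in> fOb F X; y \<in> fOb G X\<rbrakk> \<Longrightarrow>
      eHom (ev_bij C X) F G (gen (lFunc (fOb F X) (fOb G X)) (x, y :: 'v)) = gen (nat_pres lBij C F G) (X, x, y)"
    and "F \<in> set_functors C \<Longrightarrow> eOb (ev_bij C X) F = (fOb F X :: 'v set)"
proof -
  let ?q = "\<lambda>(U :: 'v set) V. gen_hom (lFunc U V) (presented (lBij U V)) (gen (lBij U V))"
  \<comment> \<open>The relations of \<open>lBij\<close> include those of \<open>lFunc\<close>, so
    the generators of \<open>lBij\<close> are a model of the latter.\<close>
  have sat: "satisfies (lFunc U V) (presented (lBij U V)) (gen (lBij U V))" for U V :: "'v set"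
    unfolding func.satisfies_R[OF bij.frame_R] using bij.gen_functional(1) by simp
  note q = gen_hom[OF wf_lFunc bij.frame_R sat]
  show ob: "eOb (ev_bij C X) F = (fOb F X :: 'v set)" if "F \<in> set_functors C" for F
    using that by (simp add: ev_bij_def efunct_comp_def bij_incl_def ev_def enriched_functors_def compose_def)
  have hm: "eHom (ev_bij C X) F G = compose (carrier (presented (lFunc (fOb F X) (fOb G X))))
      (lam lBij C X F G) (?q (fOb F X) (fOb G X))"
    if "F \<in> set_functors C" "G \<in> set_functors C" for F G :: "('o, 'a, 'v) set_funct"
    using that by (simp add: ev_bij_def efunct_comp_def bij_incl_def ev_def enriched_functors_def enriched_sets_def)
  have hom: "eHom (ev_bij C X) F G \<in> frame_homs (presented (lFunc (fOb F X) (fOb G X))) (nat_loc lBij C F G)"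
    if F: "F \<in> set_functors C" "G \<in> set_functors C" for F G :: "('o, 'a, 'v) set_funct"
    unfolding hm[OF F] compose_def
    by (rule frame_map_restrict[OF frame_map_comp[OF frame_mapI[OF func.frame_R bij.frame_R q(1)] bij.lam_map[OF F X]]])
  show gen: "eHom (ev_bij C X) F G (gen (lFunc (fOb F X) (fOb G X)) (x, y :: 'v)) = gen (nat_pres lBij C F G) (X, x, y)"
    if "F \<in> set_functors C" "G \<in> set_functors C" "x \<in> fOb F X" "y \<in> fOb G X" for F G x y
    using that functionalD(1)[OF func.gen_functional(1) that(3,4)]
    by (simp add: hm compose_def q(2) gens_lFunc bij.lam_gen[OF that(1,2) X])
  have ext: "eOb (ev_bij C X) \<in> extensional (set_functors C :: ('o, 'a, 'v) set_funct set)"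
    "eHom (ev_bij C X) \<in> extensional (set_functors C :: ('o, 'a, 'v) set_funct set)"
    "F \<in> set_functors C \<Longrightarrow> eHom (ev_bij C X) F \<in> extensional (set_functors C)"
    for F :: "('o, 'a, 'v) set_funct"
    by (simp_all add: ev_bij_def efunct_comp_def enriched_functors_def)
  show "enriched_functor (enriched_functors (lBij :: 'v set_pres) C) (enriched_sets lFunc) (ev_bij C X)"
  proof (rule matrix_enriched_functor[OF bij.functors_matrix func.sets_matrix, where \<sigma> = "\<lambda>_. X"])
    show "eOb (ev_bij C X) \<in> lObj (enriched_functors (lBij :: 'v set_pres) C) \<rightarrow>\<^sub>E lObj (enriched_sets lFunc)"
      using ext(1) by (simp add: enriched_functors_def enriched_sets_def PiE_iff)
    show "eHom (ev_bij C X) \<in> (\<Pi>\<^sub>E F\<in>lObj (enriched_functors (lBij :: 'v set_pres) C). \<Pi>\<^sub>E G\<in>lObj (enriched_functors lBij C).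
      frame_homs (lHom (enriched_sets lFunc) (eOb (ev_bij C X) F) (eOb (ev_bij C X) G)) (lHom (enriched_functors lBij C) F G))"
      by (intro PiE_I) (use ext(2,3) hom in \<open>simp_all add: ob enriched_functors_def enriched_sets_def extensional_def\<close>)
  qed (use X gen in \<open>simp_all add: ob enriched_functors_def\<close>)
qed

section \<open>Points of the hom-spaces\<close>

lemma function_point:
  assumes "f \<in> X \<rightarrow> Y"
  shows "function_point X Y f \<in> frame_homs (presented (lFunc X Y)) two"
    and "\<lbrakk>x \<in> X; y \<in> Y\<rbrakk> \<Longrightarrow> function_point X Y f (gen (lFunc X Y) (x, y)) \<longleftrightarrow> f x = y"
proof -
  have "satisfies (lFunc X Y) two (\<lambda>(x, y). f x = y)"
    unfolding func.satisfies_R[OF two_frame] functional_two_iff using assms by auto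
  note g = gen_hom[OF wf_lFunc two_frame this, folded function_point_def]
  show "function_point X Y f \<in> frame_homs (presented (lFunc X Y)) two" by (rule g(1))
  show "function_point X Y f (gen (lFunc X Y) (x, y)) \<longleftrightarrow> f x = y" if "x \<in> X" "y \<in> Y"
    using g(2)[of "(x, y)"] that by (simp add: gens_lFunc)
qed

context
  fixes C :: "('o, 'a) cat" and F G :: "('o, 'a, 'v) set_funct"
  assumes F: "F \<in> set_functors C" and G: "G \<in> set_functors C"
begin

lemma nat_transf_iff:
  "t \<in> Mor (functor_cat C set_cat) F G \<longleftrightarrow> t \<in> (\<Pi>\<^sub>E X\<in>Ob C. fOb F X \<rightarrow>\<^sub>E fOb G X) \<and>
    (\<forall>X\<in>Ob C. \<forall>Y\<in>Ob C. \<forall>f\<in>Mor C X Y. \<forall>x\<in>fOb F X.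
      fMor G X Y f (t X x) = t Y (fMor F X Y f x))"
  by (auto simp: functor_cat_def set_cat_def compose_def restrict_def fun_eq_iff)

text \<open>If \<open>t X x = y\<close>, naturality of \<open>t\<close> gives
  \<open>t Y (F f x) = G f y\<close>, which is the naturality relation for the graphs of the
  components.\<close>

lemma nat_point:
  assumes t: "t \<in> Mor (functor_cat C set_cat) F G"
  shows "nat_point C F G t \<in> frame_homs (nat_loc lFunc C F G) two"
    and "\<lbrakk>X \<in> Ob C; x \<in> fOb F X; y \<in> fOb G X\<rbrakk> \<Longrightarrow>
      nat_point C F G t (gen (nat_pres lFunc C F G) (X, x, y)) \<longleftrightarrow> t X x = y"
proof -
  note t = t[unfolded nat_transf_iff]
  have "satisfies (nat_pres lFunc C F G) two (\<lambda>(X, x, y). t X x = y)"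
    unfolding func.satisfies_nat_iff[OF two_frame F G] func.satisfies_R[OF two_frame]
      functional_two_iff two_simps
    using t by (fastforce simp: PiE_iff)
  note g = gen_hom[OF func.wf_nat[OF F G] two_frame this, folded nat_point_def]
  show "nat_point C F G t \<in> frame_homs (nat_loc lFunc C F G) two" by (rule g(1))
  show "nat_point C F G t (gen (nat_pres lFunc C F G) (X, x, y)) \<longleftrightarrow> t X x = y"
    if "X \<in> Ob C" "x \<in> fOb F X" "y \<in> fOb G X"
    using g(2)[of "(X, x, y)"] that by (simp add: nat_pres_def)
qed

text \<open>A point is a natural family of functional relations over truth values, hence of graphs;
  unique choice recovers the components of the transformation.\<close>

lemma nat_point_bij:
  "bij_betw (nat_point C F G) (Mor (functor_cat C set_cat) F G) (frame_homs (nat_loc lFunc C F G) two)"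
proof (rule bij_betw_imageI)
  interpret A: matrix_lcat "enriched_functors (lFunc :: 'v set_pres) C" "nat_pres lFunc C" "Ob C" fOb "\<lambda>X x y. (X, x, y)"
    by (rule func.functors_matrix)
  have A: "lObj (enriched_functors lFunc C) = (set_functors C :: ('o, 'a, 'v) set_funct set)"
    "lHom (enriched_functors lFunc C) F G = nat_loc lFunc C F G"
    by (simp_all add: enriched_functors_def)
  show "inj_on (nat_point C F G) (Mor (functor_cat C set_cat) F G)"
  proof (rule inj_onI)
    fix s t assume s: "s \<in> Mor (functor_cat C set_cat) F G" and t: "t \<in> Mor (functor_cat C set_cat) F G"
      and eq: "nat_point C F G s = nat_point C F G t"
    note s' = s[unfolded nat_transf_iff, THEN conjunct1] and t' = t[unfolded nat_transf_iff, THEN conjunct1]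
    have "s X x = t X x" if X: "X \<in> Ob C" "x \<in> fOb F X" for X x
    proof -
      \<comment> \<open>Testing both points at the generator with \<open>y = s X x\<close> forces
        the values to agree.\<close>
      have "s X x \<in> fOb G X" using s' X by (auto simp: PiE_iff)
      then show ?thesis
        using nat_point(2)[OF s X, of "s X x"] nat_point(2)[OF t X, of "s X x"] eq by simp
    qed
    then show "s = t"
      using s' t' by (intro PiE_ext[OF s' t'] PiE_ext[of "s _" "fOb F _" "\<lambda>_. fOb G _" "t _"]) auto
  qed
  show "nat_point C F G ` Mor (functor_cat C set_cat) F G = frame_homs (nat_loc lFunc C F G) two"
  proof
    show "nat_point C F G ` Mor (functor_cat C set_cat) F G \<subseteq> frame_homs (nat_loc lFunc C F G) two"
      using nat_point(1) by blast
    show "frame_homs (nat_loc lFunc C F G) two \<subseteq> nat_point C F G ` Mor (functor_cat C set_cat) F G"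
    proof
      fix p assume p: "p \<in> frame_homs (nat_loc lFunc C F G) two"
      define P where "P X x y \<longleftrightarrow> p (gen (nat_pres lFunc C F G) (X, x, y))" for X x y
      have "satisfies (nat_pres lFunc C F G) two (\<lambda>g. p (gen (nat_pres lFunc C F G) g))"
        by (rule satisfies_map[OF func.wf_nat[OF F G] gen_satisfies[OF func.wf_nat[OF F G]]
              frame_mapI[OF func.frame_nat[OF F G] two_frame p]])
      then have fn: "\<And>X x. X \<in> Ob C \<Longrightarrow> x \<in> fOb F X \<Longrightarrow> \<exists>!y. y \<in> fOb G X \<and> P X x y"
        and nat: "\<And>X Y f x y. \<lbrakk>X \<in> Ob C; Y \<in> Ob C; f \<in> Mor C X Y; x \<in> fOb F X; y \<in> fOb G X; P X x y\<rbrakk> \<Longrightarrow>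
          P Y (fMor F X Y f x) (fMor G X Y f y)"
        unfolding func.satisfies_nat_iff[OF two_frame F G] func.satisfies_R[OF two_frame]
          functional_two_iff two_simps P_def by simp_all
      define t where "t = (\<lambda>X\<in>Ob C. \<lambda>x\<in>fOb F X. THE y. y \<in> fOb G X \<and> P X x y)"
      have t: "t X x \<in> fOb G X" "P X x (t X x)" if "X \<in> Ob C" "x \<in> fOb F X" for X x
        using theI'[OF fn[OF that]] that by (simp_all add: t_def)
      have uniq: "t X x = y" if "X \<in> Ob C" "x \<in> fOb F X" "y \<in> fOb G X" "P X x y" for X x y
        using fn[OF that(1,2)] t[OF that(1,2)] that(3,4) by blast
      have tm: "t \<in> Mor (functor_cat C set_cat) F G"
        unfolding nat_transf_iff
      proof (intro conjI ballI)
        show "t \<in> (\<Pi>\<^sub>E X\<in>Ob C. fOb F X \<rightarrow>\<^sub>E fOb G X)"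
          using t(1) by (auto simp: PiE_iff) (auto simp: t_def)
        \<comment> \<open>The naturality relation at \<open>y = t X x\<close> relates
          \<open>F f x\<close> to \<open>G f (t X x)\<close>, and uniqueness identifies the latter
          with the value of \<open>t Y\<close>.\<close>
        show "fMor G X Y f (t X x) = t Y (fMor F X Y f x)"
          if "X \<in> Ob C" "Y \<in> Ob C" "f \<in> Mor C X Y" "x \<in> fOb F X" for X Y f x
          using that t nat by (intro uniq[symmetric] set_functor_closed[OF F] set_functor_closed[OF G]) auto
      qed
      have "nat_point C F G t = p"
      proof (rule A.homs_ext[of F G two])
        show "nat_point C F G t (gen (nat_pres lFunc C F G) (X, x, y)) = p (gen (nat_pres lFunc C F G) (X, x, y))"
          if "X \<in> Ob C" "x \<in> fOb F X" "y \<in> fOb G X" for X x y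
          using nat_point(2)[OF tm that] t[OF that(1,2)] uniq[OF that] P_def by auto
      qed (use F G A p two_frame nat_point(1)[OF tm] in auto)
      then show "p \<in> nat_point C F G ` Mor (functor_cat C set_cat) F G" using tm by blast
    qed
  qed
qed

text \<open>Identifies the action of enriched evaluation on points with ordinary evaluation of
  \<open>t\<close> at \<open>X\<close>; on a generator both sides mean
  \<open>t X x = y\<close>.\<close>

lemma nat_point_lam:
  assumes X: "X \<in> Ob C" and t: "t \<in> Mor (functor_cat C set_cat) F G"
  shows "compose (carrier (presented (lFunc (fOb F X) (fOb G X)))) (nat_point C F G t) (lam lFunc C X F G) =
    function_point (fOb F X) (fOb G X) (t X)"
proof -
  interpret B: matrix_lcat "enriched_sets (lFunc :: 'v set_pres)" lFunc "{()}" "\<lambda>X _. X" "\<lambda>_ x y. (x, y)"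
    by (rule func.sets_matrix)
  have B: "lObj (enriched_sets lFunc) = UNIV" "lHom (enriched_sets lFunc) U V = presented (lFunc U V)" for U V :: "'v set"
    by (simp_all add: enriched_sets_def)
  have tX: "t X \<in> fOb F X \<rightarrow> fOb G X" using t X by (auto simp: nat_transf_iff PiE_iff)
  show ?thesis
  proof (rule B.homs_ext[OF _ _ two_frame, unfolded B])
    show "compose (carrier (presented (lFunc (fOb F X) (fOb G X)))) (nat_point C F G t) (lam lFunc C X F G)
        \<in> frame_homs (presented (lFunc (fOb F X) (fOb G X))) two"
      unfolding compose_def
      by (rule frame_map_restrict[OF frame_map_comp[OF func.lam_map[OF F G X]
            frame_mapI[OF func.frame_nat[OF F G] two_frame nat_point(1)[OF t]]]])
    show "function_point (fOb F X) (fOb G X) (t X) \<in> frame_homs (presented (lFunc (fOb F X) (fOb G X))) two"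
      by (rule function_point(1)[OF tX])
    show "compose (carrier (presented (lFunc (fOb F X) (fOb G X)))) (nat_point C F G t) (lam lFunc C X F G)
        (gen (lFunc (fOb F X) (fOb G X)) (x, y)) =
      function_point (fOb F X) (fOb G X) (t X) (gen (lFunc (fOb F X) (fOb G X)) (x, y))"
      if "x \<in> fOb F X" "y \<in> fOb G X" for x y
      using functionalD(1)[OF func.gen_functional(1) that]
      by (simp add: compose_def func.lam_gen[OF F G X that] function_point(2)[OF tX that] nat_point(2)[OF t X that])
  qed auto
qed

end

section \<open>Ordinary categories\<close>

lemma set_category: "category set_cat"
  by unfold_locales (auto simp: set_cat_def compose_def fun_eq_iff PiE_iff extensional_def restrict_def)

lemma functor_category:
  assumes "category C" "category D"
  shows "category (functor_cat C D)"
proof -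
  interpret D: category D by fact
  have ob: "fOb F X \<in> Ob D" if "F \<in> Ob (functor_cat C D)" "X \<in> Ob C" for F X
    using PiE_mem[OF cat_functor.fOb_closed] that by (fastforce simp: functor_cat_def)
  have mor: "fMor F X Y f \<in> Mor D (fOb F X) (fOb F Y)"
    if "F \<in> Ob (functor_cat C D)" "X \<in> Ob C" "Y \<in> Ob C" "f \<in> Mor C X Y" for F X Y f
  proof -
    have "cat_functor C D F" using that(1) by (simp add: functor_cat_def)
    from PiE_mem[OF PiE_mem[OF PiE_mem[OF cat_functor.fMor_closed[OF this] that(2)] that(3)] that(4)]
    show ?thesis .
  qed
  have trE: "t X \<in> Mor D (fOb F X) (fOb G X)" if "t \<in> Mor (functor_cat C D) F G" "X \<in> Ob C" for t F G X
    using that by (auto simp: functor_cat_def)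
  have ext: "t \<in> extensional (Ob C)" if "t \<in> Mor (functor_cat C D) F G" for t F G
    using that by (auto simp: functor_cat_def PiE_iff)
  have nat: "Cmp D (fOb F X) (fOb G X) (fOb G Y) (fMor G X Y f) (t X) =
      Cmp D (fOb F X) (fOb F Y) (fOb G Y) (t Y) (fMor F X Y f)"
    if "t \<in> Mor (functor_cat C D) F G" "X \<in> Ob C" "Y \<in> Ob C" "f \<in> Mor C X Y" for t F G X Y f
    using that by (auto simp: functor_cat_def)
  have idn: "Idn (functor_cat C D) F = (\<lambda>X\<in>Ob C. Idn D (fOb F X))" for F by (simp add: functor_cat_def)
  have cmp: "Cmp (functor_cat C D) F G H s t = (\<lambda>X\<in>Ob C. Cmp D (fOb F X) (fOb G X) (fOb H X) (s X) (t X))"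
    for F G H s t by (simp add: functor_cat_def)
  have trI: "t \<in> Mor (functor_cat C D) F G"
    if "t \<in> extensional (Ob C)" "\<And>X. X \<in> Ob C \<Longrightarrow> t X \<in> Mor D (fOb F X) (fOb G X)"
      "\<And>X Y f. X \<in> Ob C \<Longrightarrow> Y \<in> Ob C \<Longrightarrow> f \<in> Mor C X Y \<Longrightarrow>
        Cmp D (fOb F X) (fOb G X) (fOb G Y) (fMor G X Y f) (t X) =
        Cmp D (fOb F X) (fOb F Y) (fOb G Y) (t Y) (fMor F X Y f)" for t F G
    using that by (auto simp: functor_cat_def PiE_iff)
  show ?thesis
  proof
    fix F assume F: "F \<in> Ob (functor_cat C D)"
    show "Idn (functor_cat C D) F \<in> Mor (functor_cat C D) F F"
      by (rule trI) (use ob[OF F] mor[OF F] in \<open>simp_all add: idn D.Idn_closed D.Cmp_Idn_left D.Cmp_Idn_right\<close>)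
  next
    fix F G t assume F: "F \<in> Ob (functor_cat C D)" and G: "G \<in> Ob (functor_cat C D)"
      and t: "t \<in> Mor (functor_cat C D) F G"
    show "Cmp (functor_cat C D) F F G t (Idn (functor_cat C D) F) = t"
      "Cmp (functor_cat C D) F G G (Idn (functor_cat C D) G) t = t"
      by (rule extensionalityI[OF _ ext[OF t]];
          simp add: cmp idn D.Cmp_Idn_right D.Cmp_Idn_left ob[OF F] ob[OF G] trE[OF t])+
  next
    fix F G H s t
    assume F: "F \<in> Ob (functor_cat C D)" and G: "G \<in> Ob (functor_cat C D)" and H: "H \<in> Ob (functor_cat C D)"
      and t: "t \<in> Mor (functor_cat C D) F G" and s: "s \<in> Mor (functor_cat C D) G H"
    show "Cmp (functor_cat C D) F G H s t \<in> Mor (functor_cat C D) F H"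
    proof (rule trI)
      fix X Y f assume X: "X \<in> Ob C" and Y: "Y \<in> Ob C" and f: "f \<in> Mor C X Y"
      note o = ob[OF F X] ob[OF G X] ob[OF H X] ob[OF F Y] ob[OF G Y] ob[OF H Y]
      note m = mor[OF F X Y f] mor[OF G X Y f] mor[OF H X Y f] trE[OF t X] trE[OF t Y] trE[OF s X] trE[OF s Y]
      \<comment> \<open>The naturality squares of \<open>s\<close> and \<open>t\<close> are pasted,
        with associativity moving the brackets.\<close>
      have "Cmp D (fOb F X) (fOb H X) (fOb H Y) (fMor H X Y f) (Cmp D (fOb F X) (fOb G X) (fOb H X) (s X) (t X)) =
          Cmp D (fOb F X) (fOb G X) (fOb H Y) (Cmp D (fOb G X) (fOb H X) (fOb H Y) (fMor H X Y f) (s X)) (t X)"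
        using o m by (intro D.Cmp_assoc)
      also have "\<dots> = Cmp D (fOb F X) (fOb G X) (fOb H Y) (Cmp D (fOb G X) (fOb G Y) (fOb H Y) (s Y) (fMor G X Y f)) (t X)"
        using nat[OF s X Y f] by simp
      also have "\<dots> = Cmp D (fOb F X) (fOb G Y) (fOb H Y) (s Y) (Cmp D (fOb F X) (fOb G X) (fOb G Y) (fMor G X Y f) (t X))"
        using o m by (intro D.Cmp_assoc[symmetric])
      also have "\<dots> = Cmp D (fOb F X) (fOb G Y) (fOb H Y) (s Y) (Cmp D (fOb F X) (fOb F Y) (fOb G Y) (t Y) (fMor F X Y f))"
        using nat[OF t X Y f] by simp
      also have "\<dots> = Cmp D (fOb F X) (fOb F Y) (fOb H Y) (Cmp D (fOb F Y) (fOb G Y) (fOb H Y) (s Y) (t Y)) (fMor F X Y f)"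
        using o m by (intro D.Cmp_assoc)
      finally show "Cmp D (fOb F X) (fOb H X) (fOb H Y) (fMor H X Y f) (Cmp (functor_cat C D) F G H s t X) =
          Cmp D (fOb F X) (fOb F Y) (fOb H Y) (Cmp (functor_cat C D) F G H s t Y) (fMor F X Y f)"
        using X Y by (simp add: cmp)
    qed (use ob[OF F] ob[OF G] ob[OF H] trE[OF t] trE[OF s] in \<open>simp_all add: cmp D.Cmp_closed\<close>)
  next
    fix F G H K r s t
    assume "F \<in> Ob (functor_cat C D)" "G \<in> Ob (functor_cat C D)" "H \<in> Ob (functor_cat C D)"
      "K \<in> Ob (functor_cat C D)" "r \<in> Mor (functor_cat C D) F G" "s \<in> Mor (functor_cat C D) G H"
      "t \<in> Mor (functor_cat C D) H K"
    then show "Cmp (functor_cat C D) F H K t (Cmp (functor_cat C D) F G H s r) =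
        Cmp (functor_cat C D) F G K (Cmp (functor_cat C D) G H K t s) r"
      unfolding cmp using ob trE by (intro restrict_ext) (simp add: D.Cmp_assoc)
  qed
qed

text \<open>Transformations compose by transitivity of their inequalities; in a carrier-based order
  this requires the elements compared to lie in the hom-locale.\<close>

lemma enriched_functors_category: "category (enriched_functor_cat A)"
proof -
  let ?D = "enriched_functor_cat A"
  have ob: "P \<in> Ob ?D \<longleftrightarrow> enriched_functor A (enriched_sets lFunc) P" for P
    by (simp add: enriched_functor_cat_def)
  let ?g = "\<lambda>P F G x y. eHom P F G (gen (lFunc (eOb P F) (eOb P G)) (x, y))"
  have mor: "t \<in> Mor ?D P Q \<longleftrightarrow> t \<in> (\<Pi>\<^sub>E F\<in>lObj A. eOb P F \<rightarrow>\<^sub>E eOb Q F) \<and>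
      (\<forall>F\<in>lObj A. \<forall>G\<in>lObj A. \<forall>x\<in>eOb P F. \<forall>y\<in>eOb P G.
        ?g P F G x y \<sqsubseteq>\<^bsub>lHom A F G\<^esub> ?g Q F G (t F x) (t G y))" for t P Q
    by (simp add: enriched_functor_cat_def)
  \<comment> \<open>\<open>A\<close> is an arbitrary record; its hom-locales are known to be frames
    through an object \<open>P\<close>, since \<open>enriched_functor\<close> includes
    \<open>localic_category A\<close>.\<close>
  have frame: "frame_lattice (lHom A F G)" if "P \<in> Ob ?D" "F \<in> lObj A" "G \<in> lObj A" for P F G
  proof -
    interpret enriched_functor A "enriched_sets lFunc" P using that by (simp add: ob)
    show ?thesis using that by (intro A.lHom_frame)
  qed
  have closed: "?g P F G x y \<in> carrier (lHom A F G)"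
    if P: "P \<in> Ob ?D" and F: "F \<in> lObj A" and G: "G \<in> lObj A" and xy: "x \<in> eOb P F" "y \<in> eOb P G" for P F G x y
  proof -
    interpret enriched_functor A "enriched_sets lFunc" P using P by (simp add: ob)
    have "eHom P F G \<in> carrier (presented (lFunc (eOb P F) (eOb P G))) \<rightarrow> carrier (lHom A F G)"
      using PiE_mem[OF PiE_mem[OF eHom_closed F] G] by (auto simp: frame_homs_def enriched_sets_def)
    then show ?thesis
      using functionalD(1)[OF func.gen_functional(1) xy] by (rule funcset_mem)
  qed
  have app: "t F x \<in> eOb Q F" if "t \<in> Mor ?D P Q" "F \<in> lObj A" "x \<in> eOb P F" for t P Q F x
    using that unfolding mor by auto
  have ext: "t \<in> extensional (lObj A)" "F \<in> lObj A \<Longrightarrow> t F \<in> extensional (eOb P F)" if "t \<in> Mor ?D P Q" for t P Q F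
    using that by (auto simp: mor PiE_iff)
  have idn: "Idn ?D P = (\<lambda>F\<in>lObj A. \<lambda>x\<in>eOb P F. x)" for P by (simp add: enriched_functor_cat_def)
  have cmp: "Cmp ?D P Q S s t = (\<lambda>F\<in>lObj A. compose (eOb P F) (s F) (t F))" for P Q S s t
    by (simp add: enriched_functor_cat_def)
  show ?thesis
  proof
    fix P assume P: "P \<in> Ob ?D"
    show "Idn ?D P \<in> Mor ?D P P"
      unfolding mor idn
    proof (intro conjI ballI)
      fix F G x y assume a: "F \<in> lObj A" "G \<in> lObj A" "x \<in> eOb P F" "y \<in> eOb P G"
      interpret frame_lattice "lHom A F G" by (rule frame[OF P a(1,2)])
      show "?g P F G x y \<sqsubseteq>\<^bsub>lHom A F G\<^esub> ?g P F G ((\<lambda>F\<in>lObj A. \<lambda>x\<in>eOb P F. x) F x) ((\<lambda>F\<in>lObj A. \<lambda>x\<in>eOb P F. x) G y)"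
        using a closed[OF P a] by simp
    qed auto
  next
    fix P Q t assume P: "P \<in> Ob ?D" and t: "t \<in> Mor ?D P Q"
    show "Cmp ?D P P Q t (Idn ?D P) = t"
      by (rule extensionalityI[OF _ ext(1)[OF t]])
        (auto simp: cmp idn compose_def intro!: extensionalityI[OF _ ext(2)[OF t]])
    show "Cmp ?D P Q Q (Idn ?D Q) t = t"
      by (rule extensionalityI[OF _ ext(1)[OF t]])
        (auto simp: cmp idn compose_def app[OF t] intro!: extensionalityI[OF _ ext(2)[OF t]])
  next
    fix P Q S s t assume P: "P \<in> Ob ?D" and Q: "Q \<in> Ob ?D" and S: "S \<in> Ob ?D"
      and t: "t \<in> Mor ?D P Q" and s: "s \<in> Mor ?D Q S"
    show "Cmp ?D P Q S s t \<in> Mor ?D P S"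
      unfolding mor
    proof (intro conjI ballI)
      show "Cmp ?D P Q S s t \<in> (\<Pi>\<^sub>E F\<in>lObj A. eOb P F \<rightarrow>\<^sub>E eOb S F)"
        using app[OF t] app[OF s] by (auto simp: cmp compose_def)
      fix F G x y assume a: "F \<in> lObj A" "G \<in> lObj A" "x \<in> eOb P F" "y \<in> eOb P G"
      interpret frame_lattice "lHom A F G" by (rule frame[OF P a(1,2)])
      note tx = app[OF t a(1,3)] app[OF t a(2,4)]
      note sx = app[OF s a(1) tx(1)] app[OF s a(2) tx(2)]
      have "?g P F G x y \<sqsubseteq>\<^bsub>lHom A F G\<^esub> ?g Q F G (t F x) (t G y)" using t a unfolding mor by blast
      moreover have "?g Q F G (t F x) (t G y) \<sqsubseteq>\<^bsub>lHom A F G\<^esub> ?g S F G (s F (t F x)) (s G (t G y))"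
        using s a tx unfolding mor by blast
      ultimately have "?g P F G x y \<sqsubseteq>\<^bsub>lHom A F G\<^esub> ?g S F G (s F (t F x)) (s G (t G y))"
        by (rule le_trans[OF _ _ closed[OF P a] closed[OF Q a(1,2) tx] closed[OF S a(1,2) sx]])
      then show "?g P F G x y \<sqsubseteq>\<^bsub>lHom A F G\<^esub> ?g S F G (Cmp ?D P Q S s t F x) (Cmp ?D P Q S s t G y)"
        using a by (simp add: cmp compose_def)
    qed
  next
    fix P Q S T r s t assume "r \<in> Mor ?D P Q"
    then show "Cmp ?D P S T t (Cmp ?D P Q S s r) = Cmp ?D P Q T (Cmp ?D Q S T t s) r"
      using app[of r P Q] by (auto simp: cmp compose_def fun_eq_iff)
  qed
qed

text \<open>The naturality relation between generators at \<open>X\<close> and at \<open>Y\<close>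
  is the condition for the family of the \<open>F f\<close> to be an enriched transformation, and
  functoriality is that of each \<open>F\<close>. \<open>E\<close> is described only by its values
  on objects and generators, which covers \<open>ev\<close> for \<open>lFunc\<close> as well as
  \<open>ev_bij\<close>.\<close>

lemma (in bij_or_func) ev_functor:
  fixes C :: "('o, 'a) cat"
    and E :: "'o \<Rightarrow> (('o, 'a, 'v) set_funct, ('o \<times> 'v \<times> 'v) set set, 'v set, ('v \<times> 'v) set set) efunct"
  assumes C: "category C"
    and E: "\<And>X. X \<in> Ob C \<Longrightarrow> enriched_functor (enriched_functors R C) (enriched_sets lFunc) (E X)"
    and Ob: "\<And>X F. X \<in> Ob C \<Longrightarrow> F \<in> set_functors C \<Longrightarrow> eOb (E X) F = fOb F X"
    and gen: "\<And>X F G x y. \<lbrakk>X \<in> Ob C; F \<in> set_functors C; G \<in> set_functors C; x \<in> fOb F X; y \<in> fOb G X\<rbrakk>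
      \<Longrightarrow> eHom (E X) F G (gen (lFunc (fOb F X) (fOb G X)) (x, y)) = gen (nat_pres R C F G) (X, x, y)"
  shows "cat_functor C (enriched_functor_cat (enriched_functors R C)) (ev_functor C E)"
proof -
  interpret C: category C by fact
  let ?A = "enriched_functors R C"
  let ?D = "enriched_functor_cat ?A"
  interpret D: category ?D by (rule enriched_functors_category)
  have A: "lObj ?A = set_functors C" "lHom ?A = nat_loc R C" by (simp_all add: enriched_functors_def)
  have le: "le (nat_loc R C F G) = (\<subseteq>)" for F G by (simp add: presented_def)
  have mor: "(\<lambda>F\<in>set_functors C. fMor F X Y f) \<in> Mor ?D (E X) (E Y)"
    if X: "X \<in> Ob C" and Y: "Y \<in> Ob C" and f: "f \<in> Mor C X Y" for X Y f
  proof -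
    have "fMor F X Y f \<in> eOb (E X) F \<rightarrow>\<^sub>E eOb (E Y) F" if "F \<in> set_functors C" for F
      using set_functor_maps[OF that X Y f] Ob[OF X that] Ob[OF Y that] by simp
    moreover have "eHom (E X) F G (gen (lFunc (eOb (E X) F) (eOb (E X) G)) (x, y)) \<subseteq>
        eHom (E Y) F G (gen (lFunc (eOb (E Y) F) (eOb (E Y) G)) (fMor F X Y f x, fMor G X Y f y))"
      if F: "F \<in> set_functors C" and G: "G \<in> set_functors C" and xy: "x \<in> eOb (E X) F" "y \<in> eOb (E X) G" for F G x y
      using xy nat_gen_natural[OF F G X Y f] set_functor_closed[OF F X Y f] set_functor_closed[OF G X Y f]
      by (simp add: Ob X Y F G gen)
    ultimately show ?thesis
      unfolding enriched_functor_cat_def cat.simps A le by auto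
  qed
  show ?thesis
  proof
    show "fOb (ev_functor C E) \<in> Ob C \<rightarrow>\<^sub>E Ob ?D"
      using E by (auto simp: ev_functor_def enriched_functor_cat_def)
    show "fMor (ev_functor C E) \<in> (\<Pi>\<^sub>E X\<in>Ob C. \<Pi>\<^sub>E Y\<in>Ob C.
        Mor C X Y \<rightarrow>\<^sub>E Mor ?D (fOb (ev_functor C E) X) (fOb (ev_functor C E) Y))"
      using mor by (auto simp: ev_functor_def)
  next
    fix X assume X: "X \<in> Ob C"
    have "fMor F X X (Idn C X) = (\<lambda>x\<in>eOb (E X) F. x)" if F: "F \<in> set_functors C" for F
    proof -
      interpret cat_functor C set_cat F using F by (simp add: functor_cat_def)
      show ?thesis using fMor_Idn[OF X] Ob[OF X F] by (simp add: set_cat_def)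
    qed
    then show "fMor (ev_functor C E) X X (Idn C X) = Idn ?D (fOb (ev_functor C E) X)"
      using X C.Idn_closed[OF X] by (auto simp: ev_functor_def enriched_functor_cat_def A intro!: restrict_ext)
  next
    fix X Y Z f g assume a: "X \<in> Ob C" "Y \<in> Ob C" "Z \<in> Ob C" "f \<in> Mor C X Y" "g \<in> Mor C Y Z"
    have "fMor F X Z (Cmp C X Y Z g f) = compose (eOb (E X) F) (fMor F Y Z g) (fMor F X Y f)"
      if F: "F \<in> set_functors C" for F
    proof -
      interpret cat_functor C set_cat F using F by (simp add: functor_cat_def)
      show ?thesis using fMor_Cmp[OF a] Ob[OF a(1) F] by (simp add: set_cat_def)
    qed
    then show "fMor (ev_functor C E) X Z (Cmp C X Y Z g f) =
        Cmp ?D (fOb (ev_functor C E) X) (fOb (ev_functor C E) Y) (fOb (ev_functor C E) Z)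
          (fMor (ev_functor C E) Y Z g) (fMor (ev_functor C E) X Y f)"
      using a C.Cmp_closed[OF a] by (auto simp: ev_functor_def enriched_functor_cat_def A intro!: restrict_ext)
  qed
qed

text \<open>On generators the unit is the graph of the identity, and the relational composite of two
  graphs is the graph of the composite function; with \<open>nat_point_bij\<close> this identifies
  the underlying category.\<close>

lemma functors_enrichment:
  fixes C :: "('o, 'a) cat"
  assumes C: "category C"
  shows "enrichment (functor_cat C set_cat) (enriched_functors (lFunc :: 'v set_pres) C) (nat_point C)"
proof -
  let ?A = "enriched_functors (lFunc :: 'v set_pres) C" and ?D = "functor_cat C (set_cat :: ('v set, 'v \<Rightarrow> 'v) cat)"
  interpret A: matrix_lcat ?A "nat_pres lFunc C" "Ob C" fOb "\<lambda>X x y. (X, x, y)"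
    by (rule func.functors_matrix)
  interpret D: category ?D by (rule functor_category[OF C set_category])
  interpret U: category "underlying_cat ?A" by (rule A.underlying_category)
  have o: "lObj ?A = Ob ?D" by (simp add: enriched_functors_def)
  have U: "Ob (underlying_cat ?A) = Ob ?D" "Mor (underlying_cat ?A) F G = frame_homs (nat_loc lFunc C F G) two"
    "Idn (underlying_cat ?A) = nat_unit lFunc C" for F G
    by (simp_all add: underlying_cat_def enriched_functors_def)
  have hom: "lHom ?A F G = nat_loc lFunc C F G" for F G by (simp add: enriched_functors_def)
  have tr: "t X x \<in> fOb G X" if "t \<in> Mor ?D F G" "F \<in> Ob ?D" "G \<in> Ob ?D" "X \<in> Ob C" "x \<in> fOb F X" for t F G X x
    using that nat_transf_iff[OF that(2,3)] by (auto simp: PiE_iff)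
  have "cat_functor ?D (underlying_cat ?A)
      \<lparr>fOb = (\<lambda>F\<in>Ob ?D. F), fMor = (\<lambda>F\<in>Ob ?D. \<lambda>G\<in>Ob ?D. \<lambda>t\<in>Mor ?D F G. nat_point C F G t)\<rparr>"
  proof (unfold_locales, unfold funct.simps)
    show "(\<lambda>F\<in>Ob ?D. F) \<in> Ob ?D \<rightarrow>\<^sub>E Ob (underlying_cat ?A)" by (simp add: U)
    show "(\<lambda>F\<in>Ob ?D. \<lambda>G\<in>Ob ?D. \<lambda>t\<in>Mor ?D F G. nat_point C F G t) \<in> (\<Pi>\<^sub>E F\<in>Ob ?D. \<Pi>\<^sub>E G\<in>Ob ?D.
        Mor ?D F G \<rightarrow>\<^sub>E Mor (underlying_cat ?A) ((\<lambda>F\<in>Ob ?D. F) F) ((\<lambda>F\<in>Ob ?D. F) G))"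
      by (auto simp: U nat_point(1))
  next
    fix F assume F: "F \<in> Ob ?D"
    have i: "Idn ?D F \<in> Mor ?D F F" by (rule D.Idn_closed[OF F])
    have idn: "Idn ?D F X x = x" if "X \<in> Ob C" "x \<in> fOb F X" for X x
      using that by (simp add: functor_cat_def set_cat_def)
    have u: "F \<in> lObj ?A" using F by (simp add: o)
    have "nat_point C F F (Idn ?D F) = nat_unit lFunc C F"
    proof (rule A.homs_ext[OF u u two_frame, unfolded hom, OF nat_point(1)[OF F F i] func.nat_unit(1)[OF F]])
      fix X x y assume X: "X \<in> Ob C" "x \<in> fOb F X" "y \<in> fOb F X"
      show "nat_point C F F (Idn ?D F) (gen (nat_pres lFunc C F F) (X, x, y)) =
          nat_unit lFunc C F (gen (nat_pres lFunc C F F) (X, x, y))"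
        unfolding nat_point(2)[OF F F i X] func.nat_unit(2)[OF F X] func.set_unit(2)[OF X(2,3)] idn[OF X(1,2)] ..
    qed
    then show "(\<lambda>F\<in>Ob ?D. \<lambda>G\<in>Ob ?D. \<lambda>t\<in>Mor ?D F G. nat_point C F G t) F F (Idn ?D F) =
        Idn (underlying_cat ?A) ((\<lambda>F\<in>Ob ?D. F) F)"
      using F i by (simp add: U)
  next
    fix F G H t s assume F: "F \<in> Ob ?D" and G: "G \<in> Ob ?D" and H: "H \<in> Ob ?D"
      and t: "t \<in> Mor ?D F G" and s: "s \<in> Mor ?D G H"
    have st: "Cmp ?D F G H s t \<in> Mor ?D F H" by (rule D.Cmp_closed[OF F G H t s])
    have cmp: "Cmp ?D F G H s t X x = s X (t X x)" if "X \<in> Ob C" "x \<in> fOb F X" for X x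
      using that by (simp add: functor_cat_def set_cat_def compose_def)
    have u: "F \<in> lObj ?A" "G \<in> lObj ?A" "H \<in> lObj ?A" using F G H by (simp_all add: o)
    note c = A.underlying_Cmp[OF u, unfolded hom, OF nat_point(1)[OF F G t] nat_point(1)[OF G H s]]
    have "nat_point C F H (Cmp ?D F G H s t) =
        Cmp (underlying_cat ?A) F G H (nat_point C G H s) (nat_point C F G t)"
    proof (rule A.homs_ext[OF u(1,3) two_frame, unfolded hom, OF nat_point(1)[OF F H st] c(1)])
      fix X x y assume X: "X \<in> Ob C" "x \<in> fOb F X" "y \<in> fOb H X"
      have "(\<exists>z\<in>fOb G X. nat_point C F G t (gen (nat_pres lFunc C F G) (X, x, z)) \<and>
          nat_point C G H s (gen (nat_pres lFunc C G H) (X, z, y))) \<longleftrightarrow> (\<exists>z\<in>fOb G X. t X x = z \<and> s X z = y)"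
        using X by (intro bex_cong refl) (simp add: nat_point(2)[OF F G t] nat_point(2)[OF G H s])
      \<comment> \<open>The only possible intermediate element is \<open>t X x\<close>, which lies
        in \<open>fOb G X\<close>.\<close>
      then show "nat_point C F H (Cmp ?D F G H s t) (gen (nat_pres lFunc C F H) (X, x, y)) =
          Cmp (underlying_cat ?A) F G H (nat_point C G H s) (nat_point C F G t) (gen (nat_pres lFunc C F H) (X, x, y))"
        unfolding c(2)[OF X] nat_point(2)[OF F H st X] cmp[OF X(1,2)]
        using tr[OF t F G X(1,2)] by simp
    qed
    then show "(\<lambda>F\<in>Ob ?D. \<lambda>G\<in>Ob ?D. \<lambda>t\<in>Mor ?D F G. nat_point C F G t) F H (Cmp ?D F G H s t) =
        Cmp (underlying_cat ?A) ((\<lambda>F\<in>Ob ?D. F) F) ((\<lambda>F\<in>Ob ?D. F) G) ((\<lambda>F\<in>Ob ?D. F) H)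
          ((\<lambda>F\<in>Ob ?D. \<lambda>G\<in>Ob ?D. \<lambda>t\<in>Mor ?D F G. nat_point C F G t) G H s)
          ((\<lambda>F\<in>Ob ?D. \<lambda>G\<in>Ob ?D. \<lambda>t\<in>Mor ?D F G. nat_point C F G t) F G t)"
      using F G H s t st by simp
  qed
  then show ?thesis
    unfolding enrichment_def U using A.is_localic_category o nat_point_bij by blast
qed

theorem proposition2p1p4:
  fixes C :: "('o, 'a) cat"
  assumes "category C"
  shows
    "(\<forall>F\<in>set_functors C. \<forall>G\<in>set_functors C. \<forall>H\<in>set_functors C.
        nat_mult (lFunc :: 'v set_pres) C F H G
          \<in> frame_homs (nat_loc lFunc C F G) (nat_loc lFunc C F H \<otimes> nat_loc lFunc C H G) \<and>
        (\<forall>X\<in>Ob C. \<forall>x\<in>fOb F X. \<forall>y\<in>fOb G X.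
           nat_mult lFunc C F H G (gen (nat_pres lFunc C F G) (X, x, y)) =
           lam_tensor lFunc C X F H G
             (set_mult lFunc (fOb F X) (fOb H X) (fOb G X)
               (gen (lFunc (fOb F X) (fOb G X)) (x, y))))) \<and>
     (\<forall>F\<in>set_functors C.
        nat_unit (lFunc :: 'v set_pres) C F \<in> frame_homs (nat_loc lFunc C F F) two \<and>
        (\<forall>X\<in>Ob C. \<forall>x\<in>fOb F X. \<forall>y\<in>fOb F X.
           nat_unit lFunc C F (gen (nat_pres lFunc C F F) (X, x, y)) =
           set_unit lFunc (fOb F X) (gen (lFunc (fOb F X) (fOb F X)) (x, y)))) \<and>
     enrichment (functor_cat C set_cat) (enriched_functors (lFunc :: 'v set_pres) C)
       (nat_point C) \<and>
     (\<forall>X\<in>Ob C.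
        enriched_functor (enriched_functors (lFunc :: 'v set_pres) C) (enriched_sets lFunc)
          (ev lFunc C X)) \<and>
     (\<forall>X\<in>Ob C. \<forall>F\<in>set_functors C. \<forall>G\<in>set_functors C. \<forall>t\<in>Mor (functor_cat C set_cat) F G.
        compose (carrier (presented (lFunc (fOb F X) (fOb G X))))
          (nat_point C F G t) (lam (lFunc :: 'v set_pres) C X F G) =
        function_point (fOb F X) (fOb G X) (t X)) \<and>
     cat_functor C (enriched_functor_cat (enriched_functors (lFunc :: 'v set_pres) C))
       (ev_functor C (ev lFunc C)) \<and>

     (\<forall>F\<in>set_functors C. \<forall>G\<in>set_functors C. \<forall>H\<in>set_functors C.
        nat_mult (lBij :: 'v set_pres) C F H G
          \<in> frame_homs (nat_loc lBij C F G) (nat_loc lBij C F H \<otimes> nat_loc lBij C H G) \<and>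
        (\<forall>X\<in>Ob C. \<forall>x\<in>fOb F X. \<forall>y\<in>fOb G X.
           nat_mult lBij C F H G (gen (nat_pres lBij C F G) (X, x, y)) =
           lam_tensor lBij C X F H G
             (set_mult lBij (fOb F X) (fOb H X) (fOb G X)
               (gen (lBij (fOb F X) (fOb G X)) (x, y))))) \<and>
     (\<forall>F\<in>set_functors C.
        nat_unit (lBij :: 'v set_pres) C F \<in> frame_homs (nat_loc lBij C F F) two \<and>
        (\<forall>X\<in>Ob C. \<forall>x\<in>fOb F X. \<forall>y\<in>fOb F X.
           nat_unit lBij C F (gen (nat_pres lBij C F F) (X, x, y)) =
           set_unit lBij (fOb F X) (gen (lBij (fOb F X) (fOb F X)) (x, y)))) \<and>
     (\<forall>F\<in>set_functors C. \<forall>G\<in>set_functors C.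
        nat_inv (lBij :: 'v set_pres) C F G \<in> frame_homs (nat_loc lBij C F G) (nat_loc lBij C G F) \<and>
        (\<forall>X\<in>Ob C. \<forall>x\<in>fOb F X. \<forall>y\<in>fOb G X.
           nat_inv lBij C F G (gen (nat_pres lBij C F G) (X, x, y)) =
           lam lBij C X G F
             (set_inv lBij (fOb F X) (fOb G X) (gen (lBij (fOb F X) (fOb G X)) (x, y))))) \<and>
     localic_groupoid (enriched_functors (lBij :: 'v set_pres) C) (nat_inv lBij C) \<and>
     (\<forall>X\<in>Ob C.
        enriched_functor (enriched_functors (lBij :: 'v set_pres) C) (enriched_sets lBij)
          (ev lBij C X) \<and>
        enriched_functor (enriched_functors (lBij :: 'v set_pres) C) (enriched_sets lFunc)
          (ev_bij C X)) \<and>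
     cat_functor C (enriched_functor_cat (enriched_functors (lBij :: 'v set_pres) C))
       (ev_functor C (ev_bij C))"
proof (intro conjI ballI)
  show "cat_functor C (enriched_functor_cat (enriched_functors (lFunc :: 'v set_pres) C)) (ev_functor C (ev lFunc C))"
    by (rule func.ev_functor[OF assms func.ev_enriched]) (simp_all add: ev_def func.lam_gen)
  show "cat_functor C (enriched_functor_cat (enriched_functors (lBij :: 'v set_pres) C)) (ev_functor C (ev_bij C))"
    by (rule bij.ev_functor[OF assms ev_bij_enriched(1,3,2)])
  show "enrichment (functor_cat C set_cat) (enriched_functors (lFunc :: 'v set_pres) C) (nat_point C)"
    by (rule functors_enrichment[OF assms])
  show "localic_groupoid (enriched_functors (lBij :: 'v set_pres) C) (nat_inv lBij C)"
    by (rule bij.functors_groupoid) simp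
qed (rule func.nat_mult func.nat_unit bij.nat_mult bij.nat_unit func.ev_enriched bij.ev_enriched ev_bij_enriched
    nat_point_lam bij.nat_inv; simp)+

end
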